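(* Let $g\in\mathcal{S}_d$ and $h\in\mathcal{T}_d$ for some $d\ge2$. Let $f=g+h\in\mathcal{R}_d$, and assume that $\mathrm{ann}_S(g)_1=\mathrm{ann}_T(h)_1=0$. Let $$\mathcal{F}:0\to F_s\to\dots\to F_1\to\mathrm{ann}_S(g)\to0,\qquad \mathcal{G}:0\to G_t\to\dots\to G_1\to\mathrm{ann}_T(h)\to0$$ be graded minimal free resolutions of $\mathrm{ann}_S(g)\subseteq S$ and $\mathrm{ann}_T(h)\subseteq T$. Denote the shifted graded Betti numbers of $S/\mathrm{ann}_S(g)$ and $T/\mathrm{ann}_T(h)$ by $\hat\beta^g_{ij}$ and $\hat\beta^h_{ij}$, respectively; that is, for every $i$, $$F_i=\bigoplus_{j=0}^d\hat\beta^g_{ij}\,S(-i-j),\qquad G_i=\bigoplus_{j=0}^d\hat\beta^h_{ij}\,T(-i-j).$$ Then $\mathrm{ann}_R(f)\subseteq R=S\otimes_KT$ has a graded minimal free resolution $$\mathcal{H}:0\to H_r\to\dots\to H_1\to\mathrm{ann}_R(f)\to0$$ with $H_r=R(-r-d)$ and, for all $0<k<r$, $$H_k=\nu_k\,R(-k-1)\oplus\nu_{r-k}\,R(-d-k+1)\oplus\Biggl(\bigoplus_{j=1}^{d-1}\biggl(\sum_{i=1}^{s-1}\binom{r-s}{k-i}\hat\beta^g_{ij}+\sum_{i=1}^{t-1}\binom{r-t}{k-i}\hat\beta^h_{ij}\biggr)R(-k-j)\Biggr).$$ Here $r=s+t$ and $\nu_k=\binom{r}{k+1}-\binom{s}{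k+1}-\binom{t}{k+1}$.
   Context: $K$ is a field. $R=K[\partial_1,\dots,\partial_r]$ is a standard graded polynomial ring and $\mathcal{R}=K[x_1,\dots,x_r]^{DP}=\bigoplus_d\mathcal{R}_d$ is the divided power ring: $\mathcal{R}_d$ has $K$-basis $x^{(\alpha)}=\prod_ix_i^{(\alpha_i)}$, $|\alpha|=d$, with multiplication generated by $x_i^{(a)}x_i^{(b)}=\binom{a+b}{a}x_i^{(a+b)}$; $R$ acts on $\mathcal{R}$ by $\partial^\beta(x^{(\alpha)})=x^{(\alpha-\beta)}$ (zero if some $\alpha_i<\beta_i$). Given $r=s+t$ with $s,t\ge1$, after a linear change of variables, $\mathcal{S}=K[x_1,\dots,x_s]^{DP}$, $\mathcal{T}=K[x_{s+1},\dots,x_r]^{DP}$, $S=K[\partial_1,\dots,\partial_s]$, $T=K[\partial_{s+1},\dots,\partial_r]$, so that $\mathcal{R}=\mathcal{S}\otimes_K\mathcal{T}$ and $R=S\otimes_KT$; $S$ and $T$ act on $\mathcal{S}$ and $\mathcal{T}$ by restriction of the action of $R$ on $\mathcal{R}$ given by $\partial^\beta(x^{(\alpha)})=x^{(\alpha-\beta)}$. $\mathrm{ann}_S(g)=\{D\in S:Dg=0\}$, and similarly $\mathrm{ann}_T(h)$, $\mathrm{ann}_R(f)$; the subscript $1$ denotes the degree $1$ part. For a nonnegative integer $m$ and free module $N$, $mN$ denotes $N^{\oplus m}$. Convention: $\binom ab=0$ for $b<0$ and for $b>a$. *)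

theory Defs
  imports "HOL-Library.Poly_Mapping" "HOL-Library.Multiset" Complex_Main
begin

text \<open>
  An exponent vector is a finitely supported function from variable indices to \<open>nat\<close>, and
  a finitely supported function from exponent vectors to \<open>K\<close> is a \<open>K\<close>-linear combination of
  monomials. The type \<open>'k mpoly\<close> is used with the ring structure of \<open>Poly_Mapping\<close>, which is
  that of the ordinary polynomial ring in the \<open>\<partial>\<^sub>i\<close>. The type \<open>'k dpoly\<close> has as its
  basis the divided monomials \<open>x\<^sup>(\<^sup>\<alpha>\<^sup>)\<close>; only its \<open>K\<close>-vector space structure and the
  action of the polynomial ring on it are ever used. In particular the product that the
  type inherits from \<open>Poly_Mapping\<close>, which is not the divided power product, plays no role.
\<close>

type_synonym expo = "nat \<Rightarrow>\<^sub>0 nat"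
type_synonym 'k mpoly = "expo \<Rightarrow>\<^sub>0 'k"
type_synonym 'k dpoly = "expo \<Rightarrow>\<^sub>0 'k"

definition mdeg :: "expo \<Rightarrow> nat" where
  "mdeg m = (\<Sum>i\<in>Poly_Mapping.keys m. Poly_Mapping.lookup m i)"

text \<open>
  The polynomial ring, or the divided power ring, in the variables with index in \<open>V\<close>,
  and the elements that are homogeneous of degree \<open>e\<close> (only \<open>0\<close> if \<open>e < 0\<close>).
\<close>

definition in_vars :: "nat set \<Rightarrow> (expo \<Rightarrow>\<^sub>0 'k::zero) set" where
  "in_vars V = {p. \<forall>m\<in>Poly_Mapping.keys p. Poly_Mapping.keys m \<subseteq> V}"

definition homog :: "int \<Rightarrow> (expo \<Rightarrow>\<^sub>0 'k::zero) set" where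
  "homog e = {p. \<forall>m\<in>Poly_Mapping.keys p. int (mdeg m) = e}"

text \<open>
  The action given by \<open>\<partial>\<^sup>\<beta> (x\<^sup>(\<^sup>\<alpha>\<^sup>)) = x\<^sup>(\<^sup>\<alpha>\<^sup>-\<^sup>\<beta>\<^sup>)\<close>, extended bilinearly. The condition \<open>\<beta> \<le> \<alpha>\<close>
  is spelled out componentwise because \<open>\<le>\<close> on \<open>poly_mapping\<close> is lexicographic.
\<close>

definition contract :: "'k::field mpoly \<Rightarrow> 'k dpoly \<Rightarrow> 'k dpoly" where
  "contract D f = (\<Sum>\<beta>\<in>Poly_Mapping.keys D. \<Sum>\<alpha>\<in>Poly_Mapping.keys f.
     if \<forall>i. Poly_Mapping.lookup \<beta> i \<le> Poly_Mapping.lookup \<alpha> i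
     then Poly_Mapping.single (\<alpha> - \<beta>) (Poly_Mapping.lookup D \<beta> * Poly_Mapping.lookup f \<alpha>) else 0)"

definition ann :: "nat set \<Rightarrow> 'k::field dpoly \<Rightarrow> 'k mpoly set" where
  "ann V f = {D \<in> in_vars V. contract D f = 0}"

text \<open>
  In the following, \<open>A\<close> is the polynomial ring in the variables with index in \<open>V\<close>. The
  list of integers \<open>[a\<^sub>0, \<dots>, a\<^sub>n\<^sub>-\<^sub>1]\<close> stands for the graded free module
  \<open>A(-a\<^sub>0) \<oplus> \<dots> \<oplus> A(-a\<^sub>n\<^sub>-\<^sub>1)\<close>. Its elements are the functions \<open>u\<close> with \<open>u l \<in> A\<close> for \<open>l < n\<close>, extended
  by \<open>0\<close> for \<open>l \<ge> n\<close>. The empty list stands for the zero module.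
\<close>

definition free_mod :: "nat set \<Rightarrow> int list \<Rightarrow> (nat \<Rightarrow> 'k::field mpoly) set" where
  "free_mod V a = {u. (\<forall>l<length a. u l \<in> in_vars V) \<and> (\<forall>l\<ge>length a. u l = 0)}"

definition free_mod_deg :: "nat set \<Rightarrow> int list \<Rightarrow> int \<Rightarrow> (nat \<Rightarrow> 'k::field mpoly) set" where
  "free_mod_deg V a e = {u \<in> free_mod V a. \<forall>l<length a. u l \<in> homog (e - a ! l)}"

text \<open>
  The submodule \<open>\<mm>F\<close> of the free module \<open>F\<close>, with \<open>\<mm>\<close> the ideal of \<open>A\<close> generated by the variables,
  that is, the ideal of polynomials with zero constant term.
\<close>

definition max_free_mod :: "nat set \<Rightarrow> int list \<Rightarrow> (nat \<Rightarrow> 'k::field mpoly) set" where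
  "max_free_mod V a = {u \<in> free_mod V a. \<forall>l. Poly_Mapping.lookup (u l) 0 = 0}"

text \<open>\<open>A\<close>-linear maps of degree \<open>0\<close>.\<close>

definition graded_hom ::
  "nat set \<Rightarrow> int list \<Rightarrow> int list \<Rightarrow> ((nat \<Rightarrow> 'k::field mpoly) \<Rightarrow> (nat \<Rightarrow> 'k mpoly)) \<Rightarrow> bool" where
  "graded_hom V a b \<phi> \<longleftrightarrow>
     (\<forall>u\<in>free_mod V a. \<phi> u \<in> free_mod V b) \<and>
     (\<forall>u\<in>free_mod V a. \<forall>v\<in>free_mod V a. \<phi> (\<lambda>l. u l + v l) = (\<lambda>l. \<phi> u l + \<phi> v l)) \<and>
     (\<forall>p\<in>in_vars V. \<forall>u\<in>free_mod V a. \<phi> (\<lambda>l. p * u l) = (\<lambda>l. p * \<phi> u l)) \<and>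
     (\<forall>e. \<forall>u\<in>free_mod_deg V a e. \<phi> u \<in> free_mod_deg V b e)"

text \<open>
  A graded minimal free resolution \<open>0 \<rightarrow> F n \<rightarrow> \<dots> \<rightarrow> F 1 \<rightarrow> I \<rightarrow> 0\<close> of the ideal \<open>I\<close> of \<open>A\<close>, with
  \<open>\<epsilon> : F 1 \<rightarrow> I\<close> and \<open>\<delta> i : F (i + 1) \<rightarrow> F i\<close> for \<open>i \<ge> 1\<close>, where \<open>F i = 0\<close> for \<open>i > n\<close>; the
  value \<open>F 0\<close> is irrelevant. The first two conditions on \<open>\<epsilon>\<close> say that it is
  a homomorphism to \<open>A = A(0)\<close> with image \<open>I\<close>.
\<close>

definition graded_min_free_res ::
  "nat set \<Rightarrow> nat \<Rightarrow> 'k::field mpoly set \<Rightarrow> (nat \<Rightarrow> int list) \<Rightarrow>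
   (nat \<Rightarrow> (nat \<Rightarrow> 'k mpoly) \<Rightarrow> (nat \<Rightarrow> 'k mpoly)) \<Rightarrow> ((nat \<Rightarrow> 'k mpoly) \<Rightarrow> 'k mpoly) \<Rightarrow> bool" where
  "graded_min_free_res V n I F \<delta> \<epsilon> \<longleftrightarrow>
     (\<forall>i>n. F i = []) \<and>
     graded_hom V (F 1) [0] (\<lambda>u l. if l = 0 then \<epsilon> u else 0) \<and>
     \<epsilon> ` free_mod V (F 1) = I \<and>
     (\<forall>i\<ge>1. graded_hom V (F (i + 1)) (F i) (\<delta> i)) \<and>
     {u \<in> free_mod V (F 1). \<epsilon> u = 0} = \<delta> 1 ` free_mod V (F 2) \<and>
     (\<forall>i\<ge>1. {u \<in> free_mod V (F (i + 1)). \<delta> i u = (\<lambda>l. 0)} = \<delta> (i + 1) ` free_mod V (F (i + 2))) \<and>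
     (\<forall>i\<ge>1. \<delta> i ` free_mod V (F (i + 1)) \<subseteq> max_free_mod V (F i))"

text \<open>
  The shifted graded Betti number \<open>\<beta>\<^sub>i\<^sub>j\<close> read off from a minimal resolution: the number of
  summands \<open>A(-i-j)\<close> of \<open>F i\<close>.
\<close>

definition shifted_betti :: "(nat \<Rightarrow> int list) \<Rightarrow> nat \<Rightarrow> nat \<Rightarrow> nat" where
  "shifted_betti F i j = count (mset (F i)) (int i + int j)"

text \<open>The binomial coefficient with the convention that it vanishes for \<open>b < 0\<close> and for \<open>b > a\<close>.\<close>

definition bin :: "nat \<Rightarrow> int \<Rightarrow> nat" where
  "bin a b = (if b < 0 then 0 else a choose nat b)"

text \<open>
  For \<open>r = s + t\<close> the truncated subtraction on \<open>nat\<close> agrees with the one on integers: the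
  subsets of size \<open>k + 1\<close> of two disjoint sets with \<open>s\<close> and \<open>t\<close> elements are distinct subsets
  of their union.
\<close>

definition nu :: "nat \<Rightarrow> nat \<Rightarrow> nat \<Rightarrow> nat" where
  "nu s t k = ((s + t) choose (k + 1)) - (s choose (k + 1)) - (t choose (k + 1))"

end

theory Submission
  imports Defs "HOL-Library.Function_Algebras"
begin

text \<open>
  The ring \<open>R\<close> acts on the inverse system \<open>M\<^sub>f = {D f. D \<in> R}\<close> of \<open>f\<close>, and \<open>D \<mapsto> D f\<close> identifies
  \<open>R / ann f\<close> with \<open>M\<^sub>f\<close>. It is graded so that \<open>D f\<close> has the degree of \<open>D\<close>, and it is finite
  dimensional with pieces only in the degrees \<open>0, \<dots>, d\<close>. The proof reads all graded Betti numbers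
  off \<open>M\<^sub>f\<close> by Koszul homology, and compares \<open>M\<^sub>f\<close> with \<open>M\<^sub>g\<close> and \<open>M\<^sub>h\<close> degree by degree.

  Betti numbers are Koszul homology. If a graded free module \<open>F\<close> maps onto a graded module \<open>M\<close> with
  kernel \<open>N \<subseteq> \<mm>F\<close>, then \<open>H\<^sub>0(M) = M / \<mm>M\<close> counts the generators of \<open>F\<close>
  (lemma \<open>has_betti_0\<close>), and \<open>H\<^sub>k\<^sub>+\<^sub>1(M)\<close> is isomorphic to \<open>H\<^sub>k(N)\<close> (lemma
  \<open>has_betti_shift\<close>), because the Koszul complex of \<open>F\<close> is exact (lemma \<open>koszul_exact\<close>). Along
  any minimal resolution this shows that \<open>F\<^sub>i\<close> has \<open>dim H\<^sub>i(M\<^sub>f)\<^sub>e\<close> summands \<open>R(-e)\<close>. It also yields a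
  minimal resolution in the first place: since \<open>M\<^sub>f\<close> is finite dimensional, each syzygy module has a
  finite dimensional \<open>H\<^sub>0\<close>, lifts of a basis of \<open>H\<^sub>0\<close> generate it (lemma \<open>exists_minimal_cover\<close>),
  and as there are no Koszul chains beyond the number of variables, the process stops there.

  Koszul homology of a connected sum. A variable that annihilates \<open>M\<close> splits the Koszul complex
  into two copies of the complex without it; this gives the binomial coefficients in the formula
  when \<open>M\<^sub>g\<close> is regarded as an \<open>R\<close>-module (lemma \<open>betti_zero_variables\<close>). In the degrees
  \<open>1, \<dots>, d - 1\<close> the module \<open>M\<^sub>f\<close> is the direct sum of \<open>M\<^sub>g\<close> and \<open>M\<^sub>h\<close>. The three modules differ only
  in degree \<open>0\<close>, which is spanned by \<open>f\<close>, \<open>g\<close>, \<open>h\<close> respectively, and in degree \<open>d\<close>, which each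
  time is spanned by \<open>1\<close>. A Betti number is the dimension of a space of chains minus the ranks of two
  Koszul differentials, so only the ranks of the differentials that leave degree \<open>0\<close> or arrive in
  degree \<open>d\<close> break additivity. These ranks count sets of variables (lemmas \<open>krank_bottom\<close> and
  \<open>krank_top\<close>), since by \<open>ann(g)\<^sub>1 = 0\<close> the derivatives \<open>\<partial>\<^sub>v g\<close> are independent and every variable
  \<open>x\<^sub>v\<close> is a derivative of \<open>g\<close> of order \<open>d - 1\<close>. The defects at the two ends are \<open>\<nu>\<^sub>k\<close> and
  \<open>\<nu>\<^sub>r\<^sub>-\<^sub>k\<close> (theorem \<open>betti_connected_sum\<close>).

  All modules, \<open>M\<^sub>f\<close> included, consist of functions from \<open>nat\<close> to polynomials, so that one type
  of Koszul chains serves them all; \<open>M\<^sub>f\<close> occupies the component \<open>0\<close>.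
\<close>

section \<open>Dimensions of quotient spaces\<close>

definition qbasis ::
  "('k::field \<Rightarrow> 'v::ab_group_add \<Rightarrow> 'v) \<Rightarrow> 'v set \<Rightarrow> 'v set \<Rightarrow> 'i set \<Rightarrow> ('i \<Rightarrow> 'v) \<Rightarrow> bool" where
  "qbasis sc P Q A b \<longleftrightarrow> (\<forall>i\<in>A. b i \<in> P) \<and>
     (\<forall>c. (\<Sum>i\<in>A. sc (c i) (b i)) \<in> Q \<longrightarrow> (\<forall>i\<in>A. c i = 0)) \<and>
     (\<forall>p\<in>P. \<exists>c. p - (\<Sum>i\<in>A. sc (c i) (b i)) \<in> Q)"

text \<open>
  The dimension of \<open>P / Q\<close> as a relation: it says that the dimension is finite, and the ambient
  spaces, which are infinite dimensional, need no quotient type.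
\<close>

definition qdim ::
  "('k::field \<Rightarrow> 'v::ab_group_add \<Rightarrow> 'v) \<Rightarrow> 'v set \<Rightarrow> 'v set \<Rightarrow> nat \<Rightarrow> bool" where
  "qdim sc P Q n \<longleftrightarrow> module.subspace sc P \<and> module.subspace sc Q \<and> Q \<subseteq> P \<and>
     (\<exists>b::nat \<Rightarrow> 'v. qbasis sc P Q {..<n} b)"

text \<open>
  Gaussian elimination on the last equation: an unknown with a nonzero coefficient is eliminated
  from the other equations.
\<close>

lemma nontrivial_solution:
  fixes A :: "'i \<Rightarrow> nat \<Rightarrow> 'k::field"
  assumes "finite I" "n < card I"
  shows "\<exists>x. (\<exists>i\<in>I. x i \<noteq> 0) \<and> (\<forall>j<n. (\<Sum>i\<in>I. x i * A i j) = 0)"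
  using assms
proof (induction n arbitrary: I A)
  case 0
  then obtain p where "p \<in> I" by fastforce
  then show ?case by (intro exI[of _ "\<lambda>_. 1"]) auto
next
  case (Suc n)
  show ?case
  proof (cases "\<forall>i\<in>I. A i n = 0")
    case True
    obtain x where "\<exists>i\<in>I. x i \<noteq> 0" "\<forall>j<n. (\<Sum>i\<in>I. x i * A i j) = 0"
      using Suc.IH[of I A] Suc.prems by auto
    then show ?thesis using True by (intro exI[of _ x]) (auto simp: less_Suc_eq)
  next
    case False
    then obtain p where p: "p \<in> I" "A p n \<noteq> 0" by auto
    define J where "J = I - {p}"
    have J: "finite J" "n < card J" "p \<notin> J" "I = insert p J"
      using Suc.prems p by (auto simp: J_def)
    obtain x where x: "\<exists>i\<in>J. x i \<noteq> 0"
        "\<forall>j<n. (\<Sum>i\<in>J. x i * (A i j - A i n / A p n * A p j)) = 0"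
      using Suc.IH[of J "\<lambda>i j. A i j - A i n / A p n * A p j"] J by auto
    define q where "q = - (\<Sum>i\<in>J. x i * (A i n / A p n))"
    define y where "y = x(p := q)"
    have y: "(\<Sum>i\<in>I. y i * A i j) = (\<Sum>i\<in>J. x i * (A i j - A i n / A p n * A p j))" for j
    proof -
      have "(\<Sum>i\<in>I. y i * A i j) = q * A p j + (\<Sum>i\<in>J. x i * A i j)"
        using J by (auto simp: y_def intro!: sum.cong)
      then show ?thesis
        by (simp add: q_def algebra_simps sum_subtractf sum_distrib_right sum_distrib_left)
    qed
    have "(\<Sum>i\<in>I. y i * A i j) = 0" if "j < Suc n" for j
    proof (cases "j = n")
      case True
      then show ?thesis using p unfolding y by simp
    next
      case False
      then show ?thesis using x(2) that unfolding y by simp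
    qed
    moreover have "\<exists>i\<in>I. y i \<noteq> 0" using x(1) J by (auto simp: y_def)
    ultimately show ?thesis by blast
  qed
qed

lemma qbasis_reindex:
  assumes "qbasis sc P Q A b" "bij_betw f B A"
  shows "qbasis sc P Q B (b \<circ> f)"
proof -
  have s: "(\<Sum>i\<in>B. sc (c (f i)) ((b \<circ> f) i)) = (\<Sum>i\<in>A. sc (c i) (b i))" for c
    using sum.reindex_bij_betw[OF assms(2), of "\<lambda>i. sc (c i) (b i)"] by simp
  have inv: "f (inv_into B f i) = i" if "i \<in> A" for i
    using assms(2) that by (meson bij_betw_inv_into_right)
  have inv2: "inv_into B f (f i) = i" if "i \<in> B" for i
    using assms(2) that by (meson bij_betw_inv_into_left)
  have fB: "f i \<in> A" if "i \<in> B" for i using assms(2) that by (auto simp: bij_betw_def)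
  show ?thesis unfolding qbasis_def
  proof (intro conjI ballI allI impI)
    fix i assume "i \<in> B" then show "(b \<circ> f) i \<in> P" using assms(1) fB by (auto simp: qbasis_def)
  next
    fix c i assume c: "(\<Sum>i\<in>B. sc (c i) ((b \<circ> f) i)) \<in> Q" and i: "i \<in> B"
    have "(\<Sum>i\<in>B. sc (c i) ((b \<circ> f) i)) = (\<Sum>i\<in>B. sc ((c \<circ> inv_into B f) (f i)) ((b \<circ> f) i))"
      by (intro sum.cong) (auto simp: inv2)
    also have "\<dots> = (\<Sum>i\<in>A. sc ((c \<circ> inv_into B f) i) (b i))" by (rule s)
    finally have "\<forall>i\<in>A. (c \<circ> inv_into B f) i = 0" using assms(1) c unfolding qbasis_def by metis
    then show "c i = 0" using inv2[OF i] fB[OF i] by force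
  next
    fix p assume "p \<in> P"
    then obtain c where "p - (\<Sum>i\<in>A. sc (c i) (b i)) \<in> Q" using assms(1) unfolding qbasis_def by metis
    then have "p - (\<Sum>i\<in>B. sc (c (f i)) ((b \<circ> f) i)) \<in> Q" by (subst s)
    then show "\<exists>c. p - (\<Sum>i\<in>B. sc (c i) ((b \<circ> f) i)) \<in> Q" by (rule exI[of _ "\<lambda>i. c (f i)"])
  qed
qed

lemma qdim_obtain_qbasis:
  assumes "qdim sc P Q (card A)" "finite A"
  obtains b where "qbasis sc P Q A b"
proof -
  obtain f where "bij_betw f A {..<card A}"
    using ex_bij_betw_finite_nat[OF assms(2)] by (auto simp: atLeast0LessThan)
  then show ?thesis using assms(1) qbasis_reindex that unfolding qdim_def by blast
qed

context vector_space
begin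

lemma subspace_sum_scale: "subspace Q \<Longrightarrow> (\<And>i. i \<in> A \<Longrightarrow> b i \<in> Q) \<Longrightarrow> (\<Sum>i\<in>A. c i *s b i) \<in> Q"
  by (intro subspace_sum subspace_scale) auto

lemma qdim_qbasis:
  assumes "subspace P" "subspace Q" "Q \<subseteq> P" "finite A" "qbasis scale P Q A b" "card A = n"
  shows "qdim scale P Q n"
proof -
  obtain f where "bij_betw f {..<n} A"
    using ex_bij_betw_nat_finite[OF assms(4)] assms(6) by (auto simp: atLeast0LessThan)
  then show ?thesis using assms qbasis_reindex[OF assms(5)] unfolding qdim_def by blast
qed

text \<open>
  Exchange argument: more than \<open>n\<close> vectors of \<open>P\<close> satisfy a relation modulo \<open>Q\<close>, because their
  coordinates with respect to a basis of \<open>P / Q\<close> satisfy a nontrivial linear system of \<open>n\<close> equations.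
\<close>

lemma qdim_bound:
  assumes "qdim scale P Q n" "finite A" "\<And>i. i \<in> A \<Longrightarrow> b i \<in> P"
    and ind: "\<And>c i. (\<Sum>i\<in>A. c i *s b i) \<in> Q \<Longrightarrow> i \<in> A \<Longrightarrow> c i = 0"
  shows "card A \<le> n"
proof (rule ccontr)
  assume "\<not> card A \<le> n"
  obtain e where e: "qbasis scale P Q {..<n} e" and Q: "subspace Q"
    using assms(1) unfolding qdim_def by blast
  have "\<forall>i\<in>A. \<exists>c. b i - (\<Sum>j<n. c j *s e j) \<in> Q" using e assms(3) unfolding qbasis_def by blast
  then obtain a where a: "\<And>i. i \<in> A \<Longrightarrow> b i - (\<Sum>j<n. a i j *s e j) \<in> Q" by metis
  obtain x where x: "\<exists>i\<in>A. x i \<noteq> 0" "\<forall>j<n. (\<Sum>i\<in>A. x i * a i j) = 0"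
    using nontrivial_solution[OF assms(2), of n a] \<open>\<not> card A \<le> n\<close> by auto
  have "(\<Sum>i\<in>A. x i *s b i) = (\<Sum>i\<in>A. x i *s (b i - (\<Sum>j<n. a i j *s e j))) +
      (\<Sum>i\<in>A. \<Sum>j<n. (x i * a i j) *s e j)"
    by (simp add: scale_right_diff_distrib sum_subtractf scale_sum_right)
  also have "(\<Sum>i\<in>A. \<Sum>j<n. (x i * a i j) *s e j) = (\<Sum>j<n. (\<Sum>i\<in>A. x i * a i j) *s e j)"
    by (subst sum.swap) (simp add: scale_sum_left)
  also have "\<dots> = 0" using x(2) by simp
  finally have "(\<Sum>i\<in>A. x i *s b i) \<in> Q" using a Q by (simp add: subspace_sum_scale)
  then show False using x(1) ind by blast
qed

lemma qdim_unique: "qdim scale P Q n \<Longrightarrow> qdim scale P Q m \<Longrightarrow> n = m"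
proof -
  have "m \<le> n" if n: "qdim scale P Q n" and m: "qdim scale P Q m" for n m
  proof -
    obtain b where "qbasis scale P Q {..<m} b" using m unfolding qdim_def by blast
    then show ?thesis using qdim_bound[OF n, of "{..<m}" b] unfolding qbasis_def by auto
  qed
  then show "qdim scale P Q n \<Longrightarrow> qdim scale P Q m \<Longrightarrow> n = m" by (meson antisym)
qed

text \<open>
  A family in \<open>P\<close> of maximal length that is independent modulo \<open>Q\<close> spans \<open>P\<close> modulo \<open>Q\<close>.
\<close>

lemma qdim_exists:
  assumes P: "subspace P" and Q: "subspace Q" and "Q \<subseteq> P"
    and bound: "\<And>(m::nat) b. (\<And>i. i < m \<Longrightarrow> b i \<in> P) \<Longrightarrow>
      (\<And>c i. (\<Sum>i<m. c i *s b i) \<in> Q \<Longrightarrow> i < m \<Longrightarrow> c i = 0) \<Longrightarrow> m \<le> n"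
  shows "\<exists>m. qdim scale P Q m"
proof -
  define S where "S = {m. \<exists>b::nat \<Rightarrow> 'b. (\<forall>i<m. b i \<in> P) \<and>
    (\<forall>c. (\<Sum>i<m. c i *s b i) \<in> Q \<longrightarrow> (\<forall>i<m. c i = 0))}"
  have "m \<le> n" if m: "m \<in> S" for m
  proof -
    obtain b where "\<forall>i<m. b i \<in> P" "\<forall>c. (\<Sum>i<m. c i *s b i) \<in> Q \<longrightarrow> (\<forall>i<m. c i = 0)"
      using m unfolding S_def by blast
    then show ?thesis using bound[of m b] by blast
  qed
  then have "S \<subseteq> {..n}" by auto
  then have fin: "finite S" using finite_subset by blast
  have "0 \<in> S" by (auto simp: S_def)
  define m where "m = Max S"
  have "m \<in> S" unfolding m_def using fin \<open>0 \<in> S\<close> by (intro Max_in) auto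
  then obtain b where b: "\<forall>i<m. b i \<in> P"
      "\<forall>c. (\<Sum>i<m. c i *s b i) \<in> Q \<longrightarrow> (\<forall>i<m. c i = 0)"
    unfolding S_def by blast
  have "\<exists>c. p - (\<Sum>i<m. c i *s b i) \<in> Q" if p: "p \<in> P" for p
  proof (rule ccontr)
    assume no: "\<nexists>c. p - (\<Sum>i<m. c i *s b i) \<in> Q"
    \<comment> \<open>an element outside the span would extend the maximal family\<close>
    define b' where "b' = b(m := p)"
    have "c m = 0 \<and> (\<forall>i<m. c i = 0)" if "(\<Sum>i<Suc m. c i *s b' i) \<in> Q" for c
    proof -
      have eq: "(\<Sum>i<Suc m. c i *s b' i) = (\<Sum>i<m. c i *s b i) + c m *s p"
        by (simp add: b'_def)
      have "c m = 0"
      proof (rule ccontr)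
        assume "c m \<noteq> 0"
        have "inverse (c m) *s (\<Sum>i<Suc m. c i *s b' i) \<in> Q"
          using that Q by (simp add: subspace_scale)
        also have "inverse (c m) *s (\<Sum>i<Suc m. c i *s b' i) =
            p - (\<Sum>i<m. (- inverse (c m) * c i) *s b i)"
          unfolding eq using \<open>c m \<noteq> 0\<close>
          by (simp add: scale_right_distrib scale_sum_right sum_negf)
        finally show False using no by (auto dest: spec[of _ "\<lambda>i. - inverse (c m) * c i"])
      qed
      then show ?thesis using that b(2) unfolding eq by auto
    qed
    then have "Suc m \<in> S" unfolding S_def using b(1) p
      by (auto intro!: exI[of _ b'] simp: b'_def less_Suc_eq)
    then have "Suc m \<le> m" using fin Max_ge[of S "Suc m"] unfolding m_def by blast
    then show False by simp
  qed
  then have "qbasis scale P Q {..<m} b" using b unfolding qbasis_def by auto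
  then show ?thesis using assms unfolding qdim_def by blast
qed

lemma qdim_mono:
  assumes "qdim scale P Q n" "subspace P'" "Q \<subseteq> P'" "P' \<subseteq> P"
  shows "\<exists>m. qdim scale P' Q m" and "\<exists>m. qdim scale P P' m"
proof -
  have Q: "subspace Q" and P: "subspace P" using assms(1) unfolding qdim_def by auto
  show "\<exists>m. qdim scale P' Q m"
  proof (rule qdim_exists[OF assms(2) Q assms(3), of n])
    fix m and b :: "nat \<Rightarrow> 'b"
    assume "\<And>i. i < m \<Longrightarrow> b i \<in> P'" "\<And>c i. (\<Sum>i<m. c i *s b i) \<in> Q \<Longrightarrow> i < m \<Longrightarrow> c i = 0"
    then show "m \<le> n" using qdim_bound[OF assms(1), of "{..<m}" b] assms(4) by auto
  qed
  show "\<exists>m. qdim scale P P' m"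
  proof (rule qdim_exists[OF P assms(2) assms(4), of n])
    fix m and b :: "nat \<Rightarrow> 'b"
    assume "\<And>i. i < m \<Longrightarrow> b i \<in> P" "\<And>c i. (\<Sum>i<m. c i *s b i) \<in> P' \<Longrightarrow> i < m \<Longrightarrow> c i = 0"
    then show "m \<le> n" using qdim_bound[OF assms(1), of "{..<m}" b] assms(3) by auto
  qed
qed

lemma qdim_trans:
  assumes "qdim scale P Q n" "qdim scale Q S m"
  shows "qdim scale P S (n + m)"
proof -
  have sub: "subspace P" "subspace Q" "subspace S" "Q \<subseteq> P" "S \<subseteq> Q"
    using assms unfolding qdim_def by auto
  obtain b e where b: "qbasis scale P Q {..<n} b" and e: "qbasis scale Q S {..<m} e"
    using assms unfolding qdim_def by blast
  let ?I = "{..<n} <+> {..<m}"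
  have s: "(\<Sum>i\<in>?I. c i *s case_sum b e i) =
      (\<Sum>i<n. c (Inl i) *s b i) + (\<Sum>i<m. c (Inr i) *s e i)" for c
    by (subst sum.Plus) auto
  have eQ: "(\<Sum>i<m. c i *s e i) \<in> Q" for c
    using e sub by (intro subspace_sum_scale) (auto simp: qbasis_def)
  have "qbasis scale P S ?I (case_sum b e)"
    unfolding qbasis_def
  proof (intro conjI ballI allI impI)
    fix i assume "i \<in> ?I" then show "case_sum b e i \<in> P" using b e sub by (auto simp: qbasis_def)
  next
    fix c i assume c: "(\<Sum>i\<in>?I. c i *s case_sum b e i) \<in> S" and i: "i \<in> ?I"
    then have "(\<Sum>i<n. c (Inl i) *s b i) + (\<Sum>i<m. c (Inr i) *s e i) \<in> Q"
      using s sub by auto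
    then have "(\<Sum>i<n. c (Inl i) *s b i) \<in> Q"
      using eQ[of "\<lambda>i. c (Inr i)"] sub(2) by (metis add_diff_cancel_right' subspace_diff)
    then have 1: "\<forall>i<n. c (Inl i) = 0"
      using b unfolding qbasis_def by (auto dest: spec[of _ "\<lambda>i. c (Inl i)"])
    then have "(\<Sum>i<m. c (Inr i) *s e i) \<in> S" using c s[of c] by simp
    then have "\<forall>i<m. c (Inr i) = 0"
      using e unfolding qbasis_def by (auto dest: spec[of _ "\<lambda>i. c (Inr i)"])
    then show "c i = 0" using 1 i by auto
  next
    fix p assume "p \<in> P"
    then obtain c where "p - (\<Sum>i<n. c i *s b i) \<in> Q" using b unfolding qbasis_def by blast
    then obtain c' where "p - (\<Sum>i<n. c i *s b i) - (\<Sum>i<m. c' i *s e i) \<in> S"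
      using e unfolding qbasis_def by blast
    then have "p - (\<Sum>i\<in>?I. case_sum c c' i *s case_sum b e i) \<in> S"
      unfolding s by (simp add: diff_diff_eq)
    then show "\<exists>c. p - (\<Sum>i\<in>?I. c i *s case_sum b e i) \<in> S" by blast
  qed
  then show ?thesis using sub by (intro qdim_qbasis[of P S ?I]) (auto simp: card_Plus)
qed

lemma qdim_refl: "subspace P \<Longrightarrow> qdim scale P P 0"
  by (auto simp: qdim_def qbasis_def)

lemma qdim_0_eq: "qdim scale P Q 0 \<Longrightarrow> P = Q"
  by (auto simp: qdim_def qbasis_def)

lemma qdim_line:
  assumes "m \<noteq> 0" shows "qdim scale (range (\<lambda>c. c *s m)) {0} 1"
proof (rule qdim_qbasis[where A = "{()}" and b = "\<lambda>_. m"])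
  show "subspace (range (\<lambda>c. c *s m))"
    by (auto simp: subspace_def image_iff scale_left_distrib[symmetric] intro: exI[of _ 0])
  have "m \<in> range (\<lambda>c. c *s m)" by (metis rangeI scale_one)
  moreover have "\<exists>c'. c *s m = c' () *s m" for c by (rule exI[of _ "\<lambda>_. c"]) simp
  ultimately show "qbasis scale (range (\<lambda>c. c *s m)) {0} {()} (\<lambda>_. m)"
    using assms by (auto simp: qbasis_def)
qed (auto simp: subspace_single_0 image_iff intro: exI[of _ 0])

text \<open>
  The isomorphism \<open>(P\<^sub>1 + P\<^sub>2) / P\<^sub>2 \<cong> P\<^sub>1 / (P\<^sub>1 \<inter> P\<^sub>2)\<close>: a basis of the right side is one of the left.
\<close>

lemma qdim_second_iso:
  assumes "qdim scale P1 (P1 \<inter> P2) n" "subspace P2"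
  shows "qdim scale {a + b |a b. a \<in> P1 \<and> b \<in> P2} P2 n"
proof -
  have P1: "subspace P1" using assms(1) by (auto simp: qdim_def)
  obtain b where b: "qbasis scale P1 (P1 \<inter> P2) {..<n} b" using assms(1) by (auto simp: qdim_def)
  have sP: "(\<Sum>i<n. c i *s b i) \<in> P1" for c
    using b P1 by (intro subspace_sum_scale) (auto simp: qbasis_def)
  have "qbasis scale {a + b |a b. a \<in> P1 \<and> b \<in> P2} P2 {..<n} b"
    unfolding qbasis_def
  proof (intro conjI ballI allI impI)
    fix i assume "i \<in> {..<n}"
    then show "b i \<in> {a + b |a b. a \<in> P1 \<and> b \<in> P2}" using b subspace_0[OF assms(2)]
      unfolding qbasis_def by (metis (mono_tags, lifting) CollectI add.right_neutral)
  next
    fix c i assume "(\<Sum>i<n. c i *s b i) \<in> P2" "i \<in> {..<n}"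
    then show "c i = 0" using b sP unfolding qbasis_def by blast
  next
    fix p assume "p \<in> {a + b |a b. a \<in> P1 \<and> b \<in> P2}"
    then obtain u v where uv: "p = u + v" "u \<in> P1" "v \<in> P2" by blast
    then obtain c where "u - (\<Sum>i<n. c i *s b i) \<in> P2" using b unfolding qbasis_def by blast
    then have "p - (\<Sum>i<n. c i *s b i) \<in> P2" using uv assms(2)
      by (metis add.commute add_diff_eq subspace_add)
    then show "\<exists>c. p - (\<Sum>i<n. c i *s b i) \<in> P2" by blast
  qed
  moreover have "P2 \<subseteq> {a + b |a b. a \<in> P1 \<and> b \<in> P2}"
    using subspace_0[OF P1] by force
  ultimately show ?thesis
    using subspace_sums[OF P1 assms(2)] assms(2) unfolding qdim_def by blast
qed

end

context vector_space_pair
begin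

lemma sum_scale_on_subspace:
  assumes "vs1.subspace P" "\<And>a b. a \<in> P \<Longrightarrow> b \<in> P \<Longrightarrow> L (a + b) = L a + L b"
    "\<And>c a. a \<in> P \<Longrightarrow> L (s1 c a) = s2 c (L a)" "finite A" "\<And>i. i \<in> A \<Longrightarrow> b i \<in> P"
  shows "L (\<Sum>i\<in>A. s1 (c i) (b i)) = (\<Sum>i\<in>A. s2 (c i) (L (b i)))"
  using assms(4,5)
proof (induction A)
  case empty
  have "L 0 = L (s1 0 0)" by simp
  also have "\<dots> = 0" using assms(3)[of 0 0] vs1.subspace_0[OF assms(1)] by simp
  finally show ?case by simp
next
  case (insert x A)
  then show ?case using assms(1-3)
    by (simp add: vs1.subspace_scale vs1.subspace_sum_scale)
qed

text \<open>
  A surjective linear map \<open>L : P \<rightarrow> Z\<close> induces \<open>P / L\<^sup>-\<^sup>1(B) \<cong> Z / B\<close>. All comparisons of homology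
  below are instances of this.
\<close>

lemma qdim_transport:
  assumes P: "vs1.subspace P" and B: "vs2.subspace B" and BZ: "B \<subseteq> Z"
    and add: "\<And>a b. a \<in> P \<Longrightarrow> b \<in> P \<Longrightarrow> L (a + b) = L a + L b"
    and sc: "\<And>c a. a \<in> P \<Longrightarrow> L (s1 c a) = s2 c (L a)"
    and Z: "L ` P = Z" and Q: "Q = {p \<in> P. L p \<in> B}"
  shows "qdim s1 P Q n \<longleftrightarrow> qdim s2 Z B n"
proof -
  note Lsum = sum_scale_on_subspace[OF P add sc]
  have L0: "L 0 = 0" using Lsum[of "{}"] by simp
  have Q': "vs1.subspace Q" unfolding Q
    using P B by (auto simp: vs1.subspace_def vs2.subspace_def add sc L0)
  have Z': "vs2.subspace Z" unfolding Z[symmetric]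
  proof (rule vs2.subspaceI)
    show "0 \<in> L ` P" using L0 vs1.subspace_0[OF P] by (metis imageI)
    show "x + y \<in> L ` P" if "x \<in> L ` P" "y \<in> L ` P" for x y
      using that by (auto simp: add[symmetric] vs1.subspace_add[OF P])
    show "s2 c x \<in> L ` P" if "x \<in> L ` P" for c x
      using that by (auto simp: sc[symmetric] vs1.subspace_scale[OF P])
  qed
  have diff: "L (a - b) = L a - L b" if "a \<in> P" and "b \<in> P" for a b
  proof -
    have "L a = L ((a - b) + b)" by simp
    also have "\<dots> = L (a - b) + L b" using that P by (intro add vs1.subspace_diff)
    finally show ?thesis by simp
  qed
  have sumP: "(\<Sum>i\<in>A. s1 (c i) (b i)) \<in> P" if "\<And>i. i \<in> A \<Longrightarrow> b i \<in> P" for A c and b :: "nat \<Rightarrow> 'b"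
    using that P by (rule vs1.subspace_sum_scale[rotated])
  have key: "qbasis s1 P Q {..<n} b \<longleftrightarrow> qbasis s2 Z B {..<n} (L \<circ> b)"
    if b: "\<And>i. i < n \<Longrightarrow> b i \<in> P" for b :: "nat \<Rightarrow> 'b"
  proof -
    have s: "L (\<Sum>i<n. s1 (c i) (b i)) = (\<Sum>i<n. s2 (c i) ((L \<circ> b) i))" for c
      unfolding o_def by (intro Lsum) (use b in auto)
    have 1: "(\<Sum>i<n. s1 (c i) (b i)) \<in> Q \<longleftrightarrow> (\<Sum>i<n. s2 (c i) ((L \<circ> b) i)) \<in> B" for c
      using sumP[of "{..<n}" b c] b unfolding s[symmetric] Q by auto
    have 2: "p - (\<Sum>i<n. s1 (c i) (b i)) \<in> Q \<longleftrightarrow> L p - (\<Sum>i<n. s2 (c i) ((L \<circ> b) i)) \<in> B"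
      if "p \<in> P" for p c
      using sumP[of "{..<n}" b c] b that P unfolding s[symmetric] Q
      by (auto simp: diff vs1.subspace_diff)
    have 3: "(\<forall>p\<in>P. \<exists>c. p - (\<Sum>i<n. s1 (c i) (b i)) \<in> Q) \<longleftrightarrow>
        (\<forall>z\<in>Z. \<exists>c. z - (\<Sum>i<n. s2 (c i) ((L \<circ> b) i)) \<in> B)"
      unfolding Z[symmetric] ball_simps using 2 by simp
    have 4: "\<forall>i\<in>{..<n}. b i \<in> P" "\<forall>i\<in>{..<n}. (L \<circ> b) i \<in> Z" using b Z by auto
    show ?thesis unfolding qbasis_def 1 3 using 4 by simp
  qed
  show ?thesis
  proof
    assume "qdim s1 P Q n"
    then obtain b where b: "qbasis s1 P Q {..<n} b" by (auto simp: qdim_def)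
    then have "qbasis s2 Z B {..<n} (L \<circ> b)" using key[of b] by (auto simp: qbasis_def)
    then show "qdim s2 Z B n" using Z' B BZ by (auto simp: qdim_def)
  next
    assume "qdim s2 Z B n"
    then obtain e where e: "qbasis s2 Z B {..<n} e" by (auto simp: qdim_def)
    then have "e i \<in> L ` P" if "i < n" for i using Z that by (auto simp: qbasis_def)
    then have "\<forall>i<n. \<exists>p\<in>P. L p = e i" by fastforce
    then obtain b where b: "\<And>i. i < n \<Longrightarrow> b i \<in> P \<and> L (b i) = e i" by metis
    have "qbasis s2 Z B {..<n} (L \<circ> b)" using e b by (simp add: qbasis_def)
    then have "qbasis s1 P Q {..<n} b" using key[of b] b by auto
    then show "qdim s1 P Q n" using Q' P Q unfolding qdim_def by blast
  qed
qed

end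

definition pointwise :: "('k \<Rightarrow> 'v \<Rightarrow> 'v) \<Rightarrow> 'k \<Rightarrow> ('i \<Rightarrow> 'v) \<Rightarrow> 'i \<Rightarrow> 'v" where
  "pointwise sc c u = (\<lambda>i. sc c (u i))"

lemma pointwise_apply [simp]: "pointwise sc c u i = sc c (u i)"
  by (simp add: pointwise_def)

lemma vector_space_pointwise: "vector_space sc \<Longrightarrow> vector_space (pointwise sc)"
  unfolding vector_space_def by (auto simp: fun_eq_iff)

lemma sum_fun_apply: "(sum f A) x = (\<Sum>i\<in>A. f i x)"
  by (induction A rule: infinite_finite_induct) auto

definition supported :: "'i set \<Rightarrow> 'v::zero set \<Rightarrow> ('i \<Rightarrow> 'v) set" where
  "supported A Q = {c. (\<forall>i\<in>A. c i \<in> Q) \<and> (\<forall>i. i \<notin> A \<longrightarrow> c i = 0)}"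

lemma (in vector_space) subspace_supported:
  assumes "subspace Q" shows "module.subspace (pointwise scale) (supported A Q)"
proof -
  interpret pw: vector_space "pointwise scale" by (rule vector_space_pointwise) unfold_locales
  show ?thesis using assms
    by (auto simp: pw.subspace_def supported_def subspace_def)
qed

text \<open>
  Evaluation at \<open>x\<close> identifies the functions on \<open>A \<union> {x}\<close> modulo those on \<open>A\<close> with \<open>Q\<close>.
\<close>

lemma (in vector_space) qdim_supported:
  fixes A :: "'i set"
  assumes "qdim scale Q {0} n" "finite A"
  shows "qdim (pointwise scale) (supported A Q) {0} (card A * n)"
  using assms(2)
proof induction
  interpret pw: vector_space "pointwise scale :: _ \<Rightarrow> ('i \<Rightarrow> _) \<Rightarrow> _"
    by (rule vector_space_pointwise) unfold_locales
  case empty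
  have "supported {} Q = {0 :: 'i \<Rightarrow> 'b}" by (auto simp: supported_def fun_eq_iff)
  then show ?case using pw.qdim_refl[OF pw.subspace_single_0] by (simp only: card.empty mult_0)
next
  interpret pw: vector_space "pointwise scale :: _ \<Rightarrow> ('i \<Rightarrow> _) \<Rightarrow> _"
    by (rule vector_space_pointwise) unfold_locales
  interpret pair: vector_space_pair "pointwise scale :: _ \<Rightarrow> ('i \<Rightarrow> _) \<Rightarrow> _" scale ..
  case (insert x A)
  have Q: "subspace Q" using assms(1) by (auto simp: qdim_def)
  have 0: "0 \<in> Q" using subspace_0[OF Q] .
  have t: "qdim (pointwise scale) (supported (insert x A) Q) (supported A Q) n
      \<longleftrightarrow> qdim scale Q {0} n"
  proof (rule pair.qdim_transport[where L = "\<lambda>c. c x"])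
    show "pw.subspace (supported (insert x A) Q)" by (rule subspace_supported[OF Q])
    show "(\<lambda>c. c x) ` supported (insert x A) Q = Q"
    proof
      show "Q \<subseteq> (\<lambda>c. c x) ` supported (insert x A) Q"
      proof
        fix q assume "q \<in> Q"
        then show "q \<in> (\<lambda>c. c x) ` supported (insert x A) Q" using 0
          by (intro image_eqI[of _ _ "\<lambda>i. if i = x then q else 0"]) (auto simp: supported_def)
      qed
    qed (auto simp: supported_def)
    show "supported A Q = {p \<in> supported (insert x A) Q. p x \<in> {0}}"
      using insert.hyps 0 by (auto simp: supported_def)
  qed (use 0 in \<open>auto simp: subspace_single_0\<close>)
  show ?case using pw.qdim_trans[OF iffD2[OF t assms(1)] insert.IH]
    unfolding card_insert_disjoint[OF insert.hyps] mult_Suc .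
qed

lemma qdim_coefficients:
  fixes A :: "'i set"
  assumes "finite A"
  shows "qdim (pointwise ((*) :: 'k::field \<Rightarrow> 'k \<Rightarrow> 'k)) (supported A UNIV) {0} (card A)"
proof -
  interpret K: vector_space "(*) :: 'k \<Rightarrow> 'k \<Rightarrow> 'k"
    by unfold_locales (auto simp: algebra_simps)
  have "qdim (*) (UNIV :: 'k set) {0} 1"
    by (rule K.qdim_qbasis[where A = "{()}" and b = "\<lambda>_. 1"])
      (auto simp: qbasis_def K.subspace_def intro: exI[of _ "\<lambda>_. _ :: 'k"])
  then show ?thesis using K.qdim_supported[OF _ assms, of "UNIV :: 'k set" 1] by simp
qed

definition vdim :: "('k::field \<Rightarrow> 'v::ab_group_add \<Rightarrow> 'v) \<Rightarrow> 'v set \<Rightarrow> nat" where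
  "vdim sc P = (THE n. qdim sc P {0} n)"

definition fin_dim :: "('k::field \<Rightarrow> 'v::ab_group_add \<Rightarrow> 'v) \<Rightarrow> 'v set \<Rightarrow> bool" where
  "fin_dim sc P \<longleftrightarrow> (\<exists>n. qdim sc P {0} n)"

context vector_space
begin

lemma vdim_eq: "qdim scale P {0} n \<Longrightarrow> vdim scale P = n"
  unfolding vdim_def using qdim_unique by blast

lemma fin_dim_qdim: "fin_dim scale P \<Longrightarrow> qdim scale P {0} (vdim scale P)"
  unfolding fin_dim_def using vdim_eq by blast

lemma fin_dim_subspace: "fin_dim scale P \<Longrightarrow> subspace P"
  unfolding fin_dim_def qdim_def by blast

lemma fin_dim_mono: "fin_dim scale P \<Longrightarrow> subspace Q \<Longrightarrow> Q \<subseteq> P \<Longrightarrow> fin_dim scale Q"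
  unfolding fin_dim_def using qdim_mono(1)[of P "{0}" _ Q] subspace_0[of Q] by blast

lemma vdim_zero [simp]: "vdim scale {0} = 0"
  using vdim_eq[OF qdim_refl[OF subspace_single_0]] .

lemma qdim_quotient:
  assumes "fin_dim scale P" "subspace Q" "Q \<subseteq> P"
  shows "\<exists>n. qdim scale P Q n \<and> vdim scale P = n + vdim scale Q"
proof -
  obtain n where n: "qdim scale P Q n"
    using assms qdim_mono(2)[of P "{0}" _ Q] subspace_0[of Q] unfolding fin_dim_def by blast
  have "qdim scale P {0} (n + vdim scale Q)"
    using qdim_trans[OF n fin_dim_qdim] fin_dim_mono[OF assms] by blast
  then show ?thesis using n vdim_eq by blast
qed

lemma direct_sum_dim:
  assumes "fin_dim scale P1" "fin_dim scale P2" "P1 \<inter> P2 \<subseteq> {0}"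
  shows "fin_dim scale {a + b |a b. a \<in> P1 \<and> b \<in> P2}"
    and "vdim scale {a + b |a b. a \<in> P1 \<and> b \<in> P2} = vdim scale P1 + vdim scale P2"
proof -
  have "P1 \<inter> P2 = {0}" using assms fin_dim_subspace subspace_0 by blast
  then have "qdim scale {a + b |a b. a \<in> P1 \<and> b \<in> P2} P2 (vdim scale P1)"
    using qdim_second_iso[of P1 P2] fin_dim_qdim[OF assms(1)] fin_dim_subspace[OF assms(2)] by simp
  then have "qdim scale {a + b |a b. a \<in> P1 \<and> b \<in> P2} {0} (vdim scale P1 + vdim scale P2)"
    using qdim_trans fin_dim_qdim[OF assms(2)] by blast
  then show "fin_dim scale {a + b |a b. a \<in> P1 \<and> b \<in> P2}"
    and "vdim scale {a + b |a b. a \<in> P1 \<and> b \<in> P2} = vdim scale P1 + vdim scale P2"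
    using vdim_eq unfolding fin_dim_def by blast+
qed

lemma rank_nullity:
  assumes "fin_dim scale P"
    and add: "\<And>a b. a \<in> P \<Longrightarrow> b \<in> P \<Longrightarrow> L (a + b) = L a + L b"
    and sc: "\<And>c a. a \<in> P \<Longrightarrow> L (c *s a) = c *s L a"
  shows "fin_dim scale (L ` P)"
    and "vdim scale P = vdim scale (L ` P) + vdim scale {p \<in> P. L p = 0}"
proof -
  interpret pair: vector_space_pair scale scale ..
  have P: "subspace P" using assms(1) by (rule fin_dim_subspace)
  have L0: "L 0 = 0" using sc[of 0 0] subspace_0[OF P] by simp
  have K: "subspace {p \<in> P. L p = 0}"
    using P by (auto simp: subspace_def add sc L0)
  have im: "0 \<in> L ` P" using L0 subspace_0[OF P] by (metis imageI)
  have t: "qdim scale P {p \<in> P. L p = 0} n \<longleftrightarrow> qdim scale (L ` P) {0} n" for n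
    by (rule pair.qdim_transport[where L = L]) (use P add sc im in \<open>auto simp: subspace_single_0\<close>)
  obtain n where n: "qdim scale P {p \<in> P. L p = 0} n"
      "vdim scale P = n + vdim scale {p \<in> P. L p = 0}"
    using qdim_quotient[OF assms(1) K] by blast
  then show "fin_dim scale (L ` P)"
    "vdim scale P = vdim scale (L ` P) + vdim scale {p \<in> P. L p = 0}"
    using t vdim_eq unfolding fin_dim_def by auto
qed

lemma vdim_supported:
  assumes "fin_dim scale Q" "finite A"
  shows "fin_dim (pointwise scale) (supported A Q)"
    and "vdim (pointwise scale) (supported A Q) = card A * vdim scale Q"
proof -
  interpret pw: vector_space "pointwise scale" by (rule vector_space_pointwise) unfold_locales
  note q = qdim_supported[OF fin_dim_qdim[OF assms(1)] assms(2)]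
  show "fin_dim (pointwise scale) (supported A Q)" using q unfolding fin_dim_def by blast
  show "vdim (pointwise scale) (supported A Q) = card A * vdim scale Q" using q pw.vdim_eq by blast
qed

end

section \<open>Koszul complexes\<close>

definition ksgn :: "nat \<Rightarrow> nat set \<Rightarrow> 'm::ab_group_add \<Rightarrow> 'm" where
  "ksgn v J m = (if even (card {u \<in> J. u < v}) then m else - m)"

definition kchains :: "nat set \<Rightarrow> nat \<Rightarrow> 'm::zero set \<Rightarrow> (nat set \<Rightarrow> 'm) set" where
  "kchains V k Q = supported {J. J \<subseteq> V \<and> card J = k} Q"

text \<open>
  With \<open>c J\<close> the coefficient of the exterior monomial of \<open>J\<close>, this is the Koszul differential: the
  coefficient at \<open>J\<close> collects \<open>X v (c (J \<union> {v}))\<close> with the sign for removing \<open>v\<close> from \<open>J \<union> {v}\<close>.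
  The guard \<open>J \<subseteq> V\<close> keeps the values \<open>0\<close> outside the subsets of \<open>V\<close>.
\<close>

definition kdiff ::
  "(nat \<Rightarrow> 'm \<Rightarrow> 'm) \<Rightarrow> nat set \<Rightarrow> (nat set \<Rightarrow> 'm::ab_group_add) \<Rightarrow> nat set \<Rightarrow> 'm" where
  "kdiff X V c J = (if J \<subseteq> V then \<Sum>v\<in>V-J. ksgn v J (X v (c (insert v J))) else 0)"

definition kcycles ::
  "(nat \<Rightarrow> 'm \<Rightarrow> 'm) \<Rightarrow> nat set \<Rightarrow> nat \<Rightarrow> 'm::ab_group_add set \<Rightarrow> (nat set \<Rightarrow> 'm) set" where
  "kcycles X V k Q = {c \<in> kchains V k Q. kdiff X V c = 0}"

text \<open>
  The index \<open>j\<close> is the degree of the coefficients, so this is the homology in Koszul degree \<open>k\<close> and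
  internal degree \<open>k + j\<close>; it belongs to the shifted Betti number with indices \<open>k\<close> and \<open>j\<close>.
\<close>

definition has_betti ::
  "('k::field \<Rightarrow> 'm \<Rightarrow> 'm) \<Rightarrow> (nat \<Rightarrow> 'm \<Rightarrow> 'm) \<Rightarrow> nat set \<Rightarrow> (int \<Rightarrow> 'm::ab_group_add set) \<Rightarrow>
   nat \<Rightarrow> int \<Rightarrow> nat \<Rightarrow> bool" where
  "has_betti sc X V M k j n \<longleftrightarrow>
     qdim (pointwise sc) (kcycles X V k (M j)) (kdiff X V ` kchains V (Suc k) (M (j - 1))) n"

lemma ksgn_add: "ksgn v J (a + b) = ksgn v J a + ksgn v J b"
  by (simp add: ksgn_def)

lemma ksgn_uminus: "ksgn v J (- a) = - ksgn v J a"
  by (simp add: ksgn_def)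

lemma ksgn_0 [simp]: "ksgn v J 0 = 0"
  by (simp add: ksgn_def)

lemma ksgn_eq_0_iff [simp]: "ksgn v J a = 0 \<longleftrightarrow> a = 0"
  by (simp add: ksgn_def)

lemma ksgn_ksgn [simp]: "ksgn v J (ksgn v J a) = a"
  by (simp add: ksgn_def)

lemma ksgn_sum: "ksgn v J (sum f A) = (\<Sum>i\<in>A. ksgn v J (f i))"
  by (simp add: ksgn_def sum_negf)

lemma ksgn_insert:
  assumes "finite J" "u \<notin> J"
  shows "ksgn v (insert u J) a = (if u < v then - ksgn v J a else ksgn v J a)"
proof -
  have "{x \<in> insert u J. x < v} = (if u < v then insert u {x \<in> J. x < v} else {x \<in> J. x < v})" by auto
  then show ?thesis using assms by (auto simp: ksgn_def)
qed

lemma kchainsI: "(\<And>J. J \<subseteq> V \<Longrightarrow> card J = k \<Longrightarrow> c J \<in> Q) \<Longrightarrow>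
    (\<And>J. \<not> (J \<subseteq> V \<and> card J = k) \<Longrightarrow> c J = 0) \<Longrightarrow> c \<in> kchains V k Q"
  by (auto simp: kchains_def supported_def)

lemma kchainsD1: "c \<in> kchains V k Q \<Longrightarrow> J \<subseteq> V \<Longrightarrow> card J = k \<Longrightarrow> c J \<in> Q"
  by (auto simp: kchains_def supported_def)

lemma kchainsD0: "c \<in> kchains V k Q \<Longrightarrow> \<not> (J \<subseteq> V \<and> card J = k) \<Longrightarrow> c J = 0"
  by (auto simp: kchains_def supported_def)

lemma kchainsD: "c \<in> kchains V k Q \<Longrightarrow> 0 \<in> Q \<Longrightarrow> c J \<in> Q"
  by (cases "J \<subseteq> V \<and> card J = k") (auto dest: kchainsD0 kchainsD1)

lemma kchains_mono: "Q \<subseteq> Q' \<Longrightarrow> kchains V k Q \<subseteq> kchains V k Q'"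
  by (auto simp: kchains_def supported_def)

lemma finite_ksubsets [simp]: "finite V \<Longrightarrow> finite {J. J \<subseteq> V \<and> card J = k}"
  by (rule finite_subset[of _ "Pow V"]) auto

text \<open>
  Pairing \<open>(v, w)\<close> with \<open>(w, v)\<close>. Summing over \<open>v < w\<close> first keeps the argument valid in
  characteristic \<open>2\<close>, where a sum that equals its own negative need not vanish.
\<close>

lemma sum_offdiagonal_antisym:
  fixes T :: "'i::linorder \<Rightarrow> 'i \<Rightarrow> 'm::ab_group_add"
  assumes "finite A" "\<And>v w. v \<in> A \<Longrightarrow> w \<in> A \<Longrightarrow> v < w \<Longrightarrow> T v w + T w v = 0"
  shows "(\<Sum>v\<in>A. \<Sum>w\<in>A-{v}. T v w) = 0"
proof -
  let ?L = "{(v, w). v \<in> A \<and> w \<in> A \<and> v < w}" and ?G = "{(v, w). v \<in> A \<and> w \<in> A \<and> w < v}"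
  have fin: "finite ?L" "finite ?G"
    by (rule finite_subset[of _ "A \<times> A"]; use assms(1) in auto)+
  have "(\<Sum>v\<in>A. \<Sum>w\<in>A-{v}. T v w) = (\<Sum>(v, w)\<in>(SIGMA v:A. A - {v}). T v w)"
    using assms(1) by (subst sum.Sigma) auto
  also have "(SIGMA v:A. A - {v}) = ?L \<union> ?G" by auto
  also have "(\<Sum>(v, w)\<in>?L \<union> ?G. T v w) = (\<Sum>(v, w)\<in>?L. T v w) + (\<Sum>(v, w)\<in>?G. T v w)"
    using fin by (intro sum.union_disjoint) auto
  also have "(\<Sum>(v, w)\<in>?G. T v w) = (\<Sum>(v, w)\<in>?L. T w v)"
    by (rule sum.reindex_bij_witness[of _ prod.swap prod.swap]) auto
  also have "(\<Sum>(v, w)\<in>?L. T v w) + (\<Sum>(v, w)\<in>?L. T w v) = (\<Sum>(v, w)\<in>?L. T v w + T w v)"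
    by (simp add: sum.distrib case_prod_beta)
  also have "\<dots> = 0" using assms(2) by (intro sum.neutral) auto
  finally show ?thesis .
qed

text \<open>
  A vector space with commuting linear operators \<open>X v\<close>, that is, a module over the polynomial ring,
  of which only the action of the scalars and of the variables matters for the Koszul complex.
\<close>

locale koszul = vector_space scale
  for scale :: "'k::field \<Rightarrow> 'm::ab_group_add \<Rightarrow> 'm" (infixr "*s" 75) +
  fixes X :: "nat \<Rightarrow> 'm \<Rightarrow> 'm"
  assumes X_add: "X v (a + b) = X v a + X v b"
    and X_scale: "X v (c *s a) = c *s X v a"
    and X_commute: "X v (X w a) = X w (X v a)"
begin

sublocale ch: vector_space "pointwise scale :: 'k \<Rightarrow> (nat set \<Rightarrow> 'm) \<Rightarrow> nat set \<Rightarrow> 'm"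
  by (rule vector_space_pointwise) unfold_locales

lemma X_0 [simp]: "X v 0 = 0"
  using X_scale[of v 0 0] by simp

lemma X_uminus: "X v (- a) = - X v a"
  using X_add[of v a "- a"] by (simp add: eq_neg_iff_add_eq_0 add.commute)

lemma X_ksgn: "X v (ksgn w J a) = ksgn w J (X v a)"
  by (simp add: ksgn_def X_uminus)

lemma X_sum: "X v (sum f A) = (\<Sum>i\<in>A. X v (f i))"
  by (induction A rule: infinite_finite_induct) (auto simp: X_add)

lemma scale_ksgn: "c *s ksgn v J a = ksgn v J (c *s a)"
  by (simp add: ksgn_def)

lemma kdiff_add: "kdiff X V (a + b) = kdiff X V a + kdiff X V b"
  by (auto simp: kdiff_def fun_eq_iff X_add ksgn_add sum.distrib)

lemma kdiff_scale: "kdiff X V (pointwise scale c a) = pointwise scale c (kdiff X V a)"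
  by (auto simp: kdiff_def fun_eq_iff X_scale scale_ksgn[symmetric] scale_sum_right)

lemma kdiff_0 [simp]: "kdiff X V 0 = 0"
  by (auto simp: kdiff_def fun_eq_iff)

lemma kdiff_uminus: "kdiff X V (- a) = - kdiff X V a"
  by (auto simp: kdiff_def fun_eq_iff X_uminus ksgn_uminus sum_negf)

lemma kdiff_diff: "kdiff X V (a - b) = kdiff X V a - kdiff X V b"
  using kdiff_add[of V a "- b"] by (simp add: kdiff_uminus)

lemma subspace_kchains: "subspace Q \<Longrightarrow> ch.subspace (kchains V k Q)"
  unfolding kchains_def by (rule subspace_supported)

lemma kdiff_in_kchains:
  assumes "finite V" "c \<in> kchains V (Suc k) Q" "subspace Q'"
    and XQ: "\<And>v q. v \<in> V \<Longrightarrow> q \<in> Q \<Longrightarrow> X v q \<in> Q'"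
  shows "kdiff X V c \<in> kchains V k Q'"
proof (rule kchainsI)
  have k: "ksgn v J q \<in> Q'" if "q \<in> Q'" for v J q
    using that assms(3) by (auto simp: ksgn_def subspace_neg)
  show "kdiff X V c J \<in> Q'" if J: "J \<subseteq> V" "card J = k" for J
  proof -
    have "c (insert v J) \<in> Q" if "v \<in> V - J" for v
      using that J finite_subset[OF J(1) assms(1)] by (intro kchainsD1[OF assms(2)]) auto
    then show ?thesis using J assms(3) XQ by (auto simp: kdiff_def intro!: subspace_sum k)
  qed
  show "kdiff X V c J = 0" if "\<not> (J \<subseteq> V \<and> card J = k)" for J
  proof (cases "J \<subseteq> V")
    case True
    have "c (insert v J) = 0" if "v \<in> V - J" for v
      using that True \<open>\<not> (J \<subseteq> V \<and> card J = k)\<close> finite_subset[OF True assms(1)]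
      by (intro kchainsD0[OF assms(2)]) auto
    then show ?thesis using True by (auto simp: kdiff_def intro!: sum.neutral)
  qed (simp add: kdiff_def)
qed

lemma kdiff_kchains_0:
  assumes "finite V" "c \<in> kchains V 0 Q" shows "kdiff X V c = 0"
proof
  fix J
  have "c (insert v J) = 0" if "J \<subseteq> V" "v \<in> V" for v
    using that finite_subset[OF _ assms(1)] by (intro kchainsD0[OF assms(2)]) auto
  then show "kdiff X V c J = 0 J" by (auto simp: kdiff_def intro!: sum.neutral)
qed

text \<open>
  Removing \<open>v\<close> and then \<open>w\<close> has the sign opposite to removing \<open>w\<close> and then \<open>v\<close>, while \<open>X v\<close> and \<open>X w\<close> commute.
\<close>

lemma kdiff_kdiff:
  assumes "finite V" shows "kdiff X V (kdiff X V c) = 0"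
proof
  fix J
  show "kdiff X V (kdiff X V c) J = 0 J"
  proof (cases "J \<subseteq> V")
    case True
    have fJ: "finite J" using finite_subset[OF True assms] .
    define T where
      "T v w = ksgn v J (ksgn w (insert v J) (X v (X w (c (insert w (insert v J))))))" for v w
    have "kdiff X V (kdiff X V c) J = (\<Sum>v\<in>V-J. \<Sum>w\<in>(V-J)-{v}. T v w)"
      using True by (auto simp: kdiff_def T_def X_sum X_ksgn ksgn_sum Diff_insert2[symmetric]
          intro!: sum.cong)
    also have "\<dots> = 0"
    proof (rule sum_offdiagonal_antisym)
      show "finite (V - J)" using assms by simp
      fix v w assume vw: "v \<in> V - J" "w \<in> V - J" "v < w"
      have "X v (X w (c (insert w (insert v J)))) = X w (X v (c (insert v (insert w J))))"
        by (simp add: X_commute insert_commute)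
      moreover have "ksgn v J (ksgn w (insert v J) a) = - ksgn w J (ksgn v (insert w J) a)" for a :: 'm
        using vw fJ by (auto simp: ksgn_insert ksgn_uminus) (auto simp: ksgn_def)
      ultimately show "T v w + T w v = 0" by (simp add: T_def)
    qed
    finally show ?thesis by simp
  qed (simp add: kdiff_def)
qed

definition graded_submodule :: "nat set \<Rightarrow> (int \<Rightarrow> 'm set) \<Rightarrow> bool" where
  "graded_submodule V M \<longleftrightarrow>
     (\<forall>j. subspace (M j)) \<and> (\<forall>j. \<forall>v\<in>V. \<forall>m\<in>M j. X v m \<in> M (j + 1))"

lemma subspace_kcycles: "subspace Q \<Longrightarrow> ch.subspace (kcycles X V k Q)"
  using subspace_kchains[of Q V k] unfolding kcycles_def ch.subspace_def
  by (auto simp: kdiff_add kdiff_scale)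

lemma subspace_kdiff_image: "subspace Q \<Longrightarrow> ch.subspace (kdiff X V ` kchains V k Q)"
  using subspace_kchains[of Q V k] unfolding ch.subspace_def
  by (auto simp: kdiff_add[symmetric] kdiff_scale[symmetric] image_iff)
    (metis kdiff_0)

lemma boundary_in_cycles:
  assumes "finite V" "graded_submodule V M"
  shows "kdiff X V ` kchains V (Suc k) (M (j - 1)) \<subseteq> kcycles X V k (M j)"
proof -
  have "kdiff X V c \<in> kchains V k (M j)" if "c \<in> kchains V (Suc k) (M (j - 1))" for c
    using assms(2) that
    by (intro kdiff_in_kchains[OF assms(1), of c k "M (j - 1)"])
      (auto simp: graded_submodule_def dest: spec[of _ "j - 1"])
  then show ?thesis using kdiff_kdiff[OF assms(1)] by (auto simp: kcycles_def)
qed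

section \<open>Ranks of Koszul differentials\<close>

text \<open>
  The rank of the Koszul differential on the \<open>k\<close>-chains with coefficients in \<open>Q\<close>. For a graded
  module \<open>M\<close> with finite dimensional pieces, the ranks for all \<open>M j\<close> determine the homology.
\<close>

definition krank :: "nat set \<Rightarrow> nat \<Rightarrow> 'm set \<Rightarrow> nat" where
  "krank V k Q = vdim (pointwise scale) (kdiff X V ` kchains V k Q)"

lemma kchains_dim:
  assumes "finite V" "fin_dim scale Q"
  shows "fin_dim (pointwise scale) (kchains V k Q)"
    and "vdim (pointwise scale) (kchains V k Q) = (card V choose k) * vdim scale Q"
  unfolding kchains_def using assms by (auto simp: vdim_supported n_subsets)

lemma kdiff_rank_nullity:
  assumes "finite V" "fin_dim scale Q"
  shows "fin_dim (pointwise scale) (kdiff X V ` kchains V k Q)"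
    and "(card V choose k) * vdim scale Q = krank V k Q + vdim (pointwise scale) (kcycles X V k Q)"
  using ch.rank_nullity[OF kchains_dim(1)[OF assms], of k "kdiff X V"] kchains_dim(2)[OF assms, of k]
  by (auto simp: kdiff_add kdiff_scale krank_def kcycles_def)

lemma krank_0 [simp]:
  assumes "finite V" "fin_dim scale Q" shows "krank V 0 Q = 0"
proof -
  have "0 \<in> kchains V 0 Q" using subspace_0[OF fin_dim_subspace[OF assms(2)]]
    by (auto simp: kchains_def supported_def)
  then have "kdiff X V ` kchains V 0 Q = {0}" using kdiff_kchains_0[OF assms(1)] by force
  then show ?thesis by (simp add: krank_def)
qed

text \<open>
  Dimension of the chains minus the rank of the outgoing differential, which is the dimension of
  the cycles, minus the rank of the incoming one. It is an integer so that the terms can be computed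
  and compared one at a time.
\<close>

definition betti :: "nat set \<Rightarrow> (int \<Rightarrow> 'm set) \<Rightarrow> nat \<Rightarrow> int \<Rightarrow> int" where
  "betti V M k j = int ((card V choose k) * vdim scale (M j)) - int (krank V k (M j))
     - int (krank V (Suc k) (M (j - 1)))"

lemma has_betti_number:
  assumes "finite V" "graded_submodule V M" "\<And>j. fin_dim scale (M j)"
  shows "\<exists>n. has_betti scale X V M k j n \<and> betti V M k j = int n"
proof -
  have "fin_dim (pointwise scale) (kcycles X V k (M j))"
    by (rule ch.fin_dim_mono[OF kchains_dim(1)[OF assms(1,3), of k j] subspace_kcycles])
      (use assms fin_dim_subspace in \<open>auto simp: kcycles_def\<close>)
  then obtain n where "has_betti scale X V M k j n"
    "vdim (pointwise scale) (kcycles X V k (M j)) = n + krank V (Suc k) (M (j - 1))"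
    unfolding has_betti_def krank_def
    using ch.qdim_quotient[OF _ subspace_kdiff_image boundary_in_cycles[OF assms(1,2)]]
      assms(3) fin_dim_subspace by metis
  then show ?thesis using kdiff_rank_nullity(2)[OF assms(1,3), of k j]
    by (intro exI[of _ n]) (auto simp: betti_def)
qed

text \<open>
  The chains with coefficients in \<open>Q\<^sub>1 \<oplus> Q\<^sub>2\<close> split, and the images of the two parts meet only in
  \<open>0\<close> because their coefficients lie in \<open>R\<^sub>1\<close> and \<open>R\<^sub>2\<close>.
\<close>

lemma krank_direct_sum:
  assumes V: "finite V" and Q: "fin_dim scale Q1" "fin_dim scale Q2"
    and XQ: "\<And>v q. v \<in> V \<Longrightarrow> q \<in> Q1 \<Longrightarrow> X v q \<in> R1" "\<And>v q. v \<in> V \<Longrightarrow> q \<in> Q2 \<Longrightarrow> X v q \<in> R2"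
    and R: "subspace R1" "subspace R2" "R1 \<inter> R2 \<subseteq> {0}"
  shows "krank V (Suc k) {a + b |a b. a \<in> Q1 \<and> b \<in> Q2} = krank V (Suc k) Q1 + krank V (Suc k) Q2"
proof -
  let ?Q = "{a + b |a b. a \<in> Q1 \<and> b \<in> Q2}"
  have s: "subspace Q1" "subspace Q2" using Q fin_dim_subspace by auto
  have kchains: "kchains V (Suc k) ?Q = {a + b |a b. a \<in> kchains V (Suc k) Q1 \<and> b \<in> kchains V (Suc k) Q2}"
  proof (intro equalityI subsetI)
    fix c assume c: "c \<in> kchains V (Suc k) ?Q"
    have "\<forall>J. \<exists>a b. c J = a + b \<and> (if J \<subseteq> V \<and> card J = Suc k then a \<in> Q1 \<and> b \<in> Q2 else a = 0 \<and> b = 0)"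
    proof
      fix J show "\<exists>a b. c J = a + b \<and> (if J \<subseteq> V \<and> card J = Suc k then a \<in> Q1 \<and> b \<in> Q2 else a = 0 \<and> b = 0)"
        using kchainsD0[OF c, of J] kchainsD1[OF c, of J] by (cases "J \<subseteq> V \<and> card J = Suc k") auto
    qed
    then obtain a b where "\<And>J. c J = a J + b J \<and>
        (if J \<subseteq> V \<and> card J = Suc k then a J \<in> Q1 \<and> b J \<in> Q2 else a J = 0 \<and> b J = 0)" by metis
    note ab = this
    have "c = a + b" using ab by (auto simp: fun_eq_iff)
    moreover have "a \<in> kchains V (Suc k) Q1" by (rule kchainsI) (metis ab)+
    moreover have "b \<in> kchains V (Suc k) Q2" by (rule kchainsI) (metis ab)+
    ultimately show "c \<in> {a + b |a b. a \<in> kchains V (Suc k) Q1 \<and> b \<in> kchains V (Suc k) Q2}" by blast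
  next
    fix c assume "c \<in> {a + b |a b. a \<in> kchains V (Suc k) Q1 \<and> b \<in> kchains V (Suc k) Q2}"
    then obtain a b where c: "c = a + b" and a: "a \<in> kchains V (Suc k) Q1" and b: "b \<in> kchains V (Suc k) Q2"
      by blast
    show "c \<in> kchains V (Suc k) ?Q"
    proof (rule kchainsI)
      show "c J \<in> ?Q" if "J \<subseteq> V" "card J = Suc k" for J
        using kchainsD1[OF a that] kchainsD1[OF b that] c by auto
      show "c J = 0" if "\<not> (J \<subseteq> V \<and> card J = Suc k)" for J
        using kchainsD0[OF a that] kchainsD0[OF b that] c by simp
    qed
  qed
  have im: "kdiff X V ` kchains V (Suc k) ?Q =
      {a + b |a b. a \<in> kdiff X V ` kchains V (Suc k) Q1 \<and> b \<in> kdiff X V ` kchains V (Suc k) Q2}"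
    unfolding kchains by (simp add: image_def kdiff_add[symmetric] set_eq_iff) (metis kdiff_add)
  have "kdiff X V ` kchains V (Suc k) Q1 \<inter> kdiff X V ` kchains V (Suc k) Q2 \<subseteq> {0}"
  proof
    fix c assume "c \<in> kdiff X V ` kchains V (Suc k) Q1 \<inter> kdiff X V ` kchains V (Suc k) Q2"
    then have "c \<in> kchains V k R1" "c \<in> kchains V k R2"
      using kdiff_in_kchains[OF V _ R(1) XQ(1)] kdiff_in_kchains[OF V _ R(2) XQ(2)] by auto
    then have "c J \<in> R1 \<inter> R2" for J using kchainsD R(1,2) subspace_0 by blast
    then show "c \<in> {0}" using R(3) by (auto simp: fun_eq_iff)
  qed
  then show ?thesis unfolding krank_def im
    using kdiff_rank_nullity(1)[OF V] Q by (intro ch.direct_sum_dim)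
qed

text \<open>
  If \<open>X w\<close> is zero on the coefficients, the complex over \<open>V \<union> {w}\<close> is the direct sum of the
  complex over \<open>V\<close> (the monomials without \<open>w\<close>) and a copy of it that is shifted by one (those with
  \<open>w\<close>).
\<close>

lemma krank_zero_variable:
  assumes V: "finite V" "w \<notin> V" and Q: "fin_dim scale Q" and w0: "\<And>q. q \<in> Q \<Longrightarrow> X w q = 0"
  shows "krank (insert w V) (Suc k) Q = krank V (Suc k) Q + krank V k Q"
proof -
  \<comment> \<open>the embedding \<open>\<sigma>\<close> of the shifted copy commutes with the differentials only after a
    twist by the number of elements above \<open>w\<close>: the sign for removing \<open>v\<close> from \<open>J \<union> {w}\<close> differs
    from the one for \<open>J\<close> exactly when \<open>w < v\<close>\<close>
  define tw :: "nat set \<Rightarrow> 'm \<Rightarrow> 'm" where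
    "tw J m = (if even (card {u \<in> J. w < u}) then m else - m)" for J m
  define \<sigma> :: "(nat set \<Rightarrow> 'm) \<Rightarrow> nat set \<Rightarrow> 'm" where
    "\<sigma> c J = (if w \<in> J then tw (J - {w}) (c (J - {w})) else 0)" for c J
  have sQ: "subspace Q" and Q0: "0 \<in> Q" using Q fin_dim_subspace subspace_0 by auto
  have tw0 [simp]: "tw J m = 0 \<longleftrightarrow> m = 0" for J m by (simp add: tw_def)
  have twQ: "tw J q \<in> Q" if "q \<in> Q" for J q using that sQ by (simp add: tw_def subspace_neg)
  have twtw [simp]: "tw J (tw J q) = q" for J q by (simp add: tw_def)
  have Xtw: "X v (tw J q) = tw J (X v q)" for v J q by (simp add: tw_def X_uminus)
  have tw_sum: "tw J (sum f A) = (\<Sum>i\<in>A. tw J (f i))" for J f and A :: "nat set"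
    by (simp add: tw_def sum_negf)
  have sgn: "ksgn v (insert w I) (tw (insert v I) q) = tw I (ksgn v I q)"
    if "finite I" "w \<notin> I" "v \<notin> I" "v \<noteq> w" for v I q
  proof -
    have "{u \<in> insert v I. w < u} = (if w < v then insert v {u \<in> I. w < u} else {u \<in> I. w < u})" by auto
    then have "tw (insert v I) q = (if w < v then - tw I q else tw I q)"
      using that by (auto simp: tw_def)
    then show ?thesis using that by (auto simp: ksgn_insert ksgn_uminus) (auto simp: tw_def ksgn_def)
  qed
  have \<sigma>_add: "\<sigma> (a + b) = \<sigma> a + \<sigma> b" for a b by (auto simp: \<sigma>_def tw_def fun_eq_iff)
  have \<sigma>_scale: "\<sigma> (pointwise scale c a) = pointwise scale c (\<sigma> a)" for c a
    by (auto simp: \<sigma>_def tw_def fun_eq_iff)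
  have d1: "kdiff X (insert w V) a = kdiff X V a" if a: "a \<in> kchains V (Suc k) Q" for a
  proof
    fix J
    have aw: "a I = 0" if "w \<in> I" for I using kchainsD0[OF a] that V(2) by blast
    consider "w \<in> J" | "w \<notin> J" "J \<subseteq> V" | "w \<notin> J" "\<not> J \<subseteq> V" by blast
    then show "kdiff X (insert w V) a J = kdiff X V a J"
    proof cases
      case 1
      then show ?thesis using V(2) by (auto simp: kdiff_def aw)
    next
      case 2
      then have "insert w V - J = insert w (V - J)" by auto
      then show ?thesis using 2 V by (auto simp: kdiff_def aw)
    qed (auto simp: kdiff_def)
  qed
  have d2: "kdiff X (insert w V) (\<sigma> b) = \<sigma> (kdiff X V b)" if b: "b \<in> kchains V k Q" for b
  proof
    fix J
    consider (w) I where "J = insert w I" "w \<notin> I" "I \<subseteq> V" | (w') I where "J = insert w I" "w \<notin> I" "\<not> I \<subseteq> V"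
      | (V) "w \<notin> J" by (metis Set.set_insert)
    then show "kdiff X (insert w V) (\<sigma> b) J = \<sigma> (kdiff X V b) J"
    proof cases
      case w
      have "finite I" using w finite_subset V by blast
      have "ksgn v J (X v (\<sigma> b (insert v J))) = tw I (ksgn v I (X v (b (insert v I))))"
        if v: "v \<in> V - I" for v
      proof -
        have vw: "v \<noteq> w" using v V by auto
        then have "insert v J - {w} = insert v I" using w by auto
        then show ?thesis using w vw v sgn[OF \<open>finite I\<close>, of v "X v (b (insert v I))"] by (simp add: \<sigma>_def Xtw)
      qed
      moreover have "insert w V - J = V - I" using w V by auto
      ultimately show ?thesis using w V(2)
        by (auto simp: kdiff_def tw_sum \<sigma>_def intro!: sum.cong)
    next
      case w'
      then have "\<not> J \<subseteq> insert w V" by auto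
      then show ?thesis using w' by (simp add: \<sigma>_def) (simp add: kdiff_def)
    next
      case V
      have "X v (\<sigma> b (insert v J)) = 0" for v
        using V w0 kchainsD[OF b Q0] by (auto simp: \<sigma>_def Xtw)
      then show ?thesis using V by (auto simp: kdiff_def \<sigma>_def)
    qed
  qed
  have \<sigma>kchains: "\<sigma> b \<in> kchains (insert w V) (Suc k) Q" if b: "b \<in> kchains V k Q" for b
  proof (rule kchainsI)
    fix J assume J: "J \<subseteq> insert w V" "card J = Suc k"
    show "\<sigma> b J \<in> Q" using Q0 twQ kchainsD[OF b Q0] by (auto simp: \<sigma>_def)
  next
    fix J assume J: "\<not> (J \<subseteq> insert w V \<and> card J = Suc k)"
    have "\<not> (J - {w} \<subseteq> V \<and> card (J - {w}) = k)" if "w \<in> J"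
    proof
      assume *: "J - {w} \<subseteq> V \<and> card (J - {w}) = k"
      then have "finite J" using V(1) finite_subset by (metis finite_Diff_insert infinite_remove)
      then have "card J = Suc k" using * that by (metis card.remove)
      then show False using * J by auto
    qed
    then show "\<sigma> b J = 0" using kchainsD0[OF b] by (auto simp: \<sigma>_def)
  qed
  have kchains_eq: "kchains (insert w V) (Suc k) Q = {a + b |a b. a \<in> kchains V (Suc k) Q \<and> b \<in> \<sigma> ` kchains V k Q}"
  proof (intro equalityI subsetI)
    fix c assume c: "c \<in> kchains (insert w V) (Suc k) Q"
    define a where "a J = (if w \<in> J then 0 else c J)" for J
    define b where "b J = (if w \<in> J then 0 else tw J (c (insert w J)))" for J
    have "c = a + \<sigma> b"
    proof
      fix J show "c J = (a + \<sigma> b) J" by (auto simp: a_def b_def \<sigma>_def insert_absorb)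
    qed
    moreover have "a \<in> kchains V (Suc k) Q"
    proof (rule kchainsI)
      show "a J \<in> Q" for J using Q0 kchainsD[OF c Q0] by (simp add: a_def)
      show "a J = 0" if "\<not> (J \<subseteq> V \<and> card J = Suc k)" for J
        using that kchainsD0[OF c, of J] by (auto simp: a_def)
    qed
    moreover have "b \<in> kchains V k Q"
    proof (rule kchainsI)
      show "b J \<in> Q" for J using Q0 kchainsD[OF c Q0] twQ by (simp add: b_def)
      show "b J = 0" if "\<not> (J \<subseteq> V \<and> card J = k)" for J
      proof -
        have "\<not> (insert w J \<subseteq> insert w V \<and> card (insert w J) = Suc k)" if "w \<notin> J"
        proof
          assume *: "insert w J \<subseteq> insert w V \<and> card (insert w J) = Suc k"
          then have "finite J" using V(1) by (metis card_eq_0_iff finite_insert nat.distinct(1))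
          then show False using * that \<open>\<not> (J \<subseteq> V \<and> card J = k)\<close> by auto
        qed
        then show ?thesis using kchainsD0[OF c, of "insert w J"] by (auto simp: b_def)
      qed
    qed
    ultimately show "c \<in> {a + b |a b. a \<in> kchains V (Suc k) Q \<and> b \<in> \<sigma> ` kchains V k Q}" by blast
  next
    fix c assume "c \<in> {a + b |a b. a \<in> kchains V (Suc k) Q \<and> b \<in> \<sigma> ` kchains V k Q}"
    then obtain a b where c: "c = a + \<sigma> b" and a: "a \<in> kchains V (Suc k) Q" and b: "b \<in> kchains V k Q" by blast
    have "a \<in> kchains (insert w V) (Suc k) Q"
    proof (rule kchainsI)
      show "a J \<in> Q" for J using kchainsD[OF a Q0] .
      show "a J = 0" if "\<not> (J \<subseteq> insert w V \<and> card J = Suc k)" for J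
        using that kchainsD0[OF a, of J] by auto
    qed
    then show "c \<in> kchains (insert w V) (Suc k) Q"
      using c \<sigma>kchains[OF b] ch.subspace_add[OF subspace_kchains[OF sQ]] by blast
  qed
  let ?P1 = "kdiff X V ` kchains V (Suc k) Q" and ?P = "kdiff X V ` kchains V k Q"
  have im: "kdiff X (insert w V) ` kchains (insert w V) (Suc k) Q = {a + b |a b. a \<in> ?P1 \<and> b \<in> \<sigma> ` ?P}"
  proof (intro equalityI subsetI)
    fix x assume "x \<in> kdiff X (insert w V) ` kchains (insert w V) (Suc k) Q"
    then obtain a b where ab: "a \<in> kchains V (Suc k) Q" "b \<in> kchains V k Q" "x = kdiff X (insert w V) (a + \<sigma> b)"
      unfolding kchains_eq by blast
    then have "x = kdiff X V a + \<sigma> (kdiff X V b)" by (simp only: kdiff_add d1 d2)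
    then show "x \<in> {a + b |a b. a \<in> ?P1 \<and> b \<in> \<sigma> ` ?P}" using ab by blast
  next
    fix x assume "x \<in> {a + b |a b. a \<in> ?P1 \<and> b \<in> \<sigma> ` ?P}"
    then obtain a b where ab: "a \<in> kchains V (Suc k) Q" "b \<in> kchains V k Q" "x = kdiff X V a + \<sigma> (kdiff X V b)"
      by blast
    then have "x = kdiff X (insert w V) (a + \<sigma> b)" by (simp only: kdiff_add d1 d2)
    moreover have "a + \<sigma> b \<in> kchains (insert w V) (Suc k) Q" unfolding kchains_eq using ab by blast
    ultimately show "x \<in> kdiff X (insert w V) ` kchains (insert w V) (Suc k) Q" by blast
  qed
  have fP: "fin_dim (pointwise scale) ?P" and fP1: "fin_dim (pointwise scale) ?P1"
    using kdiff_rank_nullity(1)[OF V(1) Q] by auto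
  have ker: "{p \<in> ?P. \<sigma> p = 0} = {0}"
  proof
    show "{0} \<subseteq> {p \<in> ?P. \<sigma> p = 0}"
      using ch.subspace_0[OF ch.fin_dim_subspace[OF fP]] \<sigma>_scale[of 0 0] by auto
    show "{p \<in> ?P. \<sigma> p = 0} \<subseteq> {0}"
    proof clarify
      fix c assume c: "\<sigma> (kdiff X V c) = 0"
      have "kdiff X V c J = 0" for J
      proof (cases "J \<subseteq> V")
        case True
        then have "insert w J - {w} = J" using V(2) by auto
        then have "\<sigma> (kdiff X V c) (insert w J) = tw J (kdiff X V c J)" by (simp add: \<sigma>_def)
        then show ?thesis using c by simp
      qed (simp add: kdiff_def)
      then show "kdiff X V c = 0" by (simp add: fun_eq_iff)
    qed
  qed
  have v\<sigma>: "vdim (pointwise scale) ?P = vdim (pointwise scale) (\<sigma> ` ?P)" and f\<sigma>: "fin_dim (pointwise scale) (\<sigma> ` ?P)"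
    using ch.rank_nullity[OF fP, of \<sigma>] \<sigma>_add \<sigma>_scale unfolding ker by auto
  have disj: "?P1 \<inter> \<sigma> ` ?P \<subseteq> {0}"
  proof
    fix y assume "y \<in> ?P1 \<inter> \<sigma> ` ?P"
    then obtain x b where y: "y = \<sigma> (kdiff X V b)" and e: "kdiff X V x = \<sigma> (kdiff X V b)" by auto
    have "\<sigma> (kdiff X V b) J = 0" for J
    proof (cases "w \<in> J")
      case True
      then show ?thesis unfolding e[symmetric] using V(2) by (auto simp: kdiff_def)
    qed (simp add: \<sigma>_def)
    then show "y \<in> {0}" unfolding y by (simp add: fun_eq_iff)
  qed
  show ?thesis unfolding krank_def im v\<sigma> by (rule ch.direct_sum_dim(2)[OF fP1 f\<sigma> disj])
qed

lemma krank_eq_0: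
  assumes "finite V" "card V < k" shows "krank V k Q = 0"
proof -
  have "card J \<noteq> k" if "J \<subseteq> V" for J using card_mono[OF assms(1) that] assms(2) by simp
  then have "{J. J \<subseteq> V \<and> card J = k} = {}" by blast
  then have "kchains V k Q = supported {} Q" by (simp only: kchains_def)
  also have "\<dots> = {0}" by (auto simp: supported_def fun_eq_iff)
  finally have "kchains V k Q = {0}" .
  then show ?thesis by (simp add: krank_def)
qed

text \<open>
  Pascal's rule: by the previous splitting each further variable adds the Betti number with \<open>k\<close> lowered by one.
\<close>

lemma betti_zero_variables:
  assumes V: "finite V" "finite W" "V \<inter> W = {}" and M: "\<And>j. fin_dim scale (M j)"
    and W0: "\<And>w q. w \<in> W \<Longrightarrow> q \<in> M j \<union> M (j - 1) \<Longrightarrow> X w q = 0"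
  shows "betti (V \<union> W) M k j = (\<Sum>i\<le>k. int (card W choose (k - i)) * betti V M i j)"
  using V(2,3) W0
proof (induction W arbitrary: k)
  case empty
  have "(\<Sum>i\<le>k. int (0 choose (k - i)) * betti V M i j) = (\<Sum>i\<le>k. if i = k then betti V M i j else 0)"
    by (intro sum.cong) (auto simp: binomial_eq_0)
  then show ?case by simp
next
  case (insert w W)
  let ?U = "V \<union> W"
  have U: "finite ?U" "w \<notin> ?U" "V \<union> insert w W = insert w ?U" using V(1) insert by auto
  have r: "krank (insert w ?U) (Suc k) (M i) = krank ?U (Suc k) (M i) + krank ?U k (M i)"
    if "i = j \<or> i = j - 1" for k i
    using that insert.prems(2) by (intro krank_zero_variable[OF U(1,2) M]) auto
  have IH: "betti ?U M k j = (\<Sum>i\<le>k. int (card W choose (k - i)) * betti V M i j)" for k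
    using insert.prems by (intro insert.IH) auto
  show ?case
  proof (cases k)
    case 0
    have "betti (insert w ?U) M 0 j = betti ?U M 0 j" using r[of "j - 1" 0] U(1) M by (simp add: betti_def)
    then show ?thesis using IH[of 0] 0 U(3) by simp
  next
    case (Suc n)
    have "betti (insert w ?U) M (Suc n) j = betti ?U M (Suc n) j + betti ?U M n j"
      using r[of j n] r[of "j - 1" "Suc n"] U(1,2) by (simp add: betti_def algebra_simps)
    also have "\<dots> = betti V M (Suc n) j + (\<Sum>i\<le>n. int (card W choose (Suc n - i)) * betti V M i j) +
        (\<Sum>i\<le>n. int (card W choose (n - i)) * betti V M i j)"
      unfolding IH by simp
    also have "\<dots> = betti V M (Suc n) j + (\<Sum>i\<le>n. int (card (insert w W) choose (Suc n - i)) * betti V M i j)"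
      using insert.hyps by (simp add: sum.distrib[symmetric] Suc_diff_le algebra_simps)
    finally show ?thesis using Suc U(3) by simp
  qed
qed

text \<open>
  A cycle with coefficients in the line of \<open>m\<close> has no component at a set \<open>J \<union> {v}\<close> with \<open>v \<in> V\<close>, since the
  vectors \<open>X v m\<close> in its boundary at \<open>J\<close> are independent. So the cycles are the chains over \<open>U - V\<close>, and the
  rank is the number of the remaining sets.
\<close>

lemma krank_bottom:
  assumes U: "finite U" "V \<subseteq> U" and m: "m \<noteq> 0"
    and ind: "\<And>c v. (\<Sum>v\<in>V. c v *s X v m) = 0 \<Longrightarrow> v \<in> V \<Longrightarrow> c v = 0"
    and X0: "\<And>w. w \<in> U - V \<Longrightarrow> X w m = 0"
  shows "krank U (Suc k) (range (\<lambda>c. c *s m)) + (card (U - V) choose Suc k) = card U choose Suc k"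
proof -
  let ?Q = "range (\<lambda>c. c *s m)"
  have Q: "qdim scale ?Q {0} 1" by (rule qdim_line[OF m])
  then have fQ: "fin_dim scale ?Q" and vQ: "vdim scale ?Q = 1"
    unfolding fin_dim_def using vdim_eq by blast+
  have Q0: "0 \<in> ?Q" using subspace_0 fin_dim_subspace[OF fQ] by blast
  have "kcycles X U (Suc k) ?Q = kchains (U - V) (Suc k) ?Q"
  proof (intro equalityI subsetI)
    fix c assume "c \<in> kcycles X U (Suc k) ?Q"
    then have c: "c \<in> kchains U (Suc k) ?Q" and d: "kdiff X U c = 0" by (auto simp: kcycles_def)
    have "\<exists>a. c J = a *s m" for J using kchainsD[OF c Q0, of J] by auto
    then obtain a where a: "\<And>J. c J = a J *s m" by metis
    show "c \<in> kchains (U - V) (Suc k) ?Q"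
    proof (rule kchainsI)
      show "c J \<in> ?Q" for J using kchainsD[OF c Q0] .
      fix I assume I: "\<not> (I \<subseteq> U - V \<and> card I = Suc k)"
      show "c I = 0"
      proof (cases "I \<subseteq> U \<and> card I = Suc k")
        case True
        then obtain v where v: "v \<in> I" "v \<in> V" using I by auto
        define J where "J = I - {v}"
        have J: "J \<subseteq> U" "v \<notin> J" "I = insert v J" using v True by (auto simp: J_def)
        \<comment> \<open>the coefficients of the vectors \<open>X u m\<close> in the boundary at \<open>J\<close>\<close>
        define e where "e u = (if u \<in> J then 0 else if even (card {w \<in> J. w < u}) then a (insert u J) else - a (insert u J))" for u
        have "(\<Sum>u\<in>V. e u *s X u m) = (\<Sum>u\<in>U-J. e u *s X u m)"
          using U J X0 by (intro sum.mono_neutral_cong) (auto simp: e_def finite_subset)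
        also have "\<dots> = (\<Sum>u\<in>U-J. ksgn u J (X u (c (insert u J))))"
          by (intro sum.cong) (auto simp: e_def ksgn_def a X_scale)
        also have "\<dots> = kdiff X U c J" using J by (simp add: kdiff_def)
        also have "\<dots> = 0" using d by simp
        finally have "e v = 0" using ind v by blast
        then have "a I = 0" using J by (auto simp: e_def split: if_splits)
        then show ?thesis using a by simp
      qed (use kchainsD0[OF c] in blast)
    qed
  next
    fix c assume c: "c \<in> kchains (U - V) (Suc k) ?Q"
    have "c \<in> kchains U (Suc k) ?Q"
    proof (rule kchainsI)
      show "c J \<in> ?Q" for J using kchainsD[OF c Q0] .
      show "c J = 0" if "\<not> (J \<subseteq> U \<and> card J = Suc k)" for J
        using that kchainsD0[OF c, of J] by auto
    qed
    moreover have "X v (c (insert v J)) = 0" if "v \<in> U" for v J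
    proof (cases "v \<in> V")
      case True
      then have "c (insert v J) = 0" using kchainsD0[OF c, of "insert v J"] by auto
      then show ?thesis by simp
    next
      case False
      then show ?thesis using X0[of v] that kchainsD[OF c Q0, of "insert v J"] by (auto simp: X_scale)
    qed
    then have "kdiff X U c = 0" by (auto simp: kdiff_def fun_eq_iff intro!: sum.neutral)
    ultimately show "c \<in> kcycles X U (Suc k) ?Q" by (simp add: kcycles_def)
  qed
  then have "vdim (pointwise scale) (kcycles X U (Suc k) ?Q) = card (U - V) choose Suc k"
    using kchains_dim(2)[OF _ fQ] U vQ by simp
  then show ?thesis using kdiff_rank_nullity(2)[OF U(1) fQ, of "Suc k"] vQ by simp
qed

text \<open>
  A boundary vanishes at every \<open>J \<supseteq> V\<close>, since only \<open>X u\<close> with \<open>u \<in> U - V\<close> contribute there. At any other \<open>J\<close>, with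
  \<open>v \<in> V - J\<close>, the element \<open>y v\<close> placed at \<open>J \<union> {v}\<close> has boundary \<open>\<plusminus>n\<close> at \<open>J\<close> and \<open>0\<close> elsewhere, because
  \<open>X u (y v) = 0\<close> for \<open>u \<noteq> v\<close>.
\<close>

lemma krank_top:
  assumes U: "finite U" "V \<subseteq> U" and n: "n \<noteq> 0" and Q: "subspace Q"
    and XQ: "\<And>v q. v \<in> U \<Longrightarrow> q \<in> Q \<Longrightarrow> X v q \<in> range (\<lambda>c. c *s n)"
    and y: "\<And>v. v \<in> V \<Longrightarrow> y v \<in> Q" "\<And>u v. u \<in> U \<Longrightarrow> v \<in> V \<Longrightarrow> X u (y v) = (if u = v then n else 0)"
    and X0: "\<And>w q. w \<in> U - V \<Longrightarrow> q \<in> Q \<Longrightarrow> X w q = 0"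
  shows "krank U (Suc k) Q + bin (card (U - V)) (int k - int (card V)) = card U choose k"
proof -
  let ?R = "range (\<lambda>c. c *s n)"
  have R: "qdim scale ?R {0} 1" by (rule qdim_line[OF n])
  then have fR: "fin_dim scale ?R" and vR: "vdim scale ?R = 1"
    unfolding fin_dim_def using vdim_eq by blast+
  have sR: "subspace ?R" and R0: "0 \<in> ?R" using subspace_0 fin_dim_subspace[OF fR] by blast+
  have Q0: "0 \<in> Q" using subspace_0[OF Q] .
  have fV: "finite V" using U finite_subset by blast
  let ?\<J> = "{J. J \<subseteq> U \<and> card J = k \<and> \<not> V \<subseteq> J}"
  have f\<J>: "finite ?\<J>" by (rule finite_subset[OF _ finite_ksubsets[OF U(1), of k]]) auto
  have sk: "ch.subspace (kdiff X U ` kchains U (Suc k) Q)" using Q by (rule subspace_kdiff_image)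
  have "kdiff X U ` kchains U (Suc k) Q = supported ?\<J> ?R"
  proof (intro equalityI subsetI)
    fix b assume "b \<in> kdiff X U ` kchains U (Suc k) Q"
    then obtain c where c: "c \<in> kchains U (Suc k) Q" and b: "b = kdiff X U c" by blast
    have bk: "b \<in> kchains U k ?R" unfolding b by (rule kdiff_in_kchains[OF U(1) c sR XQ])
    have "b J = 0" if "V \<subseteq> J" for J
    proof -
      have "X v (c (insert v J)) = 0" if "v \<in> U - J" for v
        using that \<open>V \<subseteq> J\<close> by (intro X0 kchainsD[OF c Q0]) auto
      then show ?thesis unfolding b kdiff_def by (auto intro!: sum.neutral)
    qed
    then show "b \<in> supported ?\<J> ?R"
      using kchainsD[OF bk R0] kchainsD0[OF bk] by (auto simp: supported_def)
  next
    fix b assume b: "b \<in> supported ?\<J> ?R"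
    have el: "(\<lambda>I. if I = J then b J else 0) \<in> kdiff X U ` kchains U (Suc k) Q" if J: "J \<in> ?\<J>" for J
    proof -
      have "b J \<in> ?R" using b J unfolding supported_def by blast
      then obtain a where a: "b J = a *s n" by blast
      obtain v where v: "v \<in> V" "v \<notin> J" using J by auto
      have fJ: "finite J" using J finite_subset U(1) by auto
      define c where "c I = (if I = insert v J then ksgn v J (a *s y v) else 0)" for I
      have "c \<in> kchains U (Suc k) Q"
      proof (rule kchainsI)
        show "c I \<in> Q" for I using y(1)[OF v(1)] Q Q0
          by (auto simp: c_def ksgn_def subspace_scale subspace_neg)
        show "c I = 0" if "\<not> (I \<subseteq> U \<and> card I = Suc k)" for I
          using that J v U(2) fJ by (auto simp: c_def)
      qed
      moreover have "kdiff X U c = (\<lambda>I. if I = J then b J else 0)"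
      proof
        fix I
        have z: "X u (c (insert u I)) = (if I = J \<and> u = v then ksgn v J (b J) else 0)"
          if "u \<in> U - I" for u
        proof (cases "u = v")
          case True
          then have "insert u I = insert v J \<longleftrightarrow> I = J" using that v by (simp add: insert_ident)
          then show ?thesis using True v y(2)[of v v] U(2)
            by (auto simp: c_def X_ksgn X_scale a)
        next
          case False
          then show ?thesis using that v y(2)[of u v] by (auto simp: c_def X_ksgn X_scale)
        qed
        show "kdiff X U c I = (if I = J then b J else 0)"
        proof (cases "I \<subseteq> U")
          case True
          have "kdiff X U c I = (\<Sum>u\<in>U-I. if u = v then (if I = J then b J else 0) else 0)"
            using True z by (auto simp: kdiff_def intro!: sum.cong)
          also have "\<dots> = (if v \<in> U - I then (if I = J then b J else 0) else 0)"
            using U(1) by simp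
          finally show ?thesis using v U(2) by auto
        next
          case False
          then show ?thesis using J by (auto simp: kdiff_def)
        qed
      qed
      ultimately show ?thesis by (metis imageI)
    qed
    have "b = (\<Sum>J\<in>?\<J>. (\<lambda>I. if I = J then b J else 0))"
    proof
      fix I
      have "(\<Sum>J\<in>?\<J>. (\<lambda>I. if I = J then b J else 0)) I = (\<Sum>J\<in>?\<J>. if I = J then b J else 0)"
        by (induction rule: finite_induct[OF f\<J>]) auto
      also have "\<dots> = (if I \<in> ?\<J> then b I else 0)" using f\<J> by simp
      also have "\<dots> = b I" using b by (auto simp: supported_def)
      finally show "b I = (\<Sum>J\<in>?\<J>. (\<lambda>I. if I = J then b J else 0)) I" by simp
    qed
    also have "\<dots> \<in> kdiff X U ` kchains U (Suc k) Q" using el by (intro ch.subspace_sum[OF sk])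
    finally show "b \<in> kdiff X U ` kchains U (Suc k) Q" .
  qed
  then have r: "krank U (Suc k) Q = card ?\<J>"
    unfolding krank_def using vdim_supported(2)[OF fR f\<J>] vR by simp
  let ?\<V> = "{J. J \<subseteq> U \<and> card J = k \<and> V \<subseteq> J}"
  have "card ?\<V> = bin (card (U - V)) (int k - int (card V))"
  proof (cases "card V \<le> k")
    case True
    have "card ?\<V> = card {I. I \<subseteq> U - V \<and> card I = k - card V}"
    proof (rule bij_betw_same_card[of "\<lambda>J. J - V"], rule bij_betw_byWitness[of _ "\<lambda>I. I \<union> V"])
      show "(\<lambda>J. J - V) ` ?\<V> \<subseteq> {I. I \<subseteq> U - V \<and> card I = k - card V}"
        using fV by (auto simp: card_Diff_subset)
      show "(\<lambda>I. I \<union> V) ` {I. I \<subseteq> U - V \<and> card I = k - card V} \<subseteq> ?\<V>"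
      proof clarify
        fix I assume I: "I \<subseteq> U - V" "card I = k - card V"
        then have "card (I \<union> V) = k" using True U(1) fV finite_subset[of I U]
          by (subst card_Un_disjoint) auto
        then show "I \<union> V \<subseteq> U \<and> card (I \<union> V) = k \<and> V \<subseteq> I \<union> V" using I U(2) by auto
      qed
    qed auto
    also have "\<dots> = card (U - V) choose (k - card V)" using U by (intro n_subsets) auto
    finally show ?thesis using True by (simp add: bin_def nat_diff_distrib)
  next
    case False
    have "\<not> V \<subseteq> J" if "J \<subseteq> U" "card J = k" for J
      using card_mono[of J V] finite_subset[OF that(1) U(1)] that(2) False by auto
    then have "?\<V> = {}" by blast
    then have "card ?\<V> = 0" by (simp only: card.empty)
    moreover have "int k - int (card V) < 0" using False by simp
    ultimately show ?thesis by (simp only: bin_def if_True)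
  qed
  moreover have "card ?\<J> + card ?\<V> = card {J. J \<subseteq> U \<and> card J = k}"
    using U(1) f\<J> by (subst card_Un_disjoint[symmetric]) (auto intro!: arg_cong[of _ _ card] finite_subset[OF _ finite_ksubsets[OF U(1), of k]])
  ultimately show ?thesis using r n_subsets[OF U(1), of k] by simp
qed

end

section \<open>Koszul homology of a connected sum\<close>

lemma choose_add_le: "0 < n \<Longrightarrow> (s choose n) + (t choose n) \<le> (s + t) choose n"
proof -
  assume n: "0 < n"
  have "(s choose n) + (t choose n) = (\<Sum>k\<in>{0,n}. (s choose k) * (t choose (n - k)))" using n by simp
  also have "\<dots> \<le> (\<Sum>k\<le>n. (s choose k) * (t choose (n - k)))" by (rule sum_mono2) auto
  also have "\<dots> = (s + t) choose n" by (rule vandermonde)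
  finally show ?thesis .
qed

text \<open>
  The subsets of size \<open>k + 1\<close> of either part are distinct subsets of the union, so the truncated
  subtractions are exact.
\<close>

lemma int_nu:
  "int (nu s t k) = int ((s + t) choose (k + 1)) - int (s choose (k + 1)) - int (t choose (k + 1))"
  using choose_add_le[of "k + 1" s t] by (simp add: nu_def)

text \<open>
  \<open>\<nu>\<^sub>r\<^sub>-\<^sub>k\<^sub>-\<^sub>1\<close> in the form in which it arises from \<open>krank_top\<close>: complements turn the sets of size
  \<open>r - k\<close> inside one part into the sets of size \<open>k\<close> that contain the other part.
\<close>

lemma int_nu_dual:
  assumes "k < s + t"
  shows "int (nu s t (s + t - Suc k)) =
    int ((s + t) choose k) - int (bin t (int k - int s)) - int (bin s (int k - int t))"
proof -
  have c: "a choose (a + b - k) = bin a (int k - int b)" if "k < a + b" for a b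
  proof (cases "b \<le> k")
    case True
    then have e: "a + b - k = a - (k - b)" and "k - b \<le> a" using that by auto
    then have "a choose (a + b - k) = a choose (k - b)"
      unfolding e by (intro binomial_symmetric[symmetric])
    then show ?thesis using True by (simp add: bin_def nat_diff_distrib)
  next
    case False
    then show ?thesis by (simp add: bin_def binomial_eq_0)
  qed
  have "s + t - Suc k + 1 = s + t - k" using assms by simp
  then show ?thesis
    using int_nu[of s t "s + t - Suc k"] c[of s t] c[of t s] binomial_symmetric[of k "s + t"] assms
    by (simp add: add.commute)
qed

context koszul
begin

lemma krank_zero_action:
  assumes "finite V" "subspace Q" "\<And>v q. v \<in> V \<Longrightarrow> q \<in> Q \<Longrightarrow> X v q = 0"
  shows "krank V k Q = 0"
proof -
  have Q0: "0 \<in> Q" using subspace_0 assms(2) .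
  have "kdiff X V c = 0" if "c \<in> kchains V k Q" for c
    using kchainsD[OF that Q0] assms(3) by (auto simp: kdiff_def fun_eq_iff intro!: sum.neutral)
  moreover have "0 \<in> kchains V k Q" using ch.subspace_0[OF subspace_kchains[OF assms(2)]] .
  ultimately have "kdiff X V ` kchains V k Q = {0}" by (metis (no_types, lifting) image_constant_conv image_cong empty_iff)
  then show ?thesis by (simp add: krank_def)
qed

text \<open>
  Degree \<open>0\<close> and degree \<open>d\<close> are lines; on the first, the variables in \<open>V\<close> act independently, and the
  second is reached from degree \<open>d - 1\<close> by elements dual to these variables. The variables outside \<open>V\<close>
  act by zero. The inverse system of a form \<open>g\<close> in the variables \<open>V\<close> with \<open>ann(g)\<^sub>1 = 0\<close> is of this
  shape over every \<open>U \<supseteq> V\<close>.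
\<close>

definition unit_ends :: "nat set \<Rightarrow> nat set \<Rightarrow> (int \<Rightarrow> 'm set) \<Rightarrow> nat \<Rightarrow> bool" where
  "unit_ends V U M d \<longleftrightarrow> graded_submodule U M \<and> (\<forall>j. fin_dim scale (M j)) \<and>
     (\<forall>j. j < 0 \<or> int d < j \<longrightarrow> M j = {0}) \<and>
     (\<forall>w\<in>U-V. \<forall>j. \<forall>q\<in>M j. X w q = 0) \<and>
     (\<exists>m. m \<noteq> 0 \<and> M 0 = range (\<lambda>c. c *s m) \<and>
        (\<forall>c. (\<Sum>v\<in>V. c v *s X v m) = 0 \<longrightarrow> (\<forall>v\<in>V. c v = 0))) \<and>
     (\<exists>n y. n \<noteq> 0 \<and> M (int d) = range (\<lambda>c. c *s n) \<and>
        (\<forall>v\<in>V. y v \<in> M (int d - 1) \<and> (\<forall>u\<in>U. X u (y v) = (if u = v then n else 0))))"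

lemma unit_ends_submodule: "unit_ends V U M d \<Longrightarrow> graded_submodule U M"
  and unit_ends_fin_dim: "unit_ends V U M d \<Longrightarrow> fin_dim scale (M j)"
  unfolding unit_ends_def by (elim conjE, assumption, elim conjE allE)

lemma unit_ends_ranks:
  assumes M: "unit_ends V U M d" and U: "finite U" "V \<subseteq> U"
  shows "krank U (Suc k) (M 0) + (card (U - V) choose Suc k) = card U choose Suc k"
    and "krank U (Suc k) (M (int d - 1)) + bin (card (U - V)) (int k - int (card V)) = card U choose k"
    and "krank U k (M (int d)) = 0" and "vdim scale (M 0) = 1" and "vdim scale (M (int d)) = 1"
proof -
  have gr: "subspace (M j)" and XM: "v \<in> U \<Longrightarrow> q \<in> M j \<Longrightarrow> X v q \<in> M (j + 1)" for j v q
    using M by (auto simp: unit_ends_def graded_submodule_def)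
  have top: "M (int d + 1) = {0}" using M by (auto simp: unit_ends_def)
  have "\<forall>w\<in>U-V. \<forall>j. \<forall>q\<in>M j. X w q = 0"
    using M unfolding unit_ends_def by (elim conjE)
  then have X0: "X w q = 0" if "w \<in> U - V" "q \<in> M j" for w q j
    using that by (elim ballE allE) auto
  have "\<exists>m. m \<noteq> 0 \<and> M 0 = range (\<lambda>c. c *s m) \<and>
        (\<forall>c. (\<Sum>v\<in>V. c v *s X v m) = 0 \<longrightarrow> (\<forall>v\<in>V. c v = 0))"
    using M unfolding unit_ends_def by (elim conjE)
  then obtain m where m: "m \<noteq> 0" "M 0 = range (\<lambda>c. c *s m)"
      "\<forall>c. (\<Sum>v\<in>V. c v *s X v m) = 0 \<longrightarrow> (\<forall>v\<in>V. c v = 0)"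
    by (elim exE conjE)
  then have mi: "c v = 0" if "(\<Sum>v\<in>V. c v *s X v m) = 0" "v \<in> V" for c v using that by simp
  have "m \<in> M 0" unfolding m(2) by (metis rangeI scale_one)
  show "krank U (Suc k) (M 0) + (card (U - V) choose Suc k) = card U choose Suc k"
    unfolding m(2)
  proof (rule krank_bottom[OF U m(1)])
    show "c v = 0" if "(\<Sum>v\<in>V. c v *s X v m) = 0" "v \<in> V" for c v using mi[OF that] .
    show "X w m = 0" if "w \<in> U - V" for w using X0[OF that \<open>m \<in> M 0\<close>] .
  qed
  have "\<exists>n y. n \<noteq> 0 \<and> M (int d) = range (\<lambda>c. c *s n) \<and>
        (\<forall>v\<in>V. y v \<in> M (int d - 1) \<and> (\<forall>u\<in>U. X u (y v) = (if u = v then n else 0)))"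
    using M unfolding unit_ends_def by (elim conjE)
  then obtain n y where n: "n \<noteq> 0" "M (int d) = range (\<lambda>c. c *s n)"
      "\<forall>v\<in>V. y v \<in> M (int d - 1) \<and> (\<forall>u\<in>U. X u (y v) = (if u = v then n else 0))"
    by (elim exE conjE)
  show "krank U (Suc k) (M (int d - 1)) + bin (card (U - V)) (int k - int (card V)) = card U choose k"
  proof (rule krank_top[OF U n(1) gr, where y = y])
    show "X v q \<in> range (\<lambda>c. c *s n)" if "v \<in> U" "q \<in> M (int d - 1)" for v q
      using XM[OF that] by (simp add: n(2))
    show "X w q = 0" if "w \<in> U - V" "q \<in> M (int d - 1)" for w q
      using X0[OF that] .
    show "y v \<in> M (int d - 1)" if "v \<in> V" for v using n(3) that by simp
    show "X u (y v) = (if u = v then n else 0)" if "u \<in> U" "v \<in> V" for u v using n(3) that by simp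
  qed
  show "krank U k (M (int d)) = 0" using XM[of _ _ "int d"] top
    by (intro krank_zero_action[OF U(1) gr]) auto
  show "vdim scale (M 0) = 1" "vdim scale (M (int d)) = 1"
    unfolding m(2) n(2) using qdim_line m(1) n(1) vdim_eq by blast+
qed

lemma unit_ends_betti:
  assumes M: "unit_ends U U M d" and U: "finite U" and d: "0 < d"
  shows "betti U M (Suc k) 0 = 0" and "betti U M k (int d) = (if k = card U then 1 else 0)"
    and "j < 0 \<or> int d < j \<Longrightarrow> betti U M k j = 0"
proof -
  note r = unit_ends_ranks[OF M U subset_refl]
  have z: "krank U i (M j) = 0" if "j < 0 \<or> int d \<le> j" for i j
  proof (cases "j = int d")
    case False
    then have "M j = {0}" using M that by (auto simp: unit_ends_def)
    then show ?thesis using krank_zero_action[OF U subspace_single_0] by simp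
  qed (simp add: r)
  show "betti U M (Suc k) 0 = 0" using r(1)[of k] r(4) z[of "-1"] by (simp add: betti_def)
  have "int (card U choose k) - int (krank U (Suc k) (M (int d - 1))) = int (bin 0 (int k - int (card U)))"
    using r(2)[of k] by simp
  moreover have "k < card U \<or> k = card U \<or> card U < k" by linarith
  ultimately show "betti U M k (int d) = (if k = card U then 1 else 0)"
    using r(5) z[of "int d" k] by (auto simp: betti_def bin_def binomial_eq_0)
  show "betti U M k j = 0" if "j < 0 \<or> int d < j"
  proof -
    have "M j = {0}" using M that by (auto simp: unit_ends_def)
    then show ?thesis using z[of j] z[of "j - 1"] that by (auto simp: betti_def)
  qed
qed

text \<open>
  Dimensions and ranks are additive, except the rank of the differential that leaves degree \<open>0\<close>,
  which matters for \<open>j = 1\<close>, and of the one that arrives in degree \<open>d\<close>, which matters for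
  \<open>j = d - 1\<close>. If \<open>d = 2\<close>, both defects occur at the same \<open>j\<close>.
\<close>

theorem betti_connected_sum:
  assumes A: "unit_ends V U A d" and B: "unit_ends W U B d" and C: "unit_ends U U C d"
    and U: "finite U" "U = V \<union> W" "V \<inter> W = {}"
    and sum: "\<And>j. 1 \<le> j \<Longrightarrow> j < int d \<Longrightarrow> C j = {a + b |a b. a \<in> A j \<and> b \<in> B j}"
    and disj: "\<And>j. 1 \<le> j \<Longrightarrow> j < int d \<Longrightarrow> A j \<inter> B j \<subseteq> {0}"
    and j: "1 \<le> j" "j < int d" and k: "0 < k" "k \<le> card U"
  shows "betti U C k j = betti U A k j + betti U B k j
    + (if j = 1 then int (nu (card V) (card W) k) else 0)
    + (if j = int d - 1 then int (nu (card V) (card W) (card U - k)) else 0)"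
proof -
  obtain k' where k': "k = Suc k'" using k(1) gr0_implies_Suc by blast
  let ?s = "card V" and ?t = "card W"
  have fin: "finite V" "finite W" and sub: "V \<subseteq> U" "W \<subseteq> U" using U by auto
  have r: "card U = ?s + ?t" using U fin by (simp add: card_Un_disjoint)
  have UV: "U - V = W" "U - W = V" using U by auto
  have fd: "fin_dim scale (A i)" "fin_dim scale (B i)" for i using A B by (auto simp: unit_ends_def)
  have XA: "v \<in> U \<Longrightarrow> q \<in> A i \<Longrightarrow> X v q \<in> A (i + 1)" and XB: "v \<in> U \<Longrightarrow> q \<in> B i \<Longrightarrow> X v q \<in> B (i + 1)"
    for v q i using A B by (auto simp: unit_ends_def graded_submodule_def)
  have mid: "krank U (Suc n) (C i) = krank U (Suc n) (A i) + krank U (Suc n) (B i)"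
    if "1 \<le> i" "i + 1 < int d" for i n
  proof -
    have "C i = {a + b |a b. a \<in> A i \<and> b \<in> B i}" using sum that by simp
    then show ?thesis using krank_direct_sum[OF U(1) fd XA XB _ _ disj[of "i + 1"]] fd fin_dim_subspace that
      by simp
  qed
  note rA = unit_ends_ranks[OF A U(1) sub(1)] and rB = unit_ends_ranks[OF B U(1) sub(2)]
    and rC = unit_ends_ranks[OF C U(1) subset_refl]
  have dimC: "vdim scale (C j) = vdim scale (A j) + vdim scale (B j)"
    using direct_sum_dim(2)[OF fd disj[OF j]] sum[OF j] by simp
  have top: "int (krank U (Suc k') (C j)) = int (krank U (Suc k') (A j)) + int (krank U (Suc k') (B j))
      - (if j = int d - 1 then int (nu ?s ?t (card U - k)) else 0)"
  proof (cases "j = int d - 1")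
    case True
    have "k' < ?s + ?t" using k k' r by simp
    moreover have "bin 0 (int k' - int (card U)) = 0" using k k' by (simp add: bin_def)
    ultimately show ?thesis
      using True rA(2)[of k'] rB(2)[of k'] rC(2)[of k'] int_nu_dual[of k' ?s ?t] UV r k'
      by simp
  next
    case False
    then show ?thesis using mid[of j k'] j by simp
  qed
  have bot: "int (krank U (Suc k) (C (j - 1))) =
      int (krank U (Suc k) (A (j - 1))) + int (krank U (Suc k) (B (j - 1)))
      - (if j = 1 then int (nu ?s ?t k) else 0)"
  proof (cases "j = 1")
    case True
    then show ?thesis using rA(1)[of k] rB(1)[of k] rC(1)[of k] int_nu[of ?s ?t k] UV r by simp
  next
    case False
    then show ?thesis using mid[of "j - 1" k] j by simp
  qed
  show ?thesis using top bot by (simp add: betti_def dimC k' algebra_simps)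
qed

end

section \<open>Polynomials and contraction\<close>

abbreviation "lk \<equiv> Poly_Mapping.lookup"
abbreviation "ks \<equiv> Poly_Mapping.keys"

abbreviation unit_exp :: "nat \<Rightarrow> expo" where "unit_exp v \<equiv> Poly_Mapping.single v 1"

definition var :: "nat \<Rightarrow> 'k::field mpoly" where
  "var v = Poly_Mapping.single (unit_exp v) 1"

definition smul :: "'k::field \<Rightarrow> 'k mpoly \<Rightarrow> 'k mpoly" where
  "smul c p = Poly_Mapping.single 0 c * p"

lemma keys_expo_add: "ks (a + b) = ks a \<union> ks (b::expo)"
  by (auto simp: in_keys_iff lookup_add)

lemma mdeg_superset: "finite A \<Longrightarrow> ks m \<subseteq> A \<Longrightarrow> mdeg m = (\<Sum>i\<in>A. lk m i)"
  unfolding mdeg_def by (rule sum.mono_neutral_left) (auto simp: in_keys_iff)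

lemma mdeg_add: "mdeg (a + b) = mdeg a + mdeg b"
proof -
  let ?A = "ks a \<union> ks b"
  have "mdeg (a + b) = (\<Sum>i\<in>?A. lk (a + b) i)" by (rule mdeg_superset) (auto simp: keys_expo_add)
  also have "\<dots> = (\<Sum>i\<in>?A. lk a i) + (\<Sum>i\<in>?A. lk b i)" by (simp add: lookup_add sum.distrib)
  also have "\<dots> = mdeg a + mdeg b" by (simp add: mdeg_superset[of ?A])
  finally show ?thesis .
qed

lemma mdeg_0 [simp]: "mdeg 0 = 0" by (simp add: mdeg_def)

lemma mdeg_single [simp]: "mdeg (Poly_Mapping.single v n) = n"
  by (simp add: mdeg_def)

lemma mdeg_eq_0_iff: "mdeg m = 0 \<longleftrightarrow> m = 0"
  unfolding mdeg_def by (auto simp: in_keys_iff intro: poly_mapping_eqI)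

lemma poly_sum_singles: "p = (\<Sum>m\<in>ks p. Poly_Mapping.single m (lk p m))"
  by (rule poly_mapping_eqI) (auto simp: lookup_sum lookup_single when_def in_keys_iff)

lemma lookup_single_mult_add:
  fixes p :: "'k::field mpoly"
  shows "lk (Poly_Mapping.single e c * p) (e + m) = c * lk p m"
proof -
  have "Poly_Mapping.single e c * p = (\<Sum>a\<in>ks p. Poly_Mapping.single (e + a) (c * lk p a))"
    by (subst poly_sum_singles[of p]) (simp add: sum_distrib_left mult_single)
  then have "lk (Poly_Mapping.single e c * p) (e + m) = (\<Sum>a\<in>ks p. if a = m then c * lk p a else 0)"
    by (auto simp: lookup_sum lookup_single when_def intro!: sum.cong)
  then show ?thesis by (auto simp: in_keys_iff)
qed

lemma lookup_single_mult_0: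
  fixes p :: "'k::field mpoly"
  assumes "\<And>a. e + a \<noteq> m"
  shows "lk (Poly_Mapping.single e c * p) m = 0"
proof -
  have "Poly_Mapping.single e c * p = (\<Sum>a\<in>ks p. Poly_Mapping.single (e + a) (c * lk p a))"
    by (subst poly_sum_singles[of p]) (simp add: sum_distrib_left mult_single)
  then show ?thesis using assms by (auto simp: lookup_sum lookup_single when_def)
qed

lemma lookup_smul [simp]: "lk (smul c p) m = c * lk p m"
  using lookup_single_mult_add[of 0 c p m] by (simp add: smul_def)

lemma expo_minus_plus:
  assumes "v \<in> ks m" shows "unit_exp v + (m - unit_exp v) = (m :: expo)"
  using assms by (intro poly_mapping_eqI) (auto simp: lookup_add lookup_minus lookup_single when_def in_keys_iff)

lemma lookup_var_mult:
  "lk (var v * p) m = (if v \<in> ks m then lk p (m - unit_exp v) else 0)"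
proof (cases "v \<in> ks m")
  case True
  then show ?thesis
    using lookup_single_mult_add[of "unit_exp v" 1 p "m - unit_exp v"]
    unfolding expo_minus_plus[OF True] by (simp add: var_def)
next
  case False
  have "unit_exp v + a \<noteq> m" for a
    using False by (auto simp: keys_expo_add)
  then show ?thesis using False by (simp add: var_def lookup_single_mult_0)
qed

lemma lookup_contract: "lk (contract D f) \<gamma> = (\<Sum>\<beta>\<in>ks D. lk D \<beta> * lk f (\<beta> + \<gamma>))"
  unfolding contract_def lookup_sum
proof (rule sum.cong[OF refl])
  fix \<beta> assume "\<beta> \<in> ks D"
  have eq: "(\<forall>i. lk \<beta> i \<le> lk \<alpha> i) \<and> \<alpha> - \<beta> = \<gamma> \<longleftrightarrow> \<alpha> = \<beta> + \<gamma>" for \<alpha> :: expo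
  proof
    assume a: "(\<forall>i. lk \<beta> i \<le> lk \<alpha> i) \<and> \<alpha> - \<beta> = \<gamma>"
    have "lk \<alpha> i = lk (\<beta> + \<gamma>) i" for i
    proof -
      have "lk \<gamma> i = lk \<alpha> i - lk \<beta> i" "lk \<beta> i \<le> lk \<alpha> i" using a by (auto simp: lookup_minus[symmetric])
      then show ?thesis by (simp add: lookup_add)
    qed
    then show "\<alpha> = \<beta> + \<gamma>" by (rule poly_mapping_eqI)
  qed (auto simp: lookup_add)
  have "(\<Sum>\<alpha>\<in>ks f. lk (if \<forall>i. lk \<beta> i \<le> lk \<alpha> i
      then Poly_Mapping.single (\<alpha> - \<beta>) (lk D \<beta> * lk f \<alpha>) else 0) \<gamma>) =
    (\<Sum>\<alpha>\<in>ks f. if \<alpha> = \<beta> + \<gamma> then lk D \<beta> * lk f \<alpha> else 0)"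
    by (intro sum.cong refl) (use eq in \<open>auto simp: lookup_single when_def\<close>)
  also have "\<dots> = lk D \<beta> * lk f (\<beta> + \<gamma>)" by (auto simp: in_keys_iff)
  finally show "(\<Sum>\<alpha>\<in>ks f. lk (if \<forall>i. lk \<beta> i \<le> lk \<alpha> i
      then Poly_Mapping.single (\<alpha> - \<beta>) (lk D \<beta> * lk f \<alpha>) else 0) \<gamma>) = lk D \<beta> * lk f (\<beta> + \<gamma>)" .
qed

lemma lookup_contract_superset:
  assumes "finite A" "ks D \<subseteq> A"
  shows "lk (contract D f) \<gamma> = (\<Sum>\<beta>\<in>A. lk D \<beta> * lk f (\<beta> + \<gamma>))"
  unfolding lookup_contract using assms by (intro sum.mono_neutral_left) (auto simp: in_keys_iff)

lemma contract_add_left: "contract (D + E) f = contract D f + contract E f"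
proof (rule poly_mapping_eqI)
  fix m
  let ?A = "ks D \<union> ks E"
  have "ks (D + E) \<subseteq> ?A" by (rule keys_add)
  then show "lk (contract (D + E) f) m = lk (contract D f + contract E f) m"
    by (simp add: lookup_contract_superset[of ?A] lookup_add sum.distrib algebra_simps)
qed

lemma contract_add_right: "contract D (f + g) = contract D f + contract D g"
  by (rule poly_mapping_eqI) (simp add: lookup_contract lookup_add sum.distrib algebra_simps)

lemma contract_zero_left [simp]: "contract 0 f = 0"
  by (simp add: contract_def)

lemma contract_zero_right [simp]: "contract D 0 = 0"
  by (simp add: contract_def)

lemma contract_sum_left: "contract (sum D A) f = (\<Sum>i\<in>A. contract (D i) f)"
  by (induction A rule: infinite_finite_induct) (auto simp: contract_add_left)

lemma lookup_contract_single: "lk (contract (Poly_Mapping.single e c) f) m = c * lk f (e + m)"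
  by (cases "c = 0") (auto simp: lookup_contract)

lemma contract_mult: "contract (p * q) f = contract p (contract q f)"
proof -
  have s: "contract (Poly_Mapping.single e c * Poly_Mapping.single e' c') f =
      contract (Poly_Mapping.single e c) (contract (Poly_Mapping.single e' c') f)" for e c e' c'
    by (rule poly_mapping_eqI) (simp add: mult_single lookup_contract_single add_ac mult_ac)
  have r: "contract p (sum g A) = (\<Sum>i\<in>A. contract p (g i))" for p and g :: "expo \<Rightarrow> 'a dpoly" and A
    by (induction A rule: infinite_finite_induct) (auto simp: contract_add_right)
  have "contract (Poly_Mapping.single e c * q) f = contract (Poly_Mapping.single e c) (contract q f)" for e c
    by (subst (1 2) poly_sum_singles[of q]) (simp only: sum_distrib_left contract_sum_left s r)
  then show ?thesis
    by (subst (1 2) poly_sum_singles[of p]) (simp only: sum_distrib_right contract_sum_left)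
qed

lemma contract_smul_left: "contract (smul c D) f = smul c (contract D f)"
proof -
  have "contract (Poly_Mapping.single 0 c) g = smul c g" for g
    by (rule poly_mapping_eqI) (simp add: lookup_contract_single)
  then show ?thesis by (simp add: smul_def[of c D] contract_mult)
qed

lemma contract_smul_right: "contract D (smul c f) = smul c (contract D f)"
  by (rule poly_mapping_eqI) (simp add: lookup_contract sum_distrib_left algebra_simps)

lemma lookup_contract_var: "lk (contract (var v) f) m = lk f (m + unit_exp v)"
  by (simp add: var_def lookup_contract_single add.commute)

lemma contract_one: "contract 1 f = f"
  using contract_smul_left[of 1 1 f]
  by (intro poly_mapping_eqI) (simp add: single_one[symmetric] lookup_contract_single del: single_one)

lemma in_vars_iff: "p \<in> in_vars V \<longleftrightarrow> (\<forall>m. lk p m \<noteq> 0 \<longrightarrow> ks m \<subseteq> V)"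
  by (auto simp: in_vars_def in_keys_iff)

lemma homog_iff: "p \<in> homog e \<longleftrightarrow> (\<forall>m. lk p m \<noteq> 0 \<longrightarrow> int (mdeg m) = e)"
  by (auto simp: homog_def in_keys_iff)

lemma in_vars_0 [simp]: "0 \<in> in_vars V" and homog_0 [simp]: "0 \<in> homog e"
  by (auto simp: in_vars_iff homog_iff)

lemma in_vars_add: "p \<in> in_vars V \<Longrightarrow> q \<in> in_vars V \<Longrightarrow> (p::'k::field mpoly) + q \<in> in_vars V"
  by (auto simp: in_vars_iff lookup_add) (metis add.right_neutral add_0_left subsetD)

lemma homog_add: "p \<in> homog e \<Longrightarrow> q \<in> homog e \<Longrightarrow> (p::'k::field mpoly) + q \<in> homog e"
  by (auto simp: homog_iff lookup_add) (metis add.right_neutral)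

lemma in_vars_smul: "p \<in> in_vars V \<Longrightarrow> smul c p \<in> in_vars V"
  by (auto simp: in_vars_iff)

lemma homog_smul: "p \<in> homog e \<Longrightarrow> smul c p \<in> homog e"
  by (auto simp: homog_iff)

lemma keys_multE:
  assumes "m \<in> ks ((p::'k::field mpoly) * q)"
  obtains a b where "a \<in> ks p" "b \<in> ks q" "m = a + b"
  using keys_mult[of p q] assms by blast

lemma in_vars_mult: "p \<in> in_vars V \<Longrightarrow> q \<in> in_vars V \<Longrightarrow> (p::'k::field mpoly) * q \<in> in_vars V"
  unfolding in_vars_def by (auto elim!: keys_multE simp: keys_expo_add) blast+

lemma homog_mult: "p \<in> homog e \<Longrightarrow> q \<in> homog e' \<Longrightarrow> (p::'k::field mpoly) * q \<in> homog (e + e')"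
  unfolding homog_def by (auto elim!: keys_multE simp: mdeg_add)

lemma in_vars_var: "v \<in> V \<Longrightarrow> var v \<in> in_vars V" and homog_var: "var v \<in> homog 1"
  by (auto simp: in_vars_def homog_def var_def)

lemma in_vars_mono: "V \<subseteq> U \<Longrightarrow> p \<in> in_vars V \<Longrightarrow> p \<in> in_vars U"
  by (auto simp: in_vars_def)

lemma keys_contractE:
  assumes "m \<in> ks (contract D f)" obtains b where "b \<in> ks D" "b + m \<in> ks f"
proof -
  have "(\<Sum>\<beta>\<in>ks D. lk D \<beta> * lk f (\<beta> + m)) \<noteq> 0" using assms by (simp add: in_keys_iff lookup_contract)
  then obtain b where "b \<in> ks D" "lk D b * lk f (b + m) \<noteq> 0" by (meson sum.neutral)
  then show ?thesis using that by (auto simp: in_keys_iff)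
qed

lemma in_vars_contract: "f \<in> in_vars V \<Longrightarrow> contract D f \<in> in_vars V"
  unfolding in_vars_def by (auto elim!: keys_contractE) (metis UnI2 keys_expo_add subsetD)

lemma homog_contract: "D \<in> homog e \<Longrightarrow> f \<in> homog e' \<Longrightarrow> contract D f \<in> homog (e' - e)"
  unfolding homog_def by (force elim!: keys_contractE simp: mdeg_add)

text \<open>
  Homogeneous components and the part that involves only some of the variables are of this form.
\<close>

definition pfilter :: "(expo \<Rightarrow> bool) \<Rightarrow> 'k::field mpoly \<Rightarrow> 'k mpoly" where
  "pfilter P p = Abs_poly_mapping (\<lambda>m. lk p m when P m)"

lemma lookup_pfilter [simp]: "lk (pfilter P p) m = (if P m then lk p m else 0)"
proof -
  have "finite {m. (lk p m when P m) \<noteq> 0}"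
    by (rule finite_subset[of _ "ks p"]) (auto simp: in_keys_iff)
  then show ?thesis by (simp add: pfilter_def when_def)
qed

lemma in_vars_pfilter: "p \<in> in_vars V \<Longrightarrow> pfilter P p \<in> in_vars V"
  and homog_pfilter: "p \<in> homog e \<Longrightarrow> pfilter P p \<in> homog e"
  by (auto simp: in_vars_iff homog_iff)

text \<open>
  The exponents of these monomials are bounded functions with support in \<open>V\<close>.
\<close>

lemma finite_monomials:
  assumes "finite V" shows "finite {m :: expo. ks m \<subseteq> V \<and> mdeg m \<le> n}"
proof -
  have "lk ` {m :: expo. ks m \<subseteq> V \<and> mdeg m \<le> n} \<subseteq>
      {f. \<forall>x. (x \<in> V \<longrightarrow> f x \<in> {..n}) \<and> (x \<notin> V \<longrightarrow> f x = 0)}"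
  proof clarify
    fix m :: expo and x assume m: "ks m \<subseteq> V" "mdeg m \<le> n"
    have "lk m x \<le> n" if "x \<in> V"
      using member_le_sum[of x V "lk m"] that assms m mdeg_superset[OF assms m(1)] by auto
    then show "(x \<in> V \<longrightarrow> lk m x \<in> {..n}) \<and> (x \<notin> V \<longrightarrow> lk m x = 0)"
      using m(1) by (auto simp: in_keys_iff)
  qed
  then have "finite (lk ` {m :: expo. ks m \<subseteq> V \<and> mdeg m \<le> n})"
    using finite_set_of_finite_funs[OF assms, of "{..n}" 0] finite_subset by blast
  then show ?thesis by (rule finite_imageD) (auto simp: inj_on_def intro: poly_mapping_eqI)
qed

interpretation mp: vector_space smul
proof
  fix a b :: 'a and x y :: "'a mpoly"
  show "smul a (x + y) = smul a x + smul a y" by (simp add: smul_def distrib_left)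
  show "smul (a + b) x = smul a x + smul b x" by (simp add: smul_def single_add distrib_right)
  show "smul a (smul b x) = smul (a * b) x" by (simp add: smul_def mult.assoc[symmetric] mult_single)
  show "smul 1 x = x" by (rule poly_mapping_eqI) simp
qed


definition mulX :: "nat \<Rightarrow> (nat \<Rightarrow> 'k::field mpoly) \<Rightarrow> nat \<Rightarrow> 'k mpoly" where
  "mulX v u = (\<lambda>l. var v * u l)"

definition conX :: "nat \<Rightarrow> (nat \<Rightarrow> 'k::field dpoly) \<Rightarrow> nat \<Rightarrow> 'k dpoly" where
  "conX v u = (\<lambda>l. contract (var v) (u l))"

lemma mult_smul: "p * smul c q = smul c (p * q)"
  by (simp add: smul_def algebra_simps)

interpretation mulk: koszul "pointwise smul" mulX
proof (rule koszul.intro)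
  show "vector_space (pointwise smul :: 'a \<Rightarrow> (nat \<Rightarrow> 'a mpoly) \<Rightarrow> _)"
    by (rule vector_space_pointwise) unfold_locales
  show "koszul_axioms (pointwise smul) (mulX :: nat \<Rightarrow> (nat \<Rightarrow> 'a mpoly) \<Rightarrow> _)"
    by unfold_locales (auto simp: mulX_def fun_eq_iff distrib_left mult_smul mult.left_commute)
qed

interpretation conk: koszul "pointwise smul" conX
proof (rule koszul.intro)
  show "vector_space (pointwise smul :: 'a \<Rightarrow> (nat \<Rightarrow> 'a mpoly) \<Rightarrow> _)"
    by (rule vector_space_pointwise) unfold_locales
  show "koszul_axioms (pointwise smul) (conX :: nat \<Rightarrow> (nat \<Rightarrow> 'a mpoly) \<Rightarrow> _)"
    by unfold_locales (auto simp: conX_def fun_eq_iff contract_add_right contract_smul_right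
        contract_mult[symmetric] mult.commute)
qed

section \<open>Free modules and the exactness of their Koszul complexes\<close>

lemma free_mod_degD:
  assumes "u \<in> free_mod_deg V a e"
  shows "u l \<in> in_vars V" and "length a \<le> l \<Longrightarrow> u l = 0"
    and "l < length a \<Longrightarrow> u l \<in> homog (e - a ! l)"
  using assms by (auto simp: free_mod_deg_def free_mod_def not_le) (metis in_vars_0 not_le)

lemma free_mod_degI:
  "(\<And>l. l < length a \<Longrightarrow> u l \<in> in_vars V) \<Longrightarrow> (\<And>l. length a \<le> l \<Longrightarrow> u l = 0) \<Longrightarrow>
   (\<And>l. l < length a \<Longrightarrow> u l \<in> homog (e - a ! l)) \<Longrightarrow> u \<in> free_mod_deg V a e"
  by (auto simp: free_mod_deg_def free_mod_def)

lemma subspace_free_mod_deg: "mulk.subspace (free_mod_deg V a e)"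
  by (rule mulk.subspaceI)
    (auto intro!: free_mod_degI in_vars_add homog_add in_vars_smul homog_smul simp: free_mod_degD)

lemma mulX_free_mod_deg:
  assumes "v \<in> V" "u \<in> free_mod_deg V a e" shows "mulX v u \<in> free_mod_deg V a (e + 1)"
proof (rule free_mod_degI)
  fix l assume "l < length a"
  then have "var v * u l \<in> homog (1 + (e - a ! l))"
    using free_mod_degD(3)[OF assms(2)] by (intro homog_mult homog_var)
  then show "mulX v u l \<in> homog (e + 1 - a ! l)" by (simp add: mulX_def algebra_simps)
qed (use assms in \<open>auto simp: mulX_def free_mod_degD intro!: in_vars_mult in_vars_var\<close>)

lemma lookup_ksgn: "lk (ksgn v J p) m = ksgn v J (lk p m)"
  by (simp add: ksgn_def)

lemma lookup_kdiff_mulX: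
  assumes "J \<subseteq> V"
  shows "lk (kdiff mulX V c J l) m =
    (\<Sum>u\<in>V-J. ksgn u J (if u \<in> ks m then lk (c (insert u J) l) (m - unit_exp u) else 0))"
proof -
  have "ksgn u J f l = ksgn u J (f l)" for u and f :: "nat \<Rightarrow> 'a mpoly" by (simp add: ksgn_def)
  then show ?thesis
    using assms by (simp add: kdiff_def sum_fun_apply lookup_sum lookup_ksgn mulX_def lookup_var_mult)
qed

text \<open>
  The Koszul complex of the polynomial ring is exact except in degree \<open>0\<close> at the constants. It
  is the direct sum of complexes indexed by monomials \<open>\<mu>\<close>, where \<open>\<mu>\<close> is the product of the coefficient
  monomial \<open>m\<close> and the variables in \<open>J\<close>. If \<open>v\<close> is the least variable in \<open>\<mu>\<close>, moving \<open>v\<close> from the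
  coefficient to the exterior part is a contracting homotopy. This works over any field.
\<close>

lemma koszul_exact:
  fixes c :: "nat set \<Rightarrow> nat \<Rightarrow> 'k::field mpoly"
  assumes V: "finite V" and c: "c \<in> kchains V k (free_mod_deg V a j)"
    and d: "kdiff mulX V c = 0" and z: "k = 0 \<Longrightarrow> c {} \<in> max_free_mod V a"
  shows "\<exists>b\<in>kchains V (Suc k) (free_mod_deg V a (j - 1)). kdiff mulX V b = c"
proof
  \<comment> \<open>the homotopy applied to \<open>c\<close>: its coefficient at \<open>J\<close> and \<open>m\<close> is that of \<open>c\<close> at \<open>J - {v}\<close> and
    \<open>m x\<^sub>v\<close>, provided that \<open>v = Min J\<close> is also the least variable of \<open>m x\<^sub>v\<close>\<close>
  define b where "b J = (\<lambda>l. if J \<subseteq> V \<and> J \<noteq> {}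
    then pfilter (\<lambda>m. \<forall>x\<in>ks m. Min J \<le> x) (contract (var (Min J)) (c (J - {Min J}) l)) else 0)" for J
  have F0: "0 \<in> free_mod_deg V a i" for i using mulk.subspace_0[OF subspace_free_mod_deg] .
  have cF: "c J \<in> free_mod_deg V a j" for J using kchainsD[OF c F0] .
  show bk: "b \<in> kchains V (Suc k) (free_mod_deg V a (j - 1))"
  proof (rule kchainsI)
    fix J assume J: "J \<subseteq> V" "card J = Suc k"
    show "b J \<in> free_mod_deg V a (j - 1)"
    proof (rule free_mod_degI)
      fix l
      show "b J l \<in> in_vars V" using free_mod_degD(1)[OF cF]
        by (auto simp: b_def intro!: in_vars_pfilter in_vars_contract)
      show "b J l = 0" if "length a \<le> l"
        using free_mod_degD(2)[OF cF that] by (auto simp: b_def intro: poly_mapping_eqI)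
      assume l: "l < length a"
      have "contract (var (Min J)) (c (J - {Min J}) l) \<in> homog (j - a ! l - 1)"
        using free_mod_degD(3)[OF cF l] by (intro homog_contract homog_var)
      then show "b J l \<in> homog (j - 1 - a ! l)"
        by (auto simp: b_def algebra_simps intro!: homog_pfilter)
    qed
  next
    fix J assume J: "\<not> (J \<subseteq> V \<and> card J = Suc k)"
    show "b J = 0"
    proof (cases "J \<subseteq> V \<and> J \<noteq> {}")
      case True
      have fJ: "finite J" using True finite_subset V by auto
      then have "card J = Suc (card (J - {Min J}))" using True by (metis Min_in card.remove)
      then have "c (J - {Min J}) = 0" using J True by (intro kchainsD0[OF c]) auto
      then show ?thesis by (auto simp: b_def fun_eq_iff intro: poly_mapping_eqI)
    qed (auto simp: b_def fun_eq_iff)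
  qed
  have db: "kdiff mulX V b \<in> kchains V k (free_mod_deg V a j)"
    using mulX_free_mod_deg[of _ V _ a "j - 1"]
    by (intro mulk.kdiff_in_kchains[OF V bk subspace_free_mod_deg]) auto
  have lkb: "lk (b J l) m = (if J \<subseteq> V \<and> J \<noteq> {} \<and> (\<forall>x\<in>ks m. Min J \<le> x)
      then lk (c (J - {Min J}) l) (m + unit_exp (Min J)) else 0)" for J l m
    by (simp add: b_def lookup_contract_var)
  have "lk (kdiff mulX V b J l) m = lk (c J l) m" for J l m
  proof -
    \<comment> \<open>only the last case has content; in the third both sides vanish by the hypothesis on the constant term\<close>
    consider "\<not> J \<subseteq> V" | "\<not> ks m \<subseteq> V" | "J = {}" "ks m = {}"
      | (main) "J \<subseteq> V" "ks m \<subseteq> V" "J \<union> ks m \<noteq> {}" by blast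
    then show ?thesis
    proof cases
      case 1
      then show ?thesis using kchainsD0[OF c, of J] by (simp add: kdiff_def)
    next
      case 2
      have "kdiff mulX V b J l \<in> in_vars V" "c J l \<in> in_vars V"
        using free_mod_degD(1) kchainsD[OF db F0] cF by blast+
      then show ?thesis using 2 unfolding in_vars_iff by metis
    next
      case 3
      have "lk (c {} l) 0 = 0"
      proof (cases "k = 0")
        case True
        then show ?thesis using z by (simp add: max_free_mod_def)
      next
        case False
        then have "c {} = 0" by (intro kchainsD0[OF c]) auto
        then show ?thesis by simp
      qed
      moreover have "m = 0" using 3 by (auto simp: in_keys_iff intro: poly_mapping_eqI)
      ultimately show ?thesis using 3 by (simp add: lookup_kdiff_mulX)
    next
      case main
      define v where "v = Min (J \<union> ks m)"
      have fJ: "finite J" using main finite_subset V by auto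
      have vin: "v \<in> J \<union> ks m" unfolding v_def using main fJ by (intro Min_in) auto
      have vle: "v \<le> x" if "x \<in> J \<union> ks m" for x unfolding v_def using that fJ by (intro Min_le) auto
      have vV: "v \<in> V" using vin main by auto
      have km: "ks (m - unit_exp u) = (if lk m u = 1 then ks m - {u} else ks m)" if "u \<in> ks m" for u
        using that by (auto simp: in_keys_iff lookup_minus lookup_single when_def split: if_splits)
      have km': "ks (m - unit_exp u) \<subseteq> ks m" "ks m - {u} \<subseteq> ks (m - unit_exp u)"
        if "u \<in> ks m" for u using km[OF that] by auto
      show ?thesis
      proof (cases "v \<in> J")
        case False
        then have vm: "v \<in> ks m" using vin by auto
        have s: "ksgn v J x = x" for x :: 'k
          using vle by (simp add: ksgn_def) (metis (no_types, lifting) UnI1 card.empty empty_Collect_eq even_zero not_le)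
        have "ksgn u J (if u \<in> ks m then lk (b (insert u J) l) (m - unit_exp u) else 0)
          = (if u = v then lk (c J l) m else 0)" if u: "u \<in> V - J" for u
        proof (cases "u = v")
          case True
          have "Min (insert v J) = v" using fJ vle by (intro Min_eqI) auto
          moreover have "insert v J - {v} = J" using False by auto
          moreover have "\<forall>x\<in>ks (m - unit_exp v). v \<le> x" using km'(1)[OF vm] vle by blast
          moreover have "m - unit_exp v + unit_exp v = m"
            using expo_minus_plus[OF vm] by (simp add: add.commute)
          ultimately show ?thesis using True vm main vV by (simp add: lkb s)
        next
          case ne: False
          have "Min (insert u J) \<in> insert u J" using fJ by (intro Min_in) auto
          then have "Min (insert u J) \<noteq> v" using ne False by auto
          moreover have "v \<le> Min (insert u J)" if "u \<in> ks m"
            using vle that \<open>Min (insert u J) \<in> insert u J\<close> by auto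
          moreover have "v \<in> ks (m - unit_exp u)" if "u \<in> ks m"
            using km'(2)[OF that] vm ne by auto
          ultimately have "\<not> (\<forall>x\<in>ks (m - unit_exp u). Min (insert u J) \<le> x)" if "u \<in> ks m"
            using that by (meson order_antisym)
          then show ?thesis using ne by (cases "u \<in> ks m") (auto simp: lkb)
        qed
        then have "lk (kdiff mulX V b J l) m = (\<Sum>u\<in>V-J. if u = v then lk (c J l) m else 0)"
          unfolding lookup_kdiff_mulX[OF main(1)] by (intro sum.cong) auto
        then show ?thesis using V vV False by simp
      next
        case True
        define I where "I = J - {v}"
        have I: "J = insert v I" "v \<notin> I" "I \<subseteq> V" "finite I" using True main fJ by (auto simp: I_def)
        have VI: "V - I = insert v (V - J)" using I vV by auto
        let ?m = "m + unit_exp v"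
        have kse: "ks ?m = insert v (ks m)" by (auto simp: keys_expo_add)
        have s: "ksgn v I x = x" for x :: 'k
          using vle I by (simp add: ksgn_def) (metis (no_types, lifting) UnI1 card.empty empty_Collect_eq even_zero insertI2 not_le)
        have t: "ksgn u J (if u \<in> ks m then lk (b (insert u J) l) (m - unit_exp u) else 0)
          = - ksgn u I (if u \<in> ks ?m then lk (c (insert u I) l) (?m - unit_exp u) else 0)"
          if u: "u \<in> V - J" for u
        proof (cases "u \<in> ks m")
          case um: True
          have uv: "v < u" using vle um u True by (metis DiffD2 UnI2 order_le_less)
          have "Min (insert u J) = v" using fJ vle True uv by (intro Min_eqI) auto
          moreover have "insert u J - {v} = insert u I" using uv I by auto
          moreover have "\<forall>x\<in>ks (m - unit_exp u). v \<le> x" using km'(1)[OF um] vle by blast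
          moreover have "m - unit_exp u + unit_exp v = ?m - unit_exp u"
            using um by (intro poly_mapping_eqI)
              (auto simp: lookup_add lookup_minus lookup_single when_def in_keys_iff)
          ultimately show ?thesis using um kse u main uv I ksgn_insert[OF I(4,2), of u] by (simp add: lkb)
        next
          case um: False
          then have "u \<notin> ks ?m" using kse u True by auto
          then show ?thesis using um by simp
        qed
        \<comment> \<open>that \<open>c\<close> is a cycle is used at \<open>I = J - {v}\<close>: the term of \<open>v\<close> is \<open>c J\<close>, and the other terms are
          those of the boundary of \<open>b\<close>, with the sign changed by \<open>v \<in> J\<close>\<close>
        have "0 = lk (kdiff mulX V c I l) ?m" using d by simp
        also have "\<dots> = ksgn v I (lk (c J l) m) + (\<Sum>u\<in>V-J. ksgn u I
            (if u \<in> ks ?m then lk (c (insert u I) l) (?m - unit_exp u) else 0))"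
          unfolding lookup_kdiff_mulX[OF I(3)] VI using V kse True I(1) by simp
        finally have "lk (c J l) m = - (\<Sum>u\<in>V-J. ksgn u I
            (if u \<in> ks ?m then lk (c (insert u I) l) (?m - unit_exp u) else 0))"
          by (simp add: s eq_neg_iff_add_eq_0)
        also have "\<dots> = lk (kdiff mulX V b J l) m"
          unfolding lookup_kdiff_mulX[OF main(1)] sum_negf[symmetric] using t by (intro sum.cong) auto
        finally show ?thesis by simp
      qed
    qed
  qed
  then show "kdiff mulX V b = c" by (auto simp: fun_eq_iff intro: poly_mapping_eqI)
qed

section \<open>Covers by free modules and dimension shifting\<close>

definition ker_deg :: "nat set \<Rightarrow> int list \<Rightarrow> ((nat \<Rightarrow> 'k::field mpoly) \<Rightarrow> (nat \<Rightarrow> 'k mpoly)) \<Rightarrow>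
    int \<Rightarrow> (nat \<Rightarrow> 'k mpoly) set" where
  "ker_deg V a \<phi> e = {u \<in> free_mod_deg V a e. \<phi> u = 0}"

text \<open>
  A graded free module \<open>F\<close> mapping onto a graded module \<open>M\<close>. Linearity is required only on homogeneous
  elements. The operators on \<open>M\<close> are arbitrary: the targets are the inverse system, where variables act by
  contraction, and kernels of earlier maps, where they act by multiplication.
\<close>

locale free_cover =
  fixes V :: "nat set" and X :: "nat \<Rightarrow> (nat \<Rightarrow> 'k::field mpoly) \<Rightarrow> nat \<Rightarrow> 'k mpoly"
    and a :: "int list" and \<phi> :: "(nat \<Rightarrow> 'k mpoly) \<Rightarrow> nat \<Rightarrow> 'k mpoly"
    and M :: "int \<Rightarrow> (nat \<Rightarrow> 'k mpoly) set"
  assumes finV: "finite V" and koszulX: "koszul (pointwise smul) X"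
    and image: "\<phi> ` free_mod_deg V a e = M e"
    and add: "u \<in> free_mod_deg V a e \<Longrightarrow> w \<in> free_mod_deg V a e \<Longrightarrow> \<phi> (u + w) = \<phi> u + \<phi> w"
    and scale: "u \<in> free_mod_deg V a e \<Longrightarrow> \<phi> (pointwise smul c u) = pointwise smul c (\<phi> u)"
    and X: "v \<in> V \<Longrightarrow> u \<in> free_mod_deg V a e \<Longrightarrow> \<phi> (mulX v u) = X v (\<phi> u)"
begin

sublocale KX: koszul "pointwise smul" X by (rule koszulX)

abbreviation F :: "int \<Rightarrow> (nat \<Rightarrow> 'k mpoly) set" where "F \<equiv> free_mod_deg V a"
abbreviation N :: "int \<Rightarrow> (nat \<Rightarrow> 'k mpoly) set" where "N \<equiv> ker_deg V a \<phi>"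

definition push :: "(nat set \<Rightarrow> nat \<Rightarrow> 'k mpoly) \<Rightarrow> nat set \<Rightarrow> nat \<Rightarrow> 'k mpoly" where
  "push c = (\<lambda>J. \<phi> (c J))"

lemma F_0: "0 \<in> F e"
  using mulk.subspace_0[OF subspace_free_mod_deg] .

lemma phi_0: "\<phi> 0 = 0"
proof -
  have "\<phi> (pointwise smul 0 0) = pointwise smul 0 (\<phi> 0)" by (rule scale[OF F_0])
  then show ?thesis by (simp only: mulk.scale_zero_left)
qed

lemma phi_uminus: "u \<in> F e \<Longrightarrow> \<phi> (- u) = - \<phi> u"
  using scale[of u e "- 1"] by (simp only: mulk.scale_minus_left mulk.scale_one)

lemma phi_ksgn: "u \<in> F e \<Longrightarrow> \<phi> (ksgn v J u) = ksgn v J (\<phi> u)"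
  by (simp add: ksgn_def phi_uminus)

lemma ksgn_F: "u \<in> F e \<Longrightarrow> ksgn v J u \<in> F e"
  by (simp add: ksgn_def mulk.subspace_neg[OF subspace_free_mod_deg])

lemma phi_sum: "(\<And>i. i \<in> A \<Longrightarrow> f i \<in> F e) \<Longrightarrow> \<phi> (sum f A) = (\<Sum>i\<in>A. \<phi> (f i))"
proof (induction A rule: infinite_finite_induct)
  case (insert x A)
  then have "\<phi> (f x + sum f A) = \<phi> (f x) + \<phi> (sum f A)"
    by (intro add[of _ e] mulk.subspace_sum[OF subspace_free_mod_deg]) auto
  moreover have "\<phi> (sum f A) = (\<Sum>i\<in>A. \<phi> (f i))" using insert by blast
  ultimately show ?case by (simp only: sum.insert[OF insert.hyps])
next
  case (infinite A)
  show ?case by (simp only: sum.infinite[OF infinite.hyps] phi_0)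
qed (simp only: sum.empty phi_0)

lemma subspace_M: "mulk.subspace (M e)"
proof (rule mulk.subspaceI)
  show "0 \<in> M e" using phi_0 F_0 unfolding image[symmetric] by (metis imageI)
  show "x + y \<in> M e" if "x \<in> M e" "y \<in> M e" for x y
    using that unfolding image[symmetric]
    by (auto simp: add[symmetric] mulk.subspace_add[OF subspace_free_mod_deg])
  show "pointwise smul c x \<in> M e" if "x \<in> M e" for c x
    using that unfolding image[symmetric]
    by (auto simp: scale[symmetric] mulk.subspace_scale[OF subspace_free_mod_deg])
qed

lemma subspace_N: "mulk.subspace (N e)"
proof (rule mulk.subspaceI)
  show "0 \<in> N e" using F_0 phi_0 by (simp add: ker_deg_def)
  show "x + y \<in> N e" if "x \<in> N e" "y \<in> N e" for x y
    using that add[of x e y] mulk.subspace_add[OF subspace_free_mod_deg] by (auto simp: ker_deg_def)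
  show "pointwise smul c x \<in> N e" if "x \<in> N e" for c x
    using that scale[of x e c] mulk.subspace_scale[OF subspace_free_mod_deg] by (auto simp: ker_deg_def)
qed

lemma graded_submodule_M: "KX.graded_submodule V M"
  unfolding KX.graded_submodule_def
proof (intro conjI allI ballI subspace_M)
  fix j v m assume "v \<in> V" "m \<in> M j"
  then obtain u where u: "u \<in> F j" "m = \<phi> u" unfolding image[symmetric] by blast
  then have "X v m = \<phi> (mulX v u)" using X \<open>v \<in> V\<close> by simp
  then show "X v m \<in> M (j + 1)" unfolding image[symmetric]
    using mulX_free_mod_deg[OF \<open>v \<in> V\<close> u(1)] by blast
qed

lemma graded_submodule_N: "mulk.graded_submodule V N"
  unfolding mulk.graded_submodule_def
proof (intro conjI allI ballI subspace_N)
  fix j v m assume "v \<in> V" "m \<in> N j"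
  then show "mulX v m \<in> N (j + 1)" using X[of v m j] mulX_free_mod_deg[of v V m a j]
    by (simp add: ker_deg_def)
qed

lemma push_kchains: "c \<in> kchains V k (F e) \<Longrightarrow> push c \<in> kchains V k (M e)"
  using image[of e] phi_0 by (auto simp: kchains_def supported_def push_def)

lemma push_lift:
  assumes "c' \<in> kchains V k (M e)" shows "\<exists>c\<in>kchains V k (F e). push c = c'"
proof -
  have "\<exists>u. \<phi> u = c' J \<and> (if J \<subseteq> V \<and> card J = k then u \<in> F e else u = 0)" for J
  proof (cases "J \<subseteq> V \<and> card J = k")
    case True
    then have "c' J \<in> \<phi> ` F e" using kchainsD1[OF assms] image by blast
    then show ?thesis using True by auto
  next
    case False
    then show ?thesis using kchainsD0[OF assms False] phi_0 by auto
  qed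
  then obtain c where c: "\<And>J. \<phi> (c J) = c' J \<and> (if J \<subseteq> V \<and> card J = k then c J \<in> F e else c J = 0)"
    by metis
  have "c \<in> kchains V k (F e)" by (rule kchainsI) (metis c)+
  moreover have "push c = c'" using c by (simp add: push_def)
  ultimately show ?thesis by blast
qed

lemma push_kdiff:
  assumes "c \<in> kchains V k (F e)" shows "push (kdiff mulX V c) = kdiff X V (push c)"
proof
  fix J
  have cF: "c I \<in> F e" for I using kchainsD[OF assms F_0] .
  show "push (kdiff mulX V c) J = kdiff X V (push c) J"
  proof (cases "J \<subseteq> V")
    case True
    have "\<phi> (\<Sum>v\<in>V-J. ksgn v J (mulX v (c (insert v J)))) =
        (\<Sum>v\<in>V-J. \<phi> (ksgn v J (mulX v (c (insert v J)))))"
      by (intro phi_sum[of _ _ "e + 1"] ksgn_F) (auto intro!: mulX_free_mod_deg cF)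
    also have "\<dots> = (\<Sum>v\<in>V-J. ksgn v J (X v (\<phi> (c (insert v J)))))"
    proof (intro sum.cong refl)
      fix v assume "v \<in> V - J"
      then have v: "v \<in> V" by blast
      show "\<phi> (ksgn v J (mulX v (c (insert v J)))) = ksgn v J (X v (\<phi> (c (insert v J))))"
        using phi_ksgn[OF mulX_free_mod_deg[OF v cF]] X[OF v cF] by simp
    qed
    finally show ?thesis using True by (simp add: kdiff_def push_def)
  qed (simp add: kdiff_def push_def phi_0)
qed

lemma push_add: "c \<in> kchains V k (F e) \<Longrightarrow> c' \<in> kchains V k (F e) \<Longrightarrow> push (c + c') = push c + push c'"
  using add[OF kchainsD[OF _ F_0] kchainsD[OF _ F_0], of c V k e c'] by (simp only: push_def plus_fun_def)

lemma push_scale: "c \<in> kchains V k (F e) \<Longrightarrow>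
    push (pointwise (pointwise smul) x c) = pointwise (pointwise smul) x (push c)"
  using scale[of _ e x] kchainsD[OF _ F_0, of c V k] by (auto simp: push_def fun_eq_iff pointwise_def)

lemma push_diff: "c \<in> kchains V k (F e) \<Longrightarrow> c' \<in> kchains V k (F e) \<Longrightarrow> push (c - c') = push c - push c'"
  using push_add[of "c - c'" k e c'] mulk.ch.subspace_diff[OF mulk.subspace_kchains[OF subspace_free_mod_deg]]
  by (metis add_diff_cancel_right' diff_add_cancel)

lemma kchains_N_iff: "c \<in> kchains V k (N e) \<longleftrightarrow> c \<in> kchains V k (F e) \<and> push c = 0"
proof
  assume c: "c \<in> kchains V k (N e)"
  have "c \<in> kchains V k (F e)" using c kchains_mono[of "N e" "F e"] by (auto simp: ker_deg_def)
  moreover have "\<phi> (c J) = 0" for J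
    using kchainsD[OF c mulk.subspace_0[OF subspace_N]] by (simp add: ker_deg_def)
  ultimately show "c \<in> kchains V k (F e) \<and> push c = 0" by (simp add: push_def fun_eq_iff)
next
  assume c: "c \<in> kchains V k (F e) \<and> push c = 0"
  then have "\<phi> (c J) = 0" for J by (metis push_def zero_fun_apply)
  then show "c \<in> kchains V k (N e)" using c
    by (intro kchainsI) (auto simp: ker_deg_def dest: kchainsD1 kchainsD0)
qed

lemma kdiff_F: "c \<in> kchains V (Suc k) (F e) \<Longrightarrow> kdiff mulX V c \<in> kchains V k (F (e + 1))"
  by (rule mulk.kdiff_in_kchains[OF finV _ subspace_free_mod_deg]) (auto intro: mulX_free_mod_deg)

text \<open>
  The connecting homomorphism as two isomorphisms. Let \<open>P\<close> be the chains in \<open>F\<close> with boundary in \<open>N\<close>. The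
  projection maps \<open>P\<close> onto the cycles of \<open>M\<close>, and the differential maps it onto the cycles of \<open>N\<close>, by
  exactness of the complex of \<open>F\<close> and, for \<open>k = 0\<close>, by \<open>N \<subseteq> \<mm>F\<close>. The boundaries of \<open>M\<close> and those of \<open>N\<close> have
  the same preimage in \<open>P\<close>.
\<close>

lemma has_betti_shift:
  assumes N_max: "\<And>e. N e \<subseteq> max_free_mod V a"
  shows "has_betti (pointwise smul) X V M (Suc k) j n \<longleftrightarrow>
    has_betti (pointwise smul) mulX V N k (j + 1) n"
proof -
  interpret pair: vector_space_pair
    "pointwise (pointwise smul) :: 'k \<Rightarrow> (nat set \<Rightarrow> nat \<Rightarrow> 'k mpoly) \<Rightarrow> _"
    "pointwise (pointwise smul) :: 'k \<Rightarrow> (nat set \<Rightarrow> nat \<Rightarrow> 'k mpoly) \<Rightarrow> _" ..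
  define P where "P = {c \<in> kchains V (Suc k) (F j). kdiff mulX V c \<in> kchains V k (N (j + 1))}"
  define Q where "Q = {c \<in> P. push c \<in> kdiff X V ` kchains V (Suc (Suc k)) (M (j - 1))}"
  have sF: "mulk.ch.subspace (kchains V i (F e))" for i e
    by (rule mulk.subspace_kchains[OF subspace_free_mod_deg])
  have sN: "mulk.ch.subspace (kchains V i (N e))" for i e
    by (rule mulk.subspace_kchains[OF subspace_N])
  have PF: "c \<in> kchains V (Suc k) (F j)" if "c \<in> P" for c using that by (simp add: P_def)
  have P: "mulk.ch.subspace P" using sF[of "Suc k" j] sN[of k "j + 1"] unfolding P_def mulk.ch.subspace_def
    by (auto simp: mulk.kdiff_add mulk.kdiff_scale)
  have P_iff: "c \<in> P \<longleftrightarrow> c \<in> kchains V (Suc k) (F j) \<and> push c \<in> kcycles X V (Suc k) (M j)" for c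
    unfolding P_def kchains_N_iff kcycles_def
    by (auto simp: kdiff_F push_kchains push_kdiff)
  have b1: "kdiff X V ` kchains V (Suc (Suc k)) (M (j - 1)) \<subseteq> kcycles X V (Suc k) (M j)"
    by (rule KX.boundary_in_cycles[OF finV graded_submodule_M])
  have t1: "qdim (pointwise (pointwise smul)) P Q n \<longleftrightarrow>
      qdim (pointwise (pointwise smul)) (kcycles X V (Suc k) (M j)) (kdiff X V ` kchains V (Suc (Suc k)) (M (j - 1))) n"
  proof (rule pair.qdim_transport[where L = push])
    show "mulk.ch.subspace P" by (rule P)
    show "mulk.ch.subspace (kdiff X V ` kchains V (Suc (Suc k)) (M (j - 1)))"
      by (rule KX.subspace_kdiff_image[OF subspace_M])
    show "kdiff X V ` kchains V (Suc (Suc k)) (M (j - 1)) \<subseteq> kcycles X V (Suc k) (M j)" by (rule b1)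
    show "push (x + y) = push x + push y" if "x \<in> P" "y \<in> P" for x y
      using push_add PF that by blast
    show "push (pointwise (pointwise smul) x y) = pointwise (pointwise smul) x (push y)" if "y \<in> P" for x y
      using push_scale PF that by blast
    show "push ` P = kcycles X V (Suc k) (M j)"
    proof
      show "kcycles X V (Suc k) (M j) \<subseteq> push ` P"
      proof
        fix z assume z: "z \<in> kcycles X V (Suc k) (M j)"
        then obtain c where "c \<in> kchains V (Suc k) (F j)" "push c = z"
          using push_lift[of z "Suc k" j] by (auto simp: kcycles_def)
        then show "z \<in> push ` P" using z P_iff by blast
      qed
    qed (use P_iff in blast)
    show "Q = {p \<in> P. push p \<in> kdiff X V ` kchains V (Suc (Suc k)) (M (j - 1))}" by (rule Q_def)
  qed
  have Q': "Q = {c \<in> P. kdiff mulX V c \<in> kdiff mulX V ` kchains V (Suc k) (N j)}"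
  proof (intro equalityI subsetI CollectI conjI)
    fix c assume c: "c \<in> Q"
    then show "c \<in> P" by (simp add: Q_def)
    obtain m where m: "m \<in> kchains V (Suc (Suc k)) (M (j - 1))" "push c = kdiff X V m"
      using c by (auto simp: Q_def)
    then obtain b where b: "b \<in> kchains V (Suc (Suc k)) (F (j - 1))" "push b = m" using push_lift by blast
    have db: "kdiff mulX V b \<in> kchains V (Suc k) (F j)" using kdiff_F[OF b(1)] by simp
    have "push (c - kdiff mulX V b) = push c - push (kdiff mulX V b)"
      using push_diff PF \<open>c \<in> P\<close> db by blast
    also have "\<dots> = 0" using push_kdiff[OF b(1)] b(2) m(2) by simp
    finally have "c - kdiff mulX V b \<in> kchains V (Suc k) (N j)"
      unfolding kchains_N_iff using PF[OF \<open>c \<in> P\<close>] db mulk.ch.subspace_diff[OF sF] by blast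
    moreover have "kdiff mulX V (c - kdiff mulX V b) = kdiff mulX V c"
      using mulk.kdiff_kdiff[OF finV, of b] by (simp only: mulk.kdiff_diff diff_zero)
    ultimately show "kdiff mulX V c \<in> kdiff mulX V ` kchains V (Suc k) (N j)" by (metis imageI)
  next
    fix c assume "c \<in> {c \<in> P. kdiff mulX V c \<in> kdiff mulX V ` kchains V (Suc k) (N j)}"
    then obtain n where c: "c \<in> P" and n: "n \<in> kchains V (Suc k) (N j)" "kdiff mulX V c = kdiff mulX V n" by auto
    have nF: "n \<in> kchains V (Suc k) (F j)" "push n = 0" using n(1) kchains_N_iff by auto
    have "c - n \<in> kchains V (Suc k) (F j)" using PF[OF c] nF(1) mulk.ch.subspace_diff[OF sF] by blast
    moreover have "kdiff mulX V (c - n) = 0" using n(2) by (simp only: mulk.kdiff_diff diff_self)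
    ultimately obtain b where b: "b \<in> kchains V (Suc (Suc k)) (F (j - 1))" "kdiff mulX V b = c - n"
      using koszul_exact[OF finV, of "c - n" "Suc k" a j] by auto
    have "push c = push (c - n)" using push_diff[OF PF[OF c] nF(1)] nF(2) by simp
    also have "\<dots> = kdiff X V (push b)" using push_kdiff[OF b(1)] b(2) by simp
    finally show "c \<in> Q" using c push_kchains[OF b(1)] by (auto simp: Q_def)
  qed
  have t2: "qdim (pointwise (pointwise smul)) P Q n \<longleftrightarrow>
      qdim (pointwise (pointwise smul)) (kcycles mulX V k (N (j + 1))) (kdiff mulX V ` kchains V (Suc k) (N j)) n"
  proof (rule pair.qdim_transport[where L = "kdiff mulX V"])
    show "mulk.ch.subspace P" by (rule P)
    show "mulk.ch.subspace (kdiff mulX V ` kchains V (Suc k) (N j))"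
      by (rule mulk.subspace_kdiff_image[OF subspace_N])
    show "kdiff mulX V ` kchains V (Suc k) (N j) \<subseteq> kcycles mulX V k (N (j + 1))"
      using mulk.boundary_in_cycles[OF finV graded_submodule_N, of k "j + 1"] by simp
    show "kdiff mulX V (x + y) = kdiff mulX V x + kdiff mulX V y" for x y by (rule mulk.kdiff_add)
    show "kdiff mulX V (pointwise (pointwise smul) x y) = pointwise (pointwise smul) x (kdiff mulX V y)"
      for x y by (rule mulk.kdiff_scale)
    show "kdiff mulX V ` P = kcycles mulX V k (N (j + 1))"
    proof
      show "kdiff mulX V ` P \<subseteq> kcycles mulX V k (N (j + 1))"
        using mulk.kdiff_kdiff[OF finV] by (auto simp: P_def kcycles_def)
      show "kcycles mulX V k (N (j + 1)) \<subseteq> kdiff mulX V ` P"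
      proof
        fix z assume "z \<in> kcycles mulX V k (N (j + 1))"
        then have z: "z \<in> kchains V k (N (j + 1))" "kdiff mulX V z = 0" by (auto simp: kcycles_def)
        have zF: "z \<in> kchains V k (F (j + 1))" using z(1) kchains_N_iff by blast
        have "z {} \<in> max_free_mod V a"
          using kchainsD[OF z(1) mulk.subspace_0[OF subspace_N]] N_max by blast
        then obtain c where "c \<in> kchains V (Suc k) (F j)" "kdiff mulX V c = z"
          using koszul_exact[OF finV zF z(2)] by auto
        then show "z \<in> kdiff mulX V ` P" using z(1) by (auto simp: P_def)
      qed
    qed
    show "Q = {p \<in> P. kdiff mulX V p \<in> kdiff mulX V ` kchains V (Suc k) (N j)}" by (rule Q')
  qed
  show ?thesis unfolding has_betti_def using t1 t2 by simp
qed

lemma kdiff_constant_term: "J \<subseteq> V \<Longrightarrow> lk (kdiff mulX V c J l) 0 = 0"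
  by (simp add: lookup_kdiff_mulX)

text \<open>
  \<open>H\<^sub>0(M) = M / \<mm>M\<close> is isomorphic to \<open>F / \<mm>F\<close> because \<open>N \<subseteq> \<mm>F\<close>, and taking constant terms
  identifies the degree \<open>j\<close> part of the latter with the functions on the generators of degree \<open>j\<close>.
\<close>

lemma has_betti_0:
  assumes N_max: "\<And>e. N e \<subseteq> max_free_mod V a"
  shows "has_betti (pointwise smul) X V M 0 j (count (mset a) j)"
proof -
  interpret pair: vector_space_pair
    "pointwise (pointwise smul) :: 'k \<Rightarrow> (nat set \<Rightarrow> nat \<Rightarrow> 'k mpoly) \<Rightarrow> _"
    "pointwise (pointwise smul) :: 'k \<Rightarrow> (nat set \<Rightarrow> nat \<Rightarrow> 'k mpoly) \<Rightarrow> _" ..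
  interpret K: vector_space "(*) :: 'k \<Rightarrow> 'k \<Rightarrow> 'k"
    by unfold_locales (auto simp: algebra_simps)
  interpret KK: vector_space "pointwise (*) :: 'k \<Rightarrow> (nat \<Rightarrow> 'k) \<Rightarrow> nat \<Rightarrow> 'k"
    by (rule vector_space_pointwise) unfold_locales
  interpret pairK: vector_space_pair
    "pointwise (pointwise smul) :: 'k \<Rightarrow> (nat set \<Rightarrow> nat \<Rightarrow> 'k mpoly) \<Rightarrow> _"
    "pointwise (*) :: 'k \<Rightarrow> (nat \<Rightarrow> 'k) \<Rightarrow> nat \<Rightarrow> 'k" ..
  define P where "P = kchains V 0 (F j)"
  define B where "B = kdiff X V ` kchains V (Suc 0) (M (j - 1))"
  define Q where "Q = {c \<in> P. push c \<in> B}"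
  define \<Lambda> :: "(nat set \<Rightarrow> nat \<Rightarrow> 'k mpoly) \<Rightarrow> nat \<Rightarrow> 'k" where "\<Lambda> c = (\<lambda>l. lk (c {} l) 0)" for c
  define A where "A = {l. l < length a \<and> a ! l = j}"
  have sP: "mulk.ch.subspace P" unfolding P_def by (rule mulk.subspace_kchains[OF subspace_free_mod_deg])
  have cyc: "kcycles X V 0 (M j) = kchains V 0 (M j)" using KX.kdiff_kchains_0[OF finV] by (auto simp: kcycles_def)
  have t1: "qdim (pointwise (pointwise smul)) P Q n \<longleftrightarrow> qdim (pointwise (pointwise smul)) (kcycles X V 0 (M j)) B n"
    for n
  proof (rule pair.qdim_transport[where L = push])
    show "mulk.ch.subspace B" unfolding B_def by (rule KX.subspace_kdiff_image[OF subspace_M])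
    show "B \<subseteq> kcycles X V 0 (M j)" unfolding B_def by (rule KX.boundary_in_cycles[OF finV graded_submodule_M])
    show "push ` P = kcycles X V 0 (M j)" unfolding cyc P_def using push_kchains push_lift by blast
  qed (use sP push_add push_scale in \<open>auto simp: P_def Q_def\<close>)
  have Q': "Q = {c \<in> P. \<Lambda> c \<in> {0}}"
  proof (intro equalityI subsetI CollectI conjI)
    fix c assume c: "c \<in> Q"
    then show "c \<in> P" by (simp add: Q_def)
    then have cF: "c \<in> kchains V 0 (F j)" by (simp add: P_def)
    obtain m where m: "m \<in> kchains V (Suc 0) (M (j - 1))" "push c = kdiff X V m"
      using c by (auto simp: Q_def B_def)
    then obtain b where b: "b \<in> kchains V (Suc 0) (F (j - 1))" "push b = m" using push_lift by blast
    have db: "kdiff mulX V b \<in> kchains V 0 (F j)" using kdiff_F[OF b(1)] by simp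
    have "push (c - kdiff mulX V b) = 0"
      using push_diff[OF cF db] push_kdiff[OF b(1)] b(2) m(2) by simp
    then have "c - kdiff mulX V b \<in> kchains V 0 (N j)" unfolding kchains_N_iff
      using cF db mulk.ch.subspace_diff[OF mulk.subspace_kchains[OF subspace_free_mod_deg]] by blast
    then have "(c - kdiff mulX V b) {} \<in> max_free_mod V a"
      using kchainsD[OF _ mulk.subspace_0[OF subspace_N]] N_max by blast
    then have "lk ((c - kdiff mulX V b) {} l) 0 = 0" for l by (auto simp: max_free_mod_def)
    then have "lk (c {} l) 0 = 0" for l
      using kdiff_constant_term[of "{}" b l] by (simp add: lookup_minus)
    then show "\<Lambda> c \<in> {0}" by (auto simp: \<Lambda>_def fun_eq_iff)
  next
    fix c assume c: "c \<in> {c \<in> P. \<Lambda> c \<in> {0}}"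
    then have cF: "c \<in> kchains V 0 (F j)" by (simp add: P_def)
    have "lk (c {} l) 0 = 0" for l using c by (auto simp: \<Lambda>_def fun_eq_iff)
    moreover have "c {} \<in> F j" using kchainsD[OF cF F_0] .
    ultimately have "c {} \<in> max_free_mod V a" by (auto simp: max_free_mod_def free_mod_deg_def)
    then obtain b where b: "b \<in> kchains V (Suc 0) (F (j - 1))" "kdiff mulX V b = c"
      using koszul_exact[OF finV cF mulk.kdiff_kchains_0[OF finV cF]] by blast
    then have "push c = kdiff X V (push b)" using push_kdiff[OF b(1)] by simp
    then show "c \<in> Q" using c push_kchains[OF b(1)] by (auto simp: Q_def B_def)
  qed
  have t2: "qdim (pointwise (pointwise smul)) P Q n \<longleftrightarrow> qdim (pointwise (*)) (supported A (UNIV :: 'k set)) {0} n" for n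
  proof (rule pairK.qdim_transport[where L = \<Lambda>])
    show "KK.subspace {0}" by (rule KK.subspace_single_0)
    show "{0} \<subseteq> supported A (UNIV :: 'k set)" by (auto simp: supported_def)
    show "\<Lambda> (x + y) = \<Lambda> x + \<Lambda> y" for x y by (auto simp: \<Lambda>_def lookup_add fun_eq_iff)
    show "\<Lambda> (pointwise (pointwise smul) x y) = pointwise (*) x (\<Lambda> y)" for x y
      by (auto simp: \<Lambda>_def fun_eq_iff)
    show "\<Lambda> ` P = supported A UNIV"
    proof (intro equalityI subsetI)
      fix x assume "x \<in> \<Lambda> ` P"
      then obtain c where c: "c \<in> kchains V 0 (F j)" "x = \<Lambda> c" by (auto simp: P_def)
      have cF: "c {} \<in> F j" using kchainsD[OF c(1) F_0] .
      have "x l = 0" if "l \<notin> A" for l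
      proof (cases "l < length a")
        case True
        then have "c {} l \<in> homog (j - a ! l)" "j - a ! l \<noteq> 0"
          using free_mod_degD(3)[OF cF] that by (auto simp: A_def)
        then show ?thesis using c(2) unfolding homog_iff by (auto simp: \<Lambda>_def)
      next
        case False
        then show ?thesis using free_mod_degD(2)[OF cF] c(2) by (simp add: \<Lambda>_def)
      qed
      then show "x \<in> supported A UNIV" by (simp add: supported_def)
    next
      fix x :: "nat \<Rightarrow> 'k" assume x: "x \<in> supported A UNIV"
      define c where "c J = (\<lambda>l. if J = {} then Poly_Mapping.single 0 (x l) else 0 :: 'k mpoly)" for J :: "nat set"
      have x0: "x l = 0" if "l \<notin> A" for l using x that by (auto simp: supported_def)
      have "(\<lambda>l. Poly_Mapping.single 0 (x l)) \<in> F j"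
      proof (rule free_mod_degI)
        fix l
        show "Poly_Mapping.single 0 (x l) \<in> in_vars V" by (simp add: in_vars_def)
        show "Poly_Mapping.single 0 (x l) = (0 :: 'k mpoly)" if "length a \<le> l"
          using x0[of l] that by (simp add: A_def)
        show "Poly_Mapping.single 0 (x l) \<in> homog (j - a ! l)" if "l < length a"
          using x0[of l] that by (cases "l \<in> A") (auto simp: A_def homog_def)
      qed
      then have "c \<in> kchains V 0 (F j)" using finite_subset[OF _ finV]
        by (intro kchainsI) (auto simp: c_def fun_eq_iff)
      moreover have "\<Lambda> c = x" by (simp add: \<Lambda>_def c_def)
      ultimately show "x \<in> \<Lambda> ` P" by (auto simp: P_def)
    qed
  qed (use sP Q' in auto)
  have "qdim (pointwise (*)) (supported A (UNIV :: 'k set)) {0} (card A)"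
    by (rule qdim_coefficients) (simp add: A_def)
  moreover have "card A = count (mset a) j"
    by (simp add: A_def count_mset count_list_eq_length_filter length_filter_conv_card eq_commute)
  ultimately show ?thesis unfolding has_betti_def B_def[symmetric] using t1 t2 by simp
qed

end

section \<open>Homogeneous components\<close>

definition hcomp :: "int list \<Rightarrow> int \<Rightarrow> (nat \<Rightarrow> 'k::field mpoly) \<Rightarrow> nat \<Rightarrow> 'k mpoly" where
  "hcomp a e u = (\<lambda>l. if l < length a then pfilter (\<lambda>m. int (mdeg m) = e - a ! l) (u l) else 0)"

lemma free_mod_deg_free_mod: "u \<in> free_mod_deg V a e \<Longrightarrow> u \<in> free_mod V a"
  by (simp add: free_mod_deg_def)

lemma subspace_free_mod: "mulk.subspace (free_mod V a)"
  by (rule mulk.subspaceI) (auto simp: free_mod_def intro: in_vars_add in_vars_smul)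

lemma free_mod_mult: "p \<in> in_vars V \<Longrightarrow> u \<in> free_mod V a \<Longrightarrow> (\<lambda>l. p * u l) \<in> free_mod V a"
  by (auto simp: free_mod_def intro: in_vars_mult)

lemma hcomp_in_free_mod_deg: "u \<in> free_mod V a \<Longrightarrow> hcomp a e u \<in> free_mod_deg V a e"
  by (rule free_mod_degI) (auto simp: hcomp_def free_mod_def homog_iff intro!: in_vars_pfilter)

lemma hcomp_add: "hcomp a e (u + v) = hcomp a e u + hcomp a e v"
  by (auto simp: hcomp_def fun_eq_iff lookup_add intro!: poly_mapping_eqI)

lemma hcomp_0 [simp]: "hcomp a e 0 = 0"
  by (auto simp: hcomp_def fun_eq_iff intro!: poly_mapping_eqI)

lemma hcomp_of_deg:
  assumes "u \<in> free_mod_deg V a e" shows "hcomp a e' u = (if e' = e then u else 0)"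
proof
  fix l show "hcomp a e' u l = (if e' = e then u else 0) l"
  proof (cases "l < length a")
    case True
    have h: "lk (u l) m \<noteq> 0 \<Longrightarrow> int (mdeg m) = e - a ! l" for m
      using free_mod_degD(3)[OF assms True] by (auto simp: homog_iff)
    show ?thesis
    proof (rule poly_mapping_eqI)
      fix m show "lk (hcomp a e' u l) m = lk ((if e' = e then u else 0) l) m"
        using True h[of m] by (cases "lk (u l) m = 0") (auto simp: hcomp_def)
    qed
  next
    case False
    then show ?thesis using free_mod_degD(2)[OF assms, of l] by (auto simp: hcomp_def)
  qed
qed

lemma hcomp_sum: "hcomp a e (sum f A) = (\<Sum>i\<in>A. hcomp a e (f i))"
proof (induction A rule: infinite_finite_induct)
  case (insert x A)
  then show ?case by (simp only: sum.insert[OF insert.hyps] hcomp_add)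
qed (simp_all del: zero_fun_apply)

lemma hcomp_decomposition:
  assumes "u \<in> free_mod V a"
  obtains E where "finite E" "u = (\<Sum>e\<in>E. hcomp a e u)" "\<And>e. e \<notin> E \<Longrightarrow> hcomp a e u = 0"
proof -
  define E where "E = (\<Union>l<length a. (\<lambda>m. int (mdeg m) + a ! l) ` ks (u l))"
  have fin: "finite E" by (simp add: E_def)
  have z: "lk (u l) m = 0" if "l < length a" "int (mdeg m) + a ! l \<notin> E" for l m
  proof (rule ccontr)
    assume "lk (u l) m \<noteq> 0"
    then have "m \<in> ks (u l)" by (simp add: in_keys_iff)
    then show False using that unfolding E_def by blast
  qed
  have "u = (\<Sum>e\<in>E. hcomp a e u)"
  proof
    fix l show "u l = (\<Sum>e\<in>E. hcomp a e u) l"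
    proof (cases "l < length a")
      case True
      show ?thesis
      proof (rule poly_mapping_eqI)
        fix m
        have "lk ((\<Sum>e\<in>E. hcomp a e u) l) m = (\<Sum>e\<in>E. if e = int (mdeg m) + a ! l then lk (u l) m else 0)"
          unfolding sum_fun_apply lookup_sum using True by (intro sum.cong) (auto simp: hcomp_def)
        also have "\<dots> = lk (u l) m" using z[OF True, of m] fin by (simp add: sum.delta)
        finally show "lk (u l) m = lk ((\<Sum>e\<in>E. hcomp a e u) l) m" by simp
      qed
    next
      case False
      then show ?thesis using assms by (simp add: sum_fun_apply hcomp_def free_mod_def)
    qed
  qed
  moreover have "hcomp a e u = 0" if "e \<notin> E" for e
  proof
    fix l show "hcomp a e u l = 0 l"
      using z that by (auto simp: hcomp_def intro!: poly_mapping_eqI)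
  qed
  ultimately show ?thesis using that fin by blast
qed

section \<open>Graded homomorphisms\<close>

lemma graded_homD:
  assumes "graded_hom V a b \<phi>"
  shows "u \<in> free_mod V a \<Longrightarrow> \<phi> u \<in> free_mod V b"
    and "u \<in> free_mod V a \<Longrightarrow> v \<in> free_mod V a \<Longrightarrow> \<phi> (u + v) = \<phi> u + \<phi> v"
    and "p \<in> in_vars V \<Longrightarrow> u \<in> free_mod V a \<Longrightarrow> \<phi> (\<lambda>l. p * u l) = (\<lambda>l. p * \<phi> u l)"
    and "u \<in> free_mod_deg V a e \<Longrightarrow> \<phi> u \<in> free_mod_deg V b e"
  using assms by (auto simp: graded_hom_def plus_fun_def)

lemma graded_hom_cong:
  fixes \<phi> \<psi> :: "(nat \<Rightarrow> 'k::field mpoly) \<Rightarrow> nat \<Rightarrow> 'k mpoly"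
  assumes \<phi>: "graded_hom V a b \<phi>" and eq: "\<And>u. u \<in> free_mod V a \<Longrightarrow> \<psi> u = \<phi> u"
  shows "graded_hom V a b \<psi>"
proof -
  have sum: "(\<lambda>l. u l + v l) \<in> free_mod V a" if "u \<in> free_mod V a" "v \<in> free_mod V a" for u v :: "nat \<Rightarrow> 'k mpoly"
    using mulk.subspace_add[OF subspace_free_mod that] by (simp only: plus_fun_def)
  show ?thesis unfolding graded_hom_def
  proof (intro conjI ballI allI)
    fix u v :: "nat \<Rightarrow> 'k mpoly" assume u: "u \<in> free_mod V a" and v: "v \<in> free_mod V a"
    show "\<psi> u \<in> free_mod V b" unfolding eq[OF u] by (rule graded_homD(1)[OF \<phi> u])
    show "\<psi> (\<lambda>l. u l + v l) = (\<lambda>l. \<psi> u l + \<psi> v l)"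
      unfolding eq[OF u] eq[OF v] eq[OF sum[OF u v]]
      using graded_homD(2)[OF \<phi> u v] by (simp only: plus_fun_def)
  next
    fix p :: "'k mpoly" and u :: "nat \<Rightarrow> 'k mpoly" assume p: "p \<in> in_vars V" and u: "u \<in> free_mod V a"
    show "\<psi> (\<lambda>l. p * u l) = (\<lambda>l. p * \<psi> u l)"
      unfolding eq[OF u] eq[OF free_mod_mult[OF p u]] by (rule graded_homD(3)[OF \<phi> p u])
  next
    fix e and u :: "nat \<Rightarrow> 'k mpoly" assume u: "u \<in> free_mod_deg V a e"
    show "\<psi> u \<in> free_mod_deg V b e"
      unfolding eq[OF free_mod_deg_free_mod[OF u]] by (rule graded_homD(4)[OF \<phi> u])
  qed
qed

lemma graded_hom_smul:
  assumes "graded_hom V a b \<phi>" "u \<in> free_mod V a"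
  shows "\<phi> (pointwise smul c u) = pointwise smul c (\<phi> u)"
proof -
  have "Poly_Mapping.single 0 c \<in> in_vars V" by (simp add: in_vars_def)
  then show ?thesis using graded_homD(3)[OF assms(1) _ assms(2)]
    by (simp add: pointwise_def smul_def)
qed

lemma graded_hom_0: "graded_hom V a b \<phi> \<Longrightarrow> \<phi> 0 = 0"
  using graded_hom_smul[OF _ mulk.subspace_0[OF subspace_free_mod], of V a b \<phi> 0]
  by (simp only: mulk.scale_zero_left)

lemma graded_hom_sum:
  assumes "graded_hom V a b \<phi>"
  shows "(\<And>i. i \<in> A \<Longrightarrow> f i \<in> free_mod V a) \<Longrightarrow> \<phi> (sum f A) = (\<Sum>i\<in>A. \<phi> (f i))"
proof (induction A rule: infinite_finite_induct)
  case (insert x A)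
  have "\<phi> (f x + sum f A) = \<phi> (f x) + \<phi> (sum f A)"
    using insert.prems by (intro graded_homD(2)[OF assms] mulk.subspace_sum[OF subspace_free_mod]) auto
  moreover have "\<phi> (sum f A) = (\<Sum>i\<in>A. \<phi> (f i))" using insert by blast
  ultimately show ?case by (simp only: sum.insert[OF insert.hyps])
next
  case (infinite A)
  show ?case by (simp only: sum.infinite[OF infinite.hyps] graded_hom_0[OF assms])
qed (simp only: sum.empty graded_hom_0[OF assms])

lemma graded_hom_hcomp:
  assumes "graded_hom V a b \<phi>" "u \<in> free_mod V a"
  shows "\<phi> (hcomp a e u) = hcomp b e (\<phi> u)"
proof -
  obtain E where E: "finite E" "u = (\<Sum>e\<in>E. hcomp a e u)" "\<And>e. e \<notin> E \<Longrightarrow> hcomp a e u = 0"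
    using hcomp_decomposition[OF assms(2)] by blast
  have h: "hcomp a i u \<in> free_mod_deg V a i" for i by (rule hcomp_in_free_mod_deg[OF assms(2)])
  have "\<phi> u = \<phi> (\<Sum>e\<in>E. hcomp a e u)" using E(2) by simp
  also have "\<dots> = (\<Sum>i\<in>E. \<phi> (hcomp a i u))"
    by (rule graded_hom_sum[OF assms(1)]) (rule free_mod_deg_free_mod[OF h])
  finally have "hcomp b e (\<phi> u) = (\<Sum>i\<in>E. hcomp b e (\<phi> (hcomp a i u)))" by (simp only: hcomp_sum)
  also have "\<dots> = (\<Sum>i\<in>E. if i = e then \<phi> (hcomp a i u) else 0)"
    using hcomp_of_deg[OF graded_homD(4)[OF assms(1) h]] by (intro sum.cong) auto
  also have "\<dots> = (if e \<in> E then \<phi> (hcomp a e u) else 0)" by (rule sum.delta[OF E(1)])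
  also have "\<dots> = \<phi> (hcomp a e u)"
  proof (cases "e \<in> E")
    case False
    then show ?thesis by (simp only: E(3)[OF False] graded_hom_0[OF assms(1)] if_False)
  qed (simp only: if_True)
  finally show ?thesis by simp
qed

text \<open>
  Exactness may be checked on homogeneous elements: components of a preimage of \<open>w\<close> are preimages of
  the components of \<open>w\<close>.
\<close>

lemma image_iff_graded:
  assumes \<phi>: "graded_hom V a b \<phi>" and N: "mulk.subspace N" "N \<subseteq> free_mod V b"
    and hN: "\<And>u e. u \<in> N \<Longrightarrow> hcomp b e u \<in> N"
  shows "\<phi> ` free_mod V a = N \<longleftrightarrow> (\<forall>e. \<phi> ` free_mod_deg V a e = {w \<in> free_mod_deg V b e. w \<in> N})"
proof (intro iffI allI)
  fix e assume im: "\<phi> ` free_mod V a = N"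
  show "\<phi> ` free_mod_deg V a e = {w \<in> free_mod_deg V b e. w \<in> N}"
  proof (intro equalityI subsetI)
    fix w assume "w \<in> \<phi> ` free_mod_deg V a e"
    then show "w \<in> {w \<in> free_mod_deg V b e. w \<in> N}"
      using graded_homD(4)[OF \<phi>] free_mod_deg_free_mod im by blast
  next
    fix w assume w: "w \<in> {w \<in> free_mod_deg V b e. w \<in> N}"
    then obtain u where u: "u \<in> free_mod V a" "\<phi> u = w" using im by blast
    have "\<phi> (hcomp a e u) = w"
      using graded_hom_hcomp[OF \<phi> u(1), of e] u(2) w hcomp_of_deg[of w V b e e] by simp
    then show "w \<in> \<phi> ` free_mod_deg V a e" using hcomp_in_free_mod_deg[OF u(1), of e] by blast
  qed
next
  assume im: "\<forall>e. \<phi> ` free_mod_deg V a e = {w \<in> free_mod_deg V b e. w \<in> N}"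
  show "\<phi> ` free_mod V a = N"
  proof (intro equalityI subsetI)
    fix w assume "w \<in> \<phi> ` free_mod V a"
    then obtain u where u: "u \<in> free_mod V a" "w = \<phi> u" by blast
    obtain E where E: "finite E" "u = (\<Sum>e\<in>E. hcomp a e u)"
      using hcomp_decomposition[OF u(1)] by metis
    have h: "hcomp a i u \<in> free_mod_deg V a i" for i by (rule hcomp_in_free_mod_deg[OF u(1)])
    have "w = \<phi> (\<Sum>e\<in>E. hcomp a e u)" using u(2) E(2) by simp
    also have "\<dots> = (\<Sum>i\<in>E. \<phi> (hcomp a i u))"
      by (rule graded_hom_sum[OF \<phi>]) (rule free_mod_deg_free_mod[OF h])
    also have "\<dots> \<in> N" using im h by (intro mulk.subspace_sum[OF N(1)]) blast
    finally show "w \<in> N" .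
  next
    fix w assume w: "w \<in> N"
    then have wb: "w \<in> free_mod V b" using N(2) by blast
    obtain E where E: "finite E" "w = (\<Sum>e\<in>E. hcomp b e w)"
      using hcomp_decomposition[OF wb] by metis
    have "\<exists>u\<in>free_mod_deg V a e. \<phi> u = hcomp b e w" for e
    proof -
      have "hcomp b e w \<in> \<phi> ` free_mod_deg V a e"
        using im hN[OF w, of e] hcomp_in_free_mod_deg[OF wb, of e] by simp
      then show ?thesis by auto
    qed
    then obtain u where u: "\<And>e. u e \<in> free_mod_deg V a e" "\<And>e. \<phi> (u e) = hcomp b e w" by metis
    have "\<phi> (\<Sum>e\<in>E. u e) = (\<Sum>e\<in>E. \<phi> (u e))"
      by (rule graded_hom_sum[OF \<phi>]) (rule free_mod_deg_free_mod[OF u(1)])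
    also have "\<dots> = w" using u(2) E(2) by simp
    finally show "w \<in> \<phi> ` free_mod V a"
      using mulk.subspace_sum[OF subspace_free_mod, of E u V a] free_mod_deg_free_mod[OF u(1)] by (metis imageI)
  qed
qed

lemma kernel_closed:
  assumes "graded_hom V b c \<psi>"
  shows "mulk.subspace {u \<in> free_mod V b. \<psi> u = 0}"
    and "u \<in> {u \<in> free_mod V b. \<psi> u = 0} \<Longrightarrow> hcomp b e u \<in> {u \<in> free_mod V b. \<psi> u = 0}"
proof -
  show "mulk.subspace {u \<in> free_mod V b. \<psi> u = 0}"
  proof (rule mulk.subspaceI)
    show "0 \<in> {u \<in> free_mod V b. \<psi> u = 0}"
      using graded_hom_0[OF assms] mulk.subspace_0[OF subspace_free_mod] by blast
    show "x + y \<in> {u \<in> free_mod V b. \<psi> u = 0}"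
      if "x \<in> {u \<in> free_mod V b. \<psi> u = 0}" "y \<in> {u \<in> free_mod V b. \<psi> u = 0}" for x y
    proof -
      have "x + y \<in> free_mod V b" using that by (intro mulk.subspace_add[OF subspace_free_mod]) auto
      then show ?thesis using that graded_homD(2)[OF assms, of x y] by simp
    qed
    show "pointwise smul k x \<in> {u \<in> free_mod V b. \<psi> u = 0}"
      if "x \<in> {u \<in> free_mod V b. \<psi> u = 0}" for k x
    proof -
      have "pointwise smul k x \<in> free_mod V b"
        using that by (intro mulk.subspace_scale[OF subspace_free_mod]) auto
      then show ?thesis using that graded_hom_smul[OF assms, of x k] by simp
    qed
  qed
  show "hcomp b e u \<in> {u \<in> free_mod V b. \<psi> u = 0}" if "u \<in> {u \<in> free_mod V b. \<psi> u = 0}"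
    using that graded_hom_hcomp[OF assms, of u e]
      free_mod_deg_free_mod[OF hcomp_in_free_mod_deg[of u V b e]] by simp
qed

lemma free_cover_graded_hom:
  assumes "finite V" "graded_hom V a b \<phi>" "\<And>e. \<phi> ` free_mod_deg V a e = M e"
  shows "free_cover V mulX a \<phi> M"
proof
  show "finite V" by fact
  show "\<phi> ` free_mod_deg V a e = M e" for e by fact
  show "\<phi> (u + w) = \<phi> u + \<phi> w" if "u \<in> free_mod_deg V a e" "w \<in> free_mod_deg V a e" for u w e
    using that graded_homD(2)[OF assms(2)] free_mod_deg_free_mod by blast
  show "\<phi> (pointwise smul c u) = pointwise smul c (\<phi> u)" if "u \<in> free_mod_deg V a e" for u c e
    using that graded_hom_smul[OF assms(2)] free_mod_deg_free_mod by blast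
  show "\<phi> (mulX v u) = mulX v (\<phi> u)" if "v \<in> V" "u \<in> free_mod_deg V a e" for u v e
    using graded_homD(3)[OF assms(2) in_vars_var[OF that(1)] free_mod_deg_free_mod[OF that(2)]]
    by (simp add: mulX_def)
qed

section \<open>Existence of minimal covers\<close>

definition lincomb :: "nat \<Rightarrow> (nat \<Rightarrow> nat \<Rightarrow> 'k::field mpoly) \<Rightarrow> (nat \<Rightarrow> 'k mpoly) \<Rightarrow> nat \<Rightarrow> 'k mpoly" where
  "lincomb n w u = (\<Sum>l<n. (\<lambda>i. u l * w l i))"

lemma lincomb_apply: "lincomb n w u i = (\<Sum>l<n. u l * w l i)"
  by (simp add: lincomb_def sum_fun_apply)

lemma in_vars_sum: "(\<And>i. i \<in> A \<Longrightarrow> (f i :: 'k::field mpoly) \<in> in_vars V) \<Longrightarrow> sum f A \<in> in_vars V"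
  by (induction A rule: infinite_finite_induct) (auto intro: in_vars_add)

lemma homog_sum: "(\<And>i. i \<in> A \<Longrightarrow> (f i :: 'k::field mpoly) \<in> homog e) \<Longrightarrow> sum f A \<in> homog e"
  by (induction A rule: infinite_finite_induct) (auto intro: homog_add)

lemma graded_hom_lincomb:
  fixes w :: "nat \<Rightarrow> nat \<Rightarrow> 'k::field mpoly"
  assumes w: "\<And>l. l < length a \<Longrightarrow> w l \<in> free_mod_deg V b (a ! l)"
  shows "graded_hom V a b (lincomb (length a) w)"
  unfolding graded_hom_def
proof (intro conjI ballI allI)
  note wD = free_mod_degD[OF w]
  fix u :: "nat \<Rightarrow> 'k mpoly" assume u: "u \<in> free_mod V a"
  show "lincomb (length a) w u \<in> free_mod V b"
    using u wD by (auto simp: free_mod_def lincomb_apply intro!: in_vars_sum in_vars_mult)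
next
  fix u v :: "nat \<Rightarrow> 'k mpoly"
  show "lincomb (length a) w (\<lambda>l. u l + v l) = (\<lambda>l. lincomb (length a) w u l + lincomb (length a) w v l)"
    by (simp add: lincomb_apply fun_eq_iff distrib_right sum.distrib)
next
  fix p and u :: "nat \<Rightarrow> 'k mpoly"
  show "lincomb (length a) w (\<lambda>l. p * u l) = (\<lambda>l. p * lincomb (length a) w u l)"
    by (simp add: lincomb_apply fun_eq_iff sum_distrib_left mult.assoc)
next
  note wD = free_mod_degD[OF w]
  fix e and u :: "nat \<Rightarrow> 'k mpoly" assume u: "u \<in> free_mod_deg V a e"
  show "lincomb (length a) w u \<in> free_mod_deg V b e"
  proof (rule free_mod_degI)
    fix i
    show "lincomb (length a) w u i \<in> in_vars V"
      using wD free_mod_degD(1)[OF u] by (auto simp: lincomb_apply intro!: in_vars_sum in_vars_mult)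
    show "lincomb (length a) w u i = 0" if "length b \<le> i" using wD that by (simp add: lincomb_apply)
    assume i: "i < length b"
    have "u l * w l i \<in> homog (e - b ! i)" if "l < length a" for l
      using homog_mult[OF free_mod_degD(3)[OF u that] wD(3)[OF that i]] by simp
    then show "lincomb (length a) w u i \<in> homog (e - b ! i)" by (auto simp: lincomb_apply intro!: homog_sum)
  qed
qed

text \<open>
  Choose homogeneous elements of \<open>N\<close> whose classes form a basis of \<open>H\<^sub>0(N) = N / \<mm>N\<close>. They generate \<open>N\<close> by
  the graded Nakayama lemma, an induction on the degree that starts below the least degree of a generator of the
  ambient free module. A relation between them has no constant coefficients because the classes are independent
  modulo \<open>\<mm>N\<close>.
\<close>

lemma exists_minimal_cover:
  fixes N :: "int \<Rightarrow> (nat \<Rightarrow> 'k::field mpoly) set"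
  assumes V: "finite V"
    and sN: "\<And>e. mulk.subspace (N e)" and NF: "\<And>e. N e \<subseteq> free_mod_deg V b e"
    and mN: "\<And>e e' p u. p \<in> in_vars V \<Longrightarrow> p \<in> homog e' \<Longrightarrow> u \<in> N e \<Longrightarrow> (\<lambda>l. p * u l) \<in> N (e' + e)"
    and betti: "\<And>j. has_betti (pointwise smul) mulX V N 0 j (\<beta> j)"
    and fin: "finite J" "\<And>j. j \<notin> J \<Longrightarrow> \<beta> j = 0"
  shows "\<exists>a \<phi>. graded_hom V a b \<phi> \<and> free_cover V mulX a \<phi> N \<and> (\<forall>e. ker_deg V a \<phi> e \<subseteq> max_free_mod V a)"
proof -
  obtain a where a: "mset a = (\<Sum>j\<in>J. replicate_mset (\<beta> j) j)" using ex_mset by blast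
  have cnt: "count (mset a) j = \<beta> j" for j
    using fin by (auto simp: a count_sum if_distrib cong: if_cong)
  \<comment> \<open>the generators of degree \<open>e\<close>, as positions in the list \<open>a\<close>\<close>
  define idx where "idx e = {l. l < length a \<and> a ! l = e}" for e
  have fidx: "finite (idx e)" for e by (simp add: idx_def)
  have "card (idx e) = \<beta> e" for e
    using cnt[of e] by (simp add: idx_def count_mset count_list_eq_length_filter length_filter_conv_card eq_commute)
  define B where "B e = kdiff mulX V ` kchains V (Suc 0) (N (e - 1))" for e
  have cyc: "kcycles mulX V 0 (N e) = kchains V 0 (N e)" for e
    using mulk.kdiff_kchains_0[OF V] by (auto simp: kcycles_def)
  have "\<exists>c. qbasis (pointwise (pointwise smul)) (kchains V 0 (N e)) (B e) (idx e) c" for e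
    using betti[of e] \<open>card (idx e) = \<beta> e\<close> qdim_obtain_qbasis[OF _ fidx[of e]]
    unfolding has_betti_def B_def[symmetric] cyc by metis
  then obtain c where c: "\<And>e. qbasis (pointwise (pointwise smul)) (kchains V 0 (N e)) (B e) (idx e) (c e)"
    by metis
  define w where "w l = c (a ! l) l {}" for l
  have N0: "0 \<in> N e" for e using mulk.subspace_0[OF sN] .
  have wN: "w l \<in> N (a ! l)" if "l < length a" for l
  proof -
    have "c (a ! l) l \<in> kchains V 0 (N (a ! l))" using c[of "a ! l"] that by (auto simp: qbasis_def idx_def)
    then show ?thesis unfolding w_def by (rule kchainsD[OF _ N0])
  qed
  define \<phi> where "\<phi> = lincomb (length a) w"
  have hom: "graded_hom V a b \<phi>" unfolding \<phi>_def using wN NF by (intro graded_hom_lincomb) blast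
  \<comment> \<open>elements as Koszul chains of degree \<open>0\<close>\<close>
  define pt where "pt x = (\<lambda>J::nat set. if J = {} then x else 0)" for x :: "nat \<Rightarrow> 'k mpoly"
  have J0: "J = {}" if "J \<subseteq> V" "card J = 0" for J
    using finite_subset[OF that(1) V] that(2) by simp
  have pt_in: "pt x \<in> kchains V 0 Q" if "x \<in> Q" for x Q
    using that J0 by (intro kchainsI) (auto simp: pt_def)
  have pt_of: "z = pt (z {})" if "z \<in> kchains V 0 Q" for z Q
  proof
    fix J show "z J = pt (z {}) J" using kchainsD0[OF that, of J] J0[of J] by (cases "J = {}") (auto simp: pt_def)
  qed
  \<comment> \<open>the combination of the generators of degree \<open>e\<close> with constant coefficients \<open>x\<close>\<close>
  define con where "con x e = (\<lambda>l. if l < length a \<and> a ! l = e then Poly_Mapping.single 0 (x l) else 0 :: 'k mpoly)"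
    for x :: "nat \<Rightarrow> 'k" and e
  have con_F: "con x e \<in> free_mod_deg V a e" for x e
    by (intro free_mod_degI) (auto simp: con_def in_vars_def homog_def)
  have \<phi>_con: "pt (\<phi> (con x e)) = (\<Sum>l\<in>idx e. pointwise (pointwise smul) (x l) (c e l))" for x e
  proof
    fix J
    show "pt (\<phi> (con x e)) J = (\<Sum>l\<in>idx e. pointwise (pointwise smul) (x l) (c e l)) J"
    proof (cases "J = {}")
      case True
      show ?thesis
      proof
        fix i
        have "\<phi> (con x e) i = (\<Sum>l<length a. con x e l * w l i)" by (simp add: \<phi>_def lincomb_apply)
        also have "\<dots> = (\<Sum>l\<in>idx e. smul (x l) (w l i))"
          by (rule sum.mono_neutral_cong_right) (auto simp: idx_def con_def smul_def)
        also have "\<dots> = (\<Sum>l\<in>idx e. smul (x l) (c e l {} i))" by (intro sum.cong) (auto simp: w_def idx_def)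
        finally show "pt (\<phi> (con x e)) J i = (\<Sum>l\<in>idx e. pointwise (pointwise smul) (x l) (c e l)) J i"
          using True by (simp add: pt_def sum_fun_apply)
      qed
    next
      case False
      have "c e l J = 0" if "l \<in> idx e" for l
      proof -
        have "c e l \<in> kchains V 0 (N e)" using c[of e] that by (auto simp: qbasis_def)
        from pt_of[OF this] show ?thesis using False by (metis pt_def)
      qed
      then show ?thesis using False by (simp add: pt_def sum_fun_apply fun_eq_iff)
    qed
  qed
  have sub1: "\<phi> u \<in> N e" if u: "u \<in> free_mod_deg V a e" for u e
  proof -
    have "(\<lambda>i. u l * w l i) \<in> N e" if "l < length a" for l
      using mN[OF free_mod_degD(1)[OF u] free_mod_degD(3)[OF u that] wN[OF that]] by simp
    then show ?thesis unfolding \<phi>_def lincomb_def by (intro mulk.subspace_sum[OF sN]) auto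
  qed
  have lift: "x \<in> \<phi> ` free_mod_deg V a e" if prev: "N (e - 1) \<subseteq> \<phi> ` free_mod_deg V a (e - 1)" and x: "x \<in> N e" for x e
  proof -
    obtain k where "pt x - (\<Sum>l\<in>idx e. pointwise (pointwise smul) (k l) (c e l)) \<in> B e"
      using c[of e] pt_in[OF x] unfolding qbasis_def by blast
    then obtain y where y: "y \<in> kchains V (Suc 0) (N (e - 1))" "pt x - pt (\<phi> (con k e)) = kdiff mulX V y"
      unfolding \<phi>_con[symmetric] B_def by blast
    have "y {v} \<in> \<phi> ` free_mod_deg V a (e - 1)" for v
      using kchainsD[OF y(1) N0, of "{v}"] prev by blast
    then have "\<exists>u\<in>free_mod_deg V a (e - 1). \<phi> u = y {v}" for v by (metis imageE)
    then obtain u where u: "\<And>v. u v \<in> free_mod_deg V a (e - 1)" "\<And>v. \<phi> (u v) = y {v}" by metis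
    have uF: "mulX v (u v) \<in> free_mod_deg V a e" if "v \<in> V" for v
      using mulX_free_mod_deg[OF that u(1)[of v]] by simp
    have "x - \<phi> (con k e) = (pt x - pt (\<phi> (con k e))) {}" by (simp add: pt_def)
    also have "\<dots> = (\<Sum>v\<in>V. mulX v (y {v}))" unfolding y(2) by (simp add: kdiff_def ksgn_def)
    also have "\<dots> = (\<Sum>v\<in>V. \<phi> (mulX v (u v)))"
    proof (intro sum.cong refl)
      fix v assume "v \<in> V"
      then show "mulX v (y {v}) = \<phi> (mulX v (u v))"
        using graded_homD(3)[OF hom in_vars_var free_mod_deg_free_mod[OF u(1)], of v v] u(2)[of v]
        by (simp add: mulX_def)
    qed
    also have "\<dots> = \<phi> (\<Sum>v\<in>V. mulX v (u v))"
      using uF free_mod_deg_free_mod by (intro graded_hom_sum[OF hom, symmetric]) blast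
    finally have "x = \<phi> (\<Sum>v\<in>V. mulX v (u v)) + \<phi> (con k e)" by (simp only: diff_eq_eq)
    moreover have s: "(\<Sum>v\<in>V. mulX v (u v)) \<in> free_mod_deg V a e"
      using uF by (intro mulk.subspace_sum[OF subspace_free_mod_deg])
    ultimately have "x = \<phi> ((\<Sum>v\<in>V. mulX v (u v)) + con k e)"
      using graded_homD(2)[OF hom free_mod_deg_free_mod[OF s] free_mod_deg_free_mod[OF con_F]] by simp
    then show ?thesis using mulk.subspace_add[OF subspace_free_mod_deg s con_F] by blast
  qed
  \<comment> \<open>the entry \<open>0\<close> only serves to make the minimum defined for an empty list\<close>
  define lo where "lo = Min (insert 0 (set b))"
  have low: "N e \<subseteq> \<phi> ` free_mod_deg V a e" if "e < lo" for e
  proof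
    fix x assume "x \<in> N e"
    then have xF: "x \<in> free_mod_deg V b e" using NF by blast
    have "x l = 0" for l
    proof (cases "l < length b")
      case True
      then have "lo \<le> b ! l" unfolding lo_def by (intro Min_le) auto
      then have "lk (x l) m = 0" for m
        using free_mod_degD(3)[OF xF True] that unfolding homog_iff by force
      then show ?thesis by (intro poly_mapping_eqI) simp
    next
      case False
      then show ?thesis using free_mod_degD(2)[OF xF] by simp
    qed
    then have "x = 0" by (simp add: fun_eq_iff)
    then show "x \<in> \<phi> ` free_mod_deg V a e"
      using graded_hom_0[OF hom] mulk.subspace_0[OF subspace_free_mod_deg] by (metis imageI)
  qed
  have sub2: "N e \<subseteq> \<phi> ` free_mod_deg V a e" for e
  proof (cases "e < lo - 1")
    case True
    then show ?thesis using low by simp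
  next
    case False
    then have "lo - 1 \<le> e" by simp
    then show ?thesis
    proof (induction e rule: int_ge_induct)
      case base
      then show ?case using low by simp
    next
      case (step i)
      then show ?case using lift[of "i + 1"] by auto
    qed
  qed
  have cov: "free_cover V mulX a \<phi> N"
    by (rule free_cover_graded_hom[OF V hom]) (use sub1 sub2 in blast)
  interpret free_cover V mulX a \<phi> N by (rule cov)
  have "ker_deg V a \<phi> e \<subseteq> max_free_mod V a" for e
  proof
    fix u assume "u \<in> ker_deg V a \<phi> e"
    then have u: "u \<in> free_mod_deg V a e" "\<phi> u = 0" by (auto simp: ker_deg_def)
    define k where "k l = lk (u l) 0" for l
    have k0: "k l = 0" if "l \<notin> idx e" for l
    proof (cases "l < length a")
      case True
      then have "u l \<in> homog (e - a ! l)" "e - a ! l \<noteq> 0"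
        using free_mod_degD(3)[OF u(1)] that by (auto simp: idx_def)
      then show ?thesis unfolding homog_iff k_def by force
    next
      case False
      then show ?thesis using free_mod_degD(2)[OF u(1)] by (simp add: k_def)
    qed
    \<comment> \<open>a relation minus its constant part lies in \<open>\<mm>F\<close>, so it is a boundary and maps into \<open>\<mm>N\<close>\<close>
    define u1 where "u1 = u - con k e"
    have u1F: "u1 \<in> free_mod_deg V a e" unfolding u1_def
      using u(1) con_F by (intro mulk.subspace_diff[OF subspace_free_mod_deg])
    have "lk (u1 l) 0 = 0" for l
      using k0[of l] by (auto simp: u1_def con_def lookup_minus k_def idx_def)
    then have "u1 \<in> max_free_mod V a" using free_mod_deg_free_mod[OF u1F] by (simp add: max_free_mod_def)
    then obtain y where y: "y \<in> kchains V (Suc 0) (free_mod_deg V a (e - 1))" "kdiff mulX V y = pt u1"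
      using koszul_exact[OF V pt_in[OF u1F] mulk.kdiff_kchains_0[OF V pt_in[OF u1F]]] by (auto simp: pt_def)
    have "push (pt u1) = kdiff mulX V (push y)" using push_kdiff[OF y(1)] y(2) by simp
    moreover have "push (pt u1) = pt (\<phi> u1)" using phi_0 by (auto simp: push_def pt_def)
    ultimately have B1: "pt (\<phi> u1) \<in> B e" using push_kchains[OF y(1)] by (auto simp: B_def)
    have "\<phi> u = \<phi> (u1 + con k e)" by (simp only: u1_def diff_add_cancel)
    then have "\<phi> u1 + \<phi> (con k e) = 0" using add[OF u1F con_F] u(2) by simp
    then have "\<phi> (con k e) = - \<phi> u1" by (simp only: eq_neg_iff_add_eq_0 add.commute)
    then have "pt (\<phi> (con k e)) = - pt (\<phi> u1)" by (auto simp: pt_def)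
    moreover have "mulk.ch.subspace (B e)" unfolding B_def by (rule mulk.subspace_kdiff_image[OF sN])
    ultimately have "pt (\<phi> (con k e)) \<in> B e" using B1 mulk.ch.subspace_neg by metis
    then have "\<forall>l\<in>idx e. k l = 0" using c[of e] unfolding \<phi>_con qbasis_def by blast
    then have "lk (u l) 0 = 0" for l using k0[of l] unfolding k_def by blast
    then show "u \<in> max_free_mod V a" using free_mod_deg_free_mod[OF u(1)] by (simp add: max_free_mod_def)
  qed
  then show ?thesis using hom cov by blast
qed

section \<open>Minimal resolutions and Koszul homology of the inverse system\<close>

definition act_on :: "'k::field dpoly \<Rightarrow> (nat \<Rightarrow> 'k mpoly) \<Rightarrow> nat \<Rightarrow> 'k dpoly" where
  "act_on f u = (\<lambda>l. if l = 0 then contract (u 0) f else 0)"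

text \<open>
  The degree \<open>e\<close> part consists of the derivatives of \<open>f\<close> of order \<open>e\<close>; as polynomials they have
  degree \<open>d - e\<close> if \<open>f\<close> has degree \<open>d\<close>.
\<close>

definition inv_sys :: "nat set \<Rightarrow> 'k::field dpoly \<Rightarrow> int \<Rightarrow> (nat \<Rightarrow> 'k dpoly) set" where
  "inv_sys V f e = act_on f ` free_mod_deg V [0] e"

definition ann_mod :: "nat set \<Rightarrow> 'k::field dpoly \<Rightarrow> (nat \<Rightarrow> 'k mpoly) set" where
  "ann_mod V f = {u \<in> free_mod V [0]. contract (u 0) f = 0}"

lemma act_on_eq_0_iff: "act_on f u = 0 \<longleftrightarrow> contract (u 0) f = 0"
  by (auto simp: act_on_def fun_eq_iff)

lemma free_cover_inv_sys:
  assumes "finite V" shows "free_cover V conX [0] (act_on f) (inv_sys V f)"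
proof
  show "finite V" by fact
  show "act_on f ` free_mod_deg V [0] e = inv_sys V f e" for e by (simp add: inv_sys_def)
  show "act_on f (u + w) = act_on f u + act_on f w" for u w
    by (auto simp: act_on_def contract_add_left fun_eq_iff)
  show "act_on f (pointwise smul c u) = pointwise smul c (act_on f u)" for c u
    by (auto simp: act_on_def contract_smul_left fun_eq_iff)
  show "act_on f (mulX v u) = conX v (act_on f u)" for v u
    by (auto simp: act_on_def mulX_def conX_def contract_mult fun_eq_iff)
qed

lemma ker_deg_act_on: "ker_deg V [0] (act_on f) e = {u \<in> free_mod_deg V [0] e. u \<in> ann_mod V f}"
  by (auto simp: ker_deg_def ann_mod_def act_on_eq_0_iff free_mod_deg_free_mod)

text \<open>
  For \<open>f\<close> homogeneous the components of an annihilating operator annihilate \<open>f\<close>, because their values on \<open>f\<close>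
  have different degrees.
\<close>

lemma ann_mod_closed:
  assumes "f \<in> homog d"
  shows "mulk.subspace (ann_mod V f)" and "u \<in> ann_mod V f \<Longrightarrow> hcomp [0] e u \<in> ann_mod V f"
proof -
  show "mulk.subspace (ann_mod V f)"
    using subspace_free_mod[of V "[0]"]
    by (auto simp: mulk.subspace_def ann_mod_def contract_add_left contract_smul_left)
  show "hcomp [0] e u \<in> ann_mod V f" if u: "u \<in> ann_mod V f"
  proof -
    have "lk (contract (hcomp [0] e u 0) f) m = 0" for m
    proof -
      have sub: "ks (hcomp [0] e u 0) \<subseteq> ks (u 0)" by (auto simp: in_keys_iff hcomp_def split: if_splits)
      have "lk (contract (hcomp [0] e u 0) f) m = (\<Sum>\<beta>\<in>ks (u 0). lk (hcomp [0] e u 0) \<beta> * lk f (\<beta> + m))"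
        by (rule lookup_contract_superset[OF _ sub]) simp
      also have "\<dots> = (\<Sum>\<beta>\<in>ks (u 0). if int (mdeg m) = d - e then lk (u 0) \<beta> * lk f (\<beta> + m) else 0)"
      proof (intro sum.cong refl)
        fix \<beta>
        show "lk (hcomp [0] e u 0) \<beta> * lk f (\<beta> + m) =
            (if int (mdeg m) = d - e then lk (u 0) \<beta> * lk f (\<beta> + m) else 0)"
        proof (cases "lk f (\<beta> + m) = 0")
          case False
          then have "int (mdeg \<beta>) + int (mdeg m) = d" using assms by (auto simp: homog_iff mdeg_add)
          then show ?thesis by (auto simp: hcomp_def)
        qed simp
      qed
      also have "\<dots> = (if int (mdeg m) = d - e then lk (contract (u 0) f) m else 0)"
        by (simp add: lookup_contract)
      also have "\<dots> = 0" using u by (simp add: ann_mod_def)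
      finally show ?thesis .
    qed
    then have "contract (hcomp [0] e u 0) f = 0" by (intro poly_mapping_eqI) simp
    moreover have "hcomp [0] e u \<in> free_mod V [0]" using u
      by (intro free_mod_deg_free_mod[OF hcomp_in_free_mod_deg]) (simp add: ann_mod_def)
    ultimately show ?thesis by (simp add: ann_mod_def)
  qed
qed

text \<open>
  A homogeneous operator with nonzero constant term is a constant, and a nonzero constant does not annihilate \<open>f\<close>.
\<close>

lemma ker_act_on_max:
  assumes "f \<noteq> 0" shows "ker_deg V [0] (act_on f) e \<subseteq> max_free_mod V [0]"
proof
  fix u assume u: "u \<in> ker_deg V [0] (act_on f) e"
  then have uF: "u \<in> free_mod_deg V [0] e" and z: "contract (u 0) f = 0"
    by (auto simp: ker_deg_def act_on_eq_0_iff)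
  have "lk (u 0) 0 = 0"
  proof (rule ccontr)
    assume n: "lk (u 0) 0 \<noteq> 0"
    have h: "u 0 \<in> homog e" using free_mod_degD(3)[OF uF, of 0] by simp
    then have "e = 0" using n by (force simp: homog_iff)
    then have "lk (u 0) m = 0" if "m \<noteq> 0" for m
      using h that mdeg_eq_0_iff[of m] by (auto simp: homog_iff)
    then have "u 0 = smul (lk (u 0) 0) 1"
      by (intro poly_mapping_eqI) (auto simp: lookup_one when_def)
    then have "contract (u 0) f = smul (lk (u 0) 0) f" by (metis contract_smul_left contract_one)
    then have "lk (u 0) 0 * lk f m = 0" for m using z by (metis lookup_smul lookup_zero)
    then have "f = 0" using n by (intro poly_mapping_eqI) simp
    then show False using assms by simp
  qed
  moreover have "u l = 0" if "l \<noteq> 0" for l using free_mod_degD(2)[OF uF, of l] that by simp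
  ultimately have "lk (u l) 0 = 0" for l by (cases "l = 0") auto
  then show "u \<in> max_free_mod V [0]" using free_mod_deg_free_mod[OF uF] by (simp add: max_free_mod_def)
qed

text \<open>
  A minimal resolution of the inverse system, degree by degree. It continues the resolution of the ideal by
  \<open>R = R(0)\<close> in position \<open>0\<close>, with the map \<open>D \<mapsto> D f\<close>; in position \<open>i + 1\<close> it is a cover of the kernel in
  position \<open>i\<close>.
\<close>

definition res_seq ::
  "nat set \<Rightarrow> 'k::field dpoly \<Rightarrow> (nat \<Rightarrow> int list) \<Rightarrow> (nat \<Rightarrow> (nat \<Rightarrow> 'k mpoly) \<Rightarrow> (nat \<Rightarrow> 'k mpoly)) \<Rightarrow> bool" where
  "res_seq V f a \<phi> \<longleftrightarrow> a 0 = [0] \<and> \<phi> 0 = act_on f \<and>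
     (\<forall>i. free_cover V mulX (a (Suc i)) (\<phi> (Suc i)) (ker_deg V (a i) (\<phi> i))) \<and>
     (\<forall>i e. ker_deg V (a i) (\<phi> i) e \<subseteq> max_free_mod V (a i))"

text \<open>
  Iterated dimension shift: \<open>H\<^sub>i(M\<^sub>f)\<close> is \<open>H\<^sub>0\<close> of the \<open>i\<close>-th syzygy module.
\<close>

lemma res_seq_has_betti:
  assumes V: "finite V" and r: "res_seq V f a \<phi>"
  shows "has_betti (pointwise smul) conX V (inv_sys V f) i j (count (mset (a i)) (int i + j))"
proof -
  have max: "ker_deg V (a i) (\<phi> i) e \<subseteq> max_free_mod V (a i)" for i e using r by (simp add: res_seq_def)
  have c0: "free_cover V conX (a 0) (\<phi> 0) (inv_sys V f)" using r free_cover_inv_sys[OF V] by (simp add: res_seq_def)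
  have c: "free_cover V mulX (a (Suc i)) (\<phi> (Suc i)) (ker_deg V (a i) (\<phi> i))" for i
    using r by (simp add: res_seq_def)
  have shift: "has_betti (pointwise smul) mulX V (ker_deg V (a i) (\<phi> i)) k j n \<longleftrightarrow>
      has_betti (pointwise smul) conX V (inv_sys V f) (k + i + 1) (j - int i - 1) n" for i k j n
  proof (induction i arbitrary: k j)
    case 0
    show ?case using free_cover.has_betti_shift[OF c0 max, of k "j - 1" n] by (simp del: pointwise_apply)
  next
    case (Suc i)
    show ?case using free_cover.has_betti_shift[OF c max, of i k "j - 1" n] Suc.IH[of "Suc k" "j - 1"]
      by (simp add: algebra_simps del: pointwise_apply)
  qed
  show ?thesis
  proof (cases i)
    case 0
    then show ?thesis using free_cover.has_betti_0[OF c0 max, of j] by (simp del: pointwise_apply)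
  next
    case (Suc i')
    have "int i + j - int i' - 1 = j" using Suc by simp
    then show ?thesis
      using free_cover.has_betti_0[OF c[of i'] max, of "int i + j"] shift[of i' 0 "int i + j"] Suc by (simp del: pointwise_apply)
  qed
qed

lemma res_seq_of_resolution:
  assumes V: "finite V" and f: "f \<noteq> 0" "f \<in> homog d"
    and r: "graded_min_free_res V n (ann V f) F \<delta> \<epsilon>"
  shows "\<exists>\<phi>. res_seq V f (\<lambda>i. if i = 0 then [0] else F i) \<phi>"
proof -
  define a where "a i = (if i = 0 then [0] else F i)" for i
  define \<epsilon>' where "\<epsilon>' u l = (if l = 0 then \<epsilon> u else 0)" for u and l :: nat
  define \<phi> where "\<phi> i = (if i = 0 then act_on f else if i = 1 then \<epsilon>' else \<delta> (i - 1))" for i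
  have res: "graded_hom V (F 1) [0] \<epsilon>'" "\<epsilon> ` free_mod V (F 1) = ann V f"
      "\<And>i. i \<ge> 1 \<Longrightarrow> graded_hom V (F (i + 1)) (F i) (\<delta> i)"
      "{u \<in> free_mod V (F 1). \<epsilon> u = 0} = \<delta> 1 ` free_mod V (F 2)"
      "\<And>i. i \<ge> 1 \<Longrightarrow> {u \<in> free_mod V (F (i + 1)). \<delta> i u = (\<lambda>l. 0)} = \<delta> (i + 1) ` free_mod V (F (i + 2))"
      "\<And>i. i \<ge> 1 \<Longrightarrow> \<delta> i ` free_mod V (F (i + 1)) \<subseteq> max_free_mod V (F i)"
    using r unfolding graded_min_free_res_def \<epsilon>'_def by auto
  have hom: "graded_hom V (a (Suc i)) (a i) (\<phi> (Suc i))" for i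
    using res(1) res(3)[of i] by (cases i) (auto simp: a_def \<phi>_def)
  have exact: "\<phi> (Suc (Suc i)) ` free_mod V (a (Suc (Suc i))) = {u \<in> free_mod V (a (Suc i)). \<phi> (Suc i) u = 0}" for i
  proof (cases i)
    case 0
    have "\<epsilon>' u = 0 \<longleftrightarrow> \<epsilon> u = 0" for u by (auto simp: \<epsilon>'_def fun_eq_iff)
    then show ?thesis using res(4) 0 by (simp add: a_def \<phi>_def numeral_2_eq_2)
  next
    case (Suc i')
    then show ?thesis using res(5)[of i] by (simp add: a_def \<phi>_def zero_fun_def)
  qed
  have exact0: "\<phi> 1 ` free_mod V (a 1) = ann_mod V f"
  proof (intro equalityI subsetI)
    fix x assume "x \<in> \<phi> 1 ` free_mod V (a 1)"
    then obtain u where u: "u \<in> free_mod V (F 1)" "x = \<epsilon>' u" by (auto simp: a_def \<phi>_def)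
    have "x \<in> free_mod V [0]" using graded_homD(1)[OF res(1) u(1)] u(2) by simp
    moreover have "x 0 \<in> ann V f" using u res(2) by (auto simp: \<epsilon>'_def)
    ultimately show "x \<in> ann_mod V f" by (simp add: ann_mod_def ann_def)
  next
    fix x assume x: "x \<in> ann_mod V f"
    then have "x 0 \<in> ann V f" by (auto simp: ann_mod_def ann_def free_mod_def)
    then obtain u where u: "u \<in> free_mod V (F 1)" "x 0 = \<epsilon> u" using res(2) by blast
    have "x = \<epsilon>' u" using x u(2) by (auto simp: \<epsilon>'_def ann_mod_def free_mod_def fun_eq_iff)
    then show "x \<in> \<phi> 1 ` free_mod V (a 1)" using u(1) by (auto simp: a_def \<phi>_def)
  qed
  have img: "\<phi> (Suc i) ` free_mod_deg V (a (Suc i)) e = ker_deg V (a i) (\<phi> i) e" for i e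
  proof (cases i)
    case 0
    have "ann_mod V f \<subseteq> free_mod V (a 0)" by (auto simp: ann_mod_def a_def)
    then have "\<forall>e. \<phi> 1 ` free_mod_deg V (a 1) e = {w \<in> free_mod_deg V (a 0) e. w \<in> ann_mod V f}"
      using image_iff_graded[of V "a 1" "a 0" "\<phi> 1" "ann_mod V f"] hom[of 0] ann_mod_closed[OF f(2)] exact0
      by (simp add: a_def)
    then show ?thesis using 0 by (simp add: a_def \<phi>_def ker_deg_act_on)
  next
    case (Suc i')
    let ?K = "{u \<in> free_mod V (a i). \<phi> i u = 0}"
    have K: "mulk.subspace ?K" "\<And>u e. u \<in> ?K \<Longrightarrow> hcomp (a i) e u \<in> ?K"
      using kernel_closed[OF hom[of i']] unfolding Suc by blast+
    have "\<phi> (Suc i) ` free_mod V (a (Suc i)) = ?K" using exact[of i'] unfolding Suc .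
    then have "\<forall>e. \<phi> (Suc i) ` free_mod_deg V (a (Suc i)) e = {w \<in> free_mod_deg V (a i) e. w \<in> ?K}"
      using image_iff_graded[OF hom[of i] K(1) _ K(2)] by blast
    then show ?thesis by (auto simp: ker_deg_def free_mod_deg_free_mod)
  qed
  have "ker_deg V (a i) (\<phi> i) e \<subseteq> max_free_mod V (a i)" for i e
  proof (cases i)
    case 0
    then show ?thesis using ker_act_on_max[OF f(1), of V e] by (simp add: a_def \<phi>_def)
  next
    case (Suc i')
    have "ker_deg V (a i) (\<phi> i) e \<subseteq> {u \<in> free_mod V (a i). \<phi> i u = 0}"
      by (auto simp: ker_deg_def free_mod_deg_free_mod)
    also have "\<dots> = \<delta> i ` free_mod V (F (i + 1))" using exact[of i'] Suc by (simp add: a_def \<phi>_def)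
    also have "\<dots> \<subseteq> max_free_mod V (a i)" using res(6)[of i] Suc by (simp add: a_def)
    finally show ?thesis .
  qed
  moreover have "free_cover V mulX (a (Suc i)) (\<phi> (Suc i)) (ker_deg V (a i) (\<phi> i))" for i
    by (rule free_cover_graded_hom[OF V hom img])
  ultimately have "res_seq V f a \<phi>" unfolding res_seq_def by (auto simp: a_def \<phi>_def)
  moreover have "a = (\<lambda>i. if i = 0 then [0] else F i)" by (simp add: a_def fun_eq_iff)
  ultimately show ?thesis by blast
qed

lemma free_mod_deg_mult:
  assumes "p \<in> in_vars V" "p \<in> homog e'" "u \<in> free_mod_deg V a e"
  shows "(\<lambda>l. p * u l) \<in> free_mod_deg V a (e' + e)"
proof (rule free_mod_degI)
  fix l assume "l < length a"
  then have "p * u l \<in> homog (e' + (e - a ! l))" using free_mod_degD(3)[OF assms(3)] assms(2) by (intro homog_mult)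
  then show "p * u l \<in> homog (e' + e - a ! l)" by (simp add: algebra_simps)
qed (use assms in \<open>auto intro!: in_vars_mult free_mod_degD(1)[OF assms(3)] simp: free_mod_degD(2)[OF assms(3)]\<close>)

text \<open>
  The kernels remain graded submodules, and by the dimension shift their \<open>H\<^sub>0\<close> is the homology of the inverse
  system in the next Koszul degree, hence finite dimensional. So minimal covers can be chosen one after another.
\<close>

lemma exists_res_seq:
  fixes f :: "'k::field dpoly"
  assumes V: "finite V" and f: "f \<noteq> 0"
    and \<beta>: "\<And>k j. has_betti (pointwise smul) conX V (inv_sys V f) k j (\<beta> k j)"
    and J: "finite J" "\<And>k j. j \<notin> J \<Longrightarrow> \<beta> k j = 0"
  shows "\<exists>a \<phi>. res_seq V f a \<phi> \<and> (\<forall>i. graded_hom V (a (Suc i)) (a i) (\<phi> (Suc i)))"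
proof -
  define N where "N x = ker_deg V (fst x) (snd x)" for x :: "int list \<times> ((nat \<Rightarrow> 'k mpoly) \<Rightarrow> nat \<Rightarrow> 'k mpoly)"
  define P where "P n x \<longleftrightarrow> (n = 0 \<longrightarrow> x = ([0], act_on f)) \<and> (\<forall>e. mulk.subspace (N x e)) \<and>
     (\<forall>e e' p u. p \<in> in_vars V \<longrightarrow> p \<in> homog e' \<longrightarrow> u \<in> N x e \<longrightarrow> (\<lambda>l. p * u l) \<in> N x (e' + e)) \<and>
     (\<forall>e. N x e \<subseteq> max_free_mod V (fst x)) \<and>
     (\<forall>k j m. has_betti (pointwise smul) mulX V (N x) k j m \<longleftrightarrow>
        has_betti (pointwise smul) conX V (inv_sys V f) (k + n + 1) (j - int n - 1) m)" for n x
  define Q where "Q x y \<longleftrightarrow> graded_hom V (fst y) (fst x) (snd y) \<and> free_cover V mulX (fst y) (snd y) (N x)"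
    for x y :: "int list \<times> ((nat \<Rightarrow> 'k mpoly) \<Rightarrow> nat \<Rightarrow> 'k mpoly)"
  have c0: "free_cover V conX [0] (act_on f) (inv_sys V f)" by (rule free_cover_inv_sys[OF V])
  have base: "P 0 ([0], act_on f)"
    unfolding P_def N_def fst_conv snd_conv
  proof (intro conjI allI impI)
    show "mulk.subspace (ker_deg V [0] (act_on f) e)" for e by (rule free_cover.subspace_N[OF c0])
    show "ker_deg V [0] (act_on f) e \<subseteq> max_free_mod V [0]" for e by (rule ker_act_on_max[OF f])
    show "(\<lambda>l. p * u l) \<in> ker_deg V [0] (act_on f) (e' + e)"
      if "p \<in> in_vars V" "p \<in> homog e'" "u \<in> ker_deg V [0] (act_on f) e" for p u e e'
    proof -
      have "contract (p * u 0) f = 0"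
        using that(3) unfolding contract_mult by (simp add: ker_deg_def act_on_eq_0_iff)
      then show ?thesis using that free_mod_deg_mult[OF that(1,2)] by (simp add: ker_deg_def act_on_eq_0_iff)
    qed
    show "has_betti (pointwise smul) mulX V (ker_deg V [0] (act_on f)) k j m \<longleftrightarrow>
        has_betti (pointwise smul) conX V (inv_sys V f) (k + 0 + 1) (j - int 0 - 1) m" for k j m
      using free_cover.has_betti_shift[OF c0 ker_act_on_max[OF f], of k "j - 1" m] by (simp del: pointwise_apply)
  qed simp
  have step: "\<exists>y. P (Suc n) y \<and> Q x y" if Px: "P n x" for n x
  proof -
    have Psub: "\<And>e. mulk.subspace (N x e)"
      and Pmul: "\<And>e e' p u. p \<in> in_vars V \<Longrightarrow> p \<in> homog e' \<Longrightarrow> u \<in> N x e \<Longrightarrow> (\<lambda>l. p * u l) \<in> N x (e' + e)"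
      and Pb: "\<And>k j m. has_betti (pointwise smul) mulX V (N x) k j m \<longleftrightarrow>
        has_betti (pointwise smul) conX V (inv_sys V f) (k + n + 1) (j - int n - 1) m"
      using Px unfolding P_def by auto
    have b0: "has_betti (pointwise smul) mulX V (N x) 0 j (\<beta> (n + 1) (j - int n - 1))" for j
      using Pb[of 0 j] \<beta>[of "n + 1" "j - int n - 1"] by (simp del: pointwise_apply)
    have fin: "\<beta> (n + 1) (j - int n - 1) = 0" if "j \<notin> (\<lambda>i. i + int n + 1) ` J" for j
      using that by (intro J(2)) (auto simp: image_iff algebra_simps)
    have NF: "N x e \<subseteq> free_mod_deg V (fst x) e" for e by (auto simp: N_def ker_deg_def)
    obtain a \<phi> where a: "graded_hom V a (fst x) \<phi>" "free_cover V mulX a \<phi> (N x)"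
        "\<And>e. ker_deg V a \<phi> e \<subseteq> max_free_mod V a"
      using exists_minimal_cover[OF V Psub NF Pmul b0 finite_imageI[OF J(1)] fin] by blast
    have "P (Suc n) (a, \<phi>)"
      unfolding P_def N_def fst_conv snd_conv
    proof (intro conjI allI impI)
      show "mulk.subspace (ker_deg V a \<phi> e)" for e by (rule free_cover.subspace_N[OF a(2)])
      show "ker_deg V a \<phi> e \<subseteq> max_free_mod V a" for e by (rule a(3))
      show "(\<lambda>l. p * u l) \<in> ker_deg V a \<phi> (e' + e)"
        if "p \<in> in_vars V" "p \<in> homog e'" "u \<in> ker_deg V a \<phi> e" for p u e e'
      proof -
        have uF: "u \<in> free_mod_deg V a e" "\<phi> u = 0" using that(3) by (auto simp: ker_deg_def)
        have "\<phi> (\<lambda>l. p * u l) = (\<lambda>l. p * \<phi> u l)"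
          by (rule graded_homD(3)[OF a(1) that(1) free_mod_deg_free_mod[OF uF(1)]])
        also have "\<dots> = 0" using uF(2) by (simp add: fun_eq_iff)
        finally show ?thesis using free_mod_deg_mult[OF that(1,2) uF(1)] by (simp add: ker_deg_def)
      qed
      show "has_betti (pointwise smul) mulX V (ker_deg V a \<phi>) k j m \<longleftrightarrow>
          has_betti (pointwise smul) conX V (inv_sys V f) (k + Suc n + 1) (j - int (Suc n) - 1) m" for k j m
        using free_cover.has_betti_shift[OF a(2) a(3), of k "j - 1" m] Pb[of "Suc k" "j - 1" m]
        by (simp add: algebra_simps del: pointwise_apply)
    qed simp
    moreover have "Q x (a, \<phi>)" using a by (simp add: Q_def)
    ultimately show ?thesis by blast
  qed
  obtain x where x: "\<And>n. P n (x n)" "\<And>n. Q (x n) (x (Suc n))"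
    using dependent_nat_choice[of P "\<lambda>_. Q"] base step by metis
  have "res_seq V f (\<lambda>i. fst (x i)) (\<lambda>i. snd (x i))"
    using x unfolding res_seq_def P_def Q_def N_def by auto
  moreover have "graded_hom V (fst (x (Suc i))) (fst (x i)) (snd (x (Suc i)))" for i
    using x(2)[of i] by (simp add: Q_def)
  ultimately show ?thesis by blast
qed

lemma resolution_of_res_seq:
  fixes f :: "'k::field dpoly"
  assumes V: "finite V" and f: "f \<in> homog d" and r: "res_seq V f a \<phi>"
    and hom: "\<And>i. graded_hom V (a (Suc i)) (a i) (\<phi> (Suc i))"
    and fin: "\<And>i. i > n \<Longrightarrow> a i = []"
  shows "graded_min_free_res V n (ann V f) a (\<lambda>i. \<phi> (Suc i)) (\<lambda>u. \<phi> 1 u 0)"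
proof -
  have a0: "a 0 = [0]" "\<phi> 0 = act_on f" using r by (auto simp: res_seq_def)
  have img: "\<phi> (Suc i) ` free_mod_deg V (a (Suc i)) e = ker_deg V (a i) (\<phi> i) e" for i e
    using r free_cover.image unfolding res_seq_def by blast
  have max: "ker_deg V (a i) (\<phi> i) e \<subseteq> max_free_mod V (a i)" for i e using r by (simp add: res_seq_def)
  have exact: "\<phi> (Suc (Suc i)) ` free_mod V (a (Suc (Suc i))) = {u \<in> free_mod V (a (Suc i)). \<phi> (Suc i) u = 0}" for i
  proof -
    have "\<forall>e. \<phi> (Suc (Suc i)) ` free_mod_deg V (a (Suc (Suc i))) e =
        {w \<in> free_mod_deg V (a (Suc i)) e. w \<in> {u \<in> free_mod V (a (Suc i)). \<phi> (Suc i) u = 0}}"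
      using img[of "Suc i"] by (auto simp: ker_deg_def free_mod_deg_free_mod)
    then show ?thesis
      using image_iff_graded[OF hom[of "Suc i"] kernel_closed(1)[OF hom[of i]] _ kernel_closed(2)[OF hom[of i]]]
      by blast
  qed
  have exact0: "\<phi> 1 ` free_mod V (a 1) = ann_mod V f"
  proof -
    have "ann_mod V f \<subseteq> free_mod V (a 0)" by (auto simp: ann_mod_def a0)
    moreover have "\<forall>e. \<phi> 1 ` free_mod_deg V (a 1) e = {w \<in> free_mod_deg V (a 0) e. w \<in> ann_mod V f}"
      using img[of 0] by (simp add: a0 ker_deg_act_on)
    ultimately show ?thesis
      using image_iff_graded[of V "a 1" "a 0" "\<phi> 1" "ann_mod V f"] hom[of 0] ann_mod_closed[OF f]
      by (simp add: a0)
  qed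
  have low: "\<phi> 1 u l = 0" if "u \<in> free_mod V (a 1)" "l \<noteq> 0" for u l
    using graded_homD(1)[OF hom[of 0]] that by (simp add: free_mod_def a0)
  have \<epsilon>: "(\<lambda>l. if l = 0 then \<phi> 1 u 0 else 0) = \<phi> 1 u" if "u \<in> free_mod V (a 1)" for u
    using low[OF that] by (auto simp: fun_eq_iff)
  have h1: "graded_hom V (a 1) [0] (\<lambda>u l. if l = 0 then \<phi> 1 u 0 else 0)"
    using hom[of 0] by (intro graded_hom_cong[OF _ \<epsilon>]) (simp add: a0)
  have im1: "(\<lambda>u. \<phi> 1 u 0) ` free_mod V (a 1) = ann V f"
  proof -
    have "(\<lambda>u. \<phi> 1 u 0) ` free_mod V (a 1) = (\<lambda>x. x 0) ` ann_mod V f"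
      unfolding exact0[symmetric] by (simp add: image_image)
    also have "\<dots> = ann V f"
    proof (intro equalityI subsetI)
      fix D assume D: "D \<in> ann V f"
      then have "(\<lambda>l. if l = 0 then D else 0) \<in> ann_mod V f" by (auto simp: ann_mod_def ann_def free_mod_def)
      then show "D \<in> (\<lambda>x. x 0) ` ann_mod V f" by (rule rev_image_eqI) simp
    qed (auto simp: ann_mod_def ann_def free_mod_def)
    finally show ?thesis .
  qed
  have min: "\<phi> (Suc i) ` free_mod V (a (Suc i)) \<subseteq> max_free_mod V (a i)" if i1: "i \<ge> 1" for i
  proof
    fix w assume "w \<in> \<phi> (Suc i) ` free_mod V (a (Suc i))"
    moreover obtain i' where i': "i = Suc i'" using i1 by (cases i) auto
    ultimately have w: "w \<in> {u \<in> free_mod V (a i). \<phi> i u = 0}" using exact[of i'] by simp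
    have "hcomp (a i) e w \<in> max_free_mod V (a i)" for e
    proof -
      have "hcomp (a i) e w \<in> ker_deg V (a i) (\<phi> i) e"
        using w kernel_closed(2)[OF hom[of i'], of w e] hcomp_in_free_mod_deg[of w V "a i" e] i'
        by (simp add: ker_deg_def)
      then show ?thesis using max by blast
    qed
    then have z: "lk (hcomp (a i) e w l) 0 = 0" for e l by (simp add: max_free_mod_def)
    have "lk (w l) 0 = 0" if "l < length (a i)" for l
      using z[of "a i ! l" l] that by (simp add: hcomp_def)
    moreover have "lk (w l) 0 = 0" if "\<not> l < length (a i)" for l using w that by (simp add: free_mod_def)
    ultimately have "lk (w l) 0 = 0" for l by blast
    then show "w \<in> max_free_mod V (a i)" using w by (simp add: max_free_mod_def)
  qed
  have k1: "{u \<in> free_mod V (a 1). \<phi> 1 u 0 = 0} = {u \<in> free_mod V (a 1). \<phi> 1 u = 0}"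
    using \<epsilon> by (auto simp: fun_eq_iff) (metis low not_gr_zero)
  show ?thesis
    unfolding graded_min_free_res_def
  proof (intro conjI allI impI)
    show "{u \<in> free_mod V (a 1). \<phi> 1 u 0 = 0} = \<phi> (Suc 1) ` free_mod V (a 2)"
      unfolding k1 using exact[of 0] by (simp add: numeral_2_eq_2)
    fix i :: nat assume i: "1 \<le> i"
    show "graded_hom V (a (i + 1)) (a i) (\<phi> (Suc i))" using hom[of i] by simp
    show "{u \<in> free_mod V (a (i + 1)). \<phi> (Suc i) u = (\<lambda>l. 0)} = \<phi> (Suc (i + 1)) ` free_mod V (a (i + 2))"
      using exact[of i] by (simp add: zero_fun_def)
    show "\<phi> (Suc i) ` free_mod V (a (i + 1)) \<subseteq> max_free_mod V (a i)" using min[OF i] by simp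
  qed (use fin h1 im1 in auto)
qed

section \<open>The inverse system of a form\<close>

definition emb :: "'k::field mpoly \<Rightarrow> nat \<Rightarrow> 'k mpoly" where
  "emb p = (\<lambda>l. if l = 0 then p else 0)"

lemma emb_simps: "emb p = emb q \<longleftrightarrow> p = q" "emb p = 0 \<longleftrightarrow> p = 0"
  "conX v (emb p) = emb (contract (var v) p)" "pointwise smul c (emb p) = emb (smul c p)"
  "emb p + emb q = emb (p + q)"
  by (auto simp: emb_def fun_eq_iff conX_def smul_def)

lemma emb_sum: "(\<Sum>i\<in>A. emb (f i)) = emb (sum f A)"
  by (auto simp: emb_def fun_eq_iff sum_fun_apply)

lemma mem_inv_sys:
  "x \<in> inv_sys V f e \<longleftrightarrow> (\<exists>D. D \<in> in_vars V \<and> D \<in> homog e \<and> x = emb (contract D f))"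
proof
  assume "x \<in> inv_sys V f e"
  then obtain u where u: "u \<in> free_mod_deg V [0] e" "x = act_on f u" by (auto simp: inv_sys_def)
  then show "\<exists>D. D \<in> in_vars V \<and> D \<in> homog e \<and> x = emb (contract D f)"
    using free_mod_degD(1)[OF u(1), of 0] free_mod_degD(3)[OF u(1), of 0]
    by (intro exI[of _ "u 0"]) (auto simp: act_on_def emb_def)
next
  assume "\<exists>D. D \<in> in_vars V \<and> D \<in> homog e \<and> x = emb (contract D f)"
  then obtain D where D: "D \<in> in_vars V" "D \<in> homog e" "x = emb (contract D f)" by blast
  have "emb D \<in> free_mod_deg V [0] e" using D by (intro free_mod_degI) (auto simp: emb_def)
  moreover have "act_on f (emb D) = x" using D(3) by (auto simp: act_on_def emb_def)
  ultimately show "x \<in> inv_sys V f e" by (auto simp: inv_sys_def)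
qed

text \<open>
  The coefficients embed this space into the functions on the finite set of monomials of degree at most \<open>e\<close>.
\<close>

lemma fin_dim_homog:
  assumes "finite V" shows "fin_dim smul (in_vars V \<inter> homog e :: 'k::field mpoly set)"
proof -
  interpret K: vector_space "(*) :: 'k \<Rightarrow> 'k \<Rightarrow> 'k"
    by unfold_locales (auto simp: algebra_simps)
  interpret KK: vector_space "pointwise (*) :: 'k \<Rightarrow> (expo \<Rightarrow> 'k) \<Rightarrow> expo \<Rightarrow> 'k"
    by (rule vector_space_pointwise) unfold_locales
  interpret pr: vector_space_pair "smul :: 'k \<Rightarrow> 'k mpoly \<Rightarrow> _" "pointwise (*) :: 'k \<Rightarrow> (expo \<Rightarrow> 'k) \<Rightarrow> expo \<Rightarrow> 'k" ..
  define S where "S = {m :: expo. ks m \<subseteq> V \<and> mdeg m \<le> nat e}"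
  define P where "P = {p :: 'k mpoly. ks p \<subseteq> S}"
  have fS: "finite S" unfolding S_def by (rule finite_monomials[OF assms])
  have P_iff: "p \<in> P \<longleftrightarrow> (\<forall>m. m \<notin> S \<longrightarrow> lk p m = 0)" for p by (auto simp: P_def in_keys_iff)
  have sP: "mp.subspace P" by (rule mp.subspaceI) (auto simp: P_iff lookup_add)
  note q = qdim_coefficients[OF fS, where 'k = 'k]
  have "qdim smul P {0} (card S) \<longleftrightarrow> qdim (pointwise (*)) (supported S (UNIV :: 'k set)) {0} (card S)"
  proof (rule pr.qdim_transport[where L = lk])
    show "mp.subspace P" by (rule sP)
    show "KK.subspace {0}" by (rule KK.subspace_single_0)
    show "{0} \<subseteq> supported S (UNIV :: 'k set)" by (auto simp: supported_def)
    show "lk (x + y) = lk x + lk y" for x y :: "'k mpoly" by (simp add: fun_eq_iff lookup_add)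
    show "lk (smul c x) = pointwise (*) c (lk x)" for c and x :: "'k mpoly" by (simp add: fun_eq_iff)
    show "lk ` P = supported S UNIV"
    proof (intro equalityI subsetI)
      fix h :: "expo \<Rightarrow> 'k" assume h: "h \<in> supported S UNIV"
      define p where "p = (\<Sum>m\<in>S. Poly_Mapping.single m (h m))"
      have "lk p m = h m" for m
        using h fS by (auto simp: p_def lookup_sum lookup_single when_def supported_def)
      then show "h \<in> lk ` P" using h by (intro image_eqI[of _ _ p]) (auto simp: P_iff supported_def)
    qed (auto simp: P_iff supported_def)
    show "{0} = {p \<in> P. lk p \<in> {0}}" using mp.subspace_0[OF sP] by (auto intro: poly_mapping_eqI)
  qed
  then have "fin_dim smul P" using q unfolding fin_dim_def by blast
  moreover have "mp.subspace (in_vars V \<inter> homog e :: 'k mpoly set)"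
    by (rule mp.subspaceI) (auto intro: in_vars_add homog_add in_vars_smul homog_smul)
  moreover have "(in_vars V \<inter> homog e :: 'k mpoly set) \<subseteq> P"
  proof
    fix p :: "'k mpoly" assume p: "p \<in> in_vars V \<inter> homog e"
    have "m \<in> S" if "lk p m \<noteq> 0" for m
    proof -
      have "ks m \<subseteq> V" "int (mdeg m) = e" using p that by (auto simp: in_vars_iff homog_iff)
      then show ?thesis by (auto simp: S_def)
    qed
    then show "p \<in> P" by (auto simp: P_iff)
  qed
  ultimately show ?thesis by (rule mp.fin_dim_mono)
qed

lemma keys_expo_empty: "ks (m :: expo) = {} \<longleftrightarrow> m = 0"
proof
  assume "ks m = {}"
  then have "lk m i = 0" for i by (auto simp: set_eq_iff in_keys_iff)
  then show "m = 0" by (intro poly_mapping_eqI) simp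
qed simp

text \<open>
  If \<open>f\<close> involves only the variables \<open>V\<close>, an exponent with a variable outside \<open>V\<close> contracts \<open>f\<close> to \<open>0\<close>.
\<close>

lemma contract_filter:
  assumes "f \<in> in_vars V" shows "contract (pfilter (\<lambda>m. ks m \<subseteq> V) D) f = contract D f"
proof (rule poly_mapping_eqI)
  fix m
  have sub: "ks (pfilter (\<lambda>m. ks m \<subseteq> V) D) \<subseteq> ks D" by (auto simp: in_keys_iff split: if_splits)
  have "lk (contract (pfilter (\<lambda>m. ks m \<subseteq> V) D) f) m =
      (\<Sum>\<beta>\<in>ks D. lk (pfilter (\<lambda>m. ks m \<subseteq> V) D) \<beta> * lk f (\<beta> + m))"
    by (rule lookup_contract_superset[OF _ sub]) simp
  also have "\<dots> = (\<Sum>\<beta>\<in>ks D. lk D \<beta> * lk f (\<beta> + m))"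
  proof (intro sum.cong refl)
    fix \<beta> show "lk (pfilter (\<lambda>m. ks m \<subseteq> V) D) \<beta> * lk f (\<beta> + m) = lk D \<beta> * lk f (\<beta> + m)"
    proof (cases "lk f (\<beta> + m) = 0")
      case False
      then have "ks (\<beta> + m) \<subseteq> V" using assms by (simp add: in_vars_iff)
      then show ?thesis by (simp add: keys_expo_add)
    qed simp
  qed
  finally show "lk (contract (pfilter (\<lambda>m. ks m \<subseteq> V) D) f) m = lk (contract D f) m"
    by (simp add: lookup_contract)
qed

lemma filter_in_vars: "pfilter (\<lambda>m. ks m \<subseteq> V) D \<in> in_vars V"
  by (auto simp: in_vars_iff)

lemma inv_sys_mono:
  assumes "f \<in> in_vars V" "V \<subseteq> U" shows "inv_sys U f = inv_sys V f"
proof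
  fix e show "inv_sys U f e = inv_sys V f e"
  proof (intro equalityI subsetI)
    fix x assume "x \<in> inv_sys U f e"
    then obtain D where "D \<in> homog e" "x = emb (contract D f)" by (auto simp: mem_inv_sys)
    then show "x \<in> inv_sys V f e"
      unfolding mem_inv_sys using contract_filter[OF assms(1), of D] filter_in_vars homog_pfilter by metis
  next
    fix x assume "x \<in> inv_sys V f e"
    then show "x \<in> inv_sys U f e" using in_vars_mono[OF assms(2)] by (auto simp: mem_inv_sys)
  qed
qed

lemma contract_disjoint_vars:
  assumes "D \<in> in_vars V" "D \<in> homog j" "j \<noteq> 0" "h \<in> in_vars W" "V \<inter> W = {}"
  shows "contract D h = 0"
proof (rule poly_mapping_eqI)
  fix m
  have "lk D \<beta> * lk h (\<beta> + m) = 0" for \<beta>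
  proof (rule ccontr)
    assume "lk D \<beta> * lk h (\<beta> + m) \<noteq> 0"
    then have "lk D \<beta> \<noteq> 0" "lk h (\<beta> + m) \<noteq> 0" by auto
    then have "ks \<beta> \<subseteq> V" "ks (\<beta> + m) \<subseteq> W" "int (mdeg \<beta>) = j"
      using assms by (simp_all add: in_vars_iff homog_iff)
    then have "\<beta> = 0" "int (mdeg \<beta>) = j"
      using assms(5) unfolding keys_expo_add keys_expo_empty[symmetric] by blast+
    then show False using assms(3) by simp
  qed
  then show "lk (contract D h) m = lk 0 m" unfolding lookup_contract by (simp only: sum.neutral_const lookup_zero)
qed

lemma in_vars_disjoint_0:
  assumes "p \<in> in_vars V" "p \<in> in_vars W" "p \<in> homog j" "j \<noteq> 0" "V \<inter> W = {}"
  shows "p = (0 :: 'k::field mpoly)"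
proof (rule poly_mapping_eqI)
  fix m
  have "lk p m = 0"
  proof (rule ccontr)
    assume "lk p m \<noteq> 0"
    then have "ks m \<subseteq> V" "ks m \<subseteq> W" "int (mdeg m) = j"
      using assms by (auto simp: in_vars_iff homog_iff)
    then have "m = 0" "int (mdeg m) = j"
      using assms(5) unfolding keys_expo_empty[symmetric] by blast+
    then show False using assms(4) by simp
  qed
  then show "lk p m = lk 0 m" by simp
qed

lemma mdeg_1E:
  assumes "mdeg m = 1" obtains v where "m = unit_exp v" "v \<in> ks m"
proof -
  have "m \<noteq> 0" using assms by auto
  then obtain v where v: "v \<in> ks m" using keys_expo_empty by blast
  have "m = unit_exp v + (m - unit_exp v)" using expo_minus_plus[OF v] by simp
  moreover from this have "mdeg (m - unit_exp v) = 0"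
    using assms mdeg_add[of "unit_exp v" "m - unit_exp v"] by simp
  ultimately have "m = unit_exp v" by (simp add: mdeg_eq_0_iff)
  then show ?thesis using that v by blast
qed

lemma homog_1_eqI:
  assumes "p \<in> in_vars V \<inter> homog 1" "q \<in> in_vars V \<inter> homog 1"
    "\<And>v. v \<in> V \<Longrightarrow> lk p (unit_exp v) = lk q (unit_exp v)"
  shows "p = (q :: 'k::field mpoly)"
proof (rule poly_mapping_eqI)
  fix m
  show "lk p m = lk q m"
  proof (cases "mdeg m = 1 \<and> ks m \<subseteq> V")
    case True
    then obtain v where "m = unit_exp v" "v \<in> ks m" using mdeg_1E by blast
    then show ?thesis using assms(3) True by auto
  next
    case False
    then have "lk p m = 0" "lk q m = 0" using assms(1,2) by (auto simp: in_vars_iff homog_iff)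
    then show ?thesis by simp
  qed
qed

text \<open>
  The values \<open>(\<phi>\<^sub>i p)\<^sub>i\<close> form a subspace of the coordinate space of \<open>A\<close>. If its dimension were smaller than
  \<open>card A\<close>, the equations \<open>\<Sum>\<^sub>i c\<^sub>i z\<^sub>i = 0\<close> for \<open>z\<close> in a basis of it would have a nontrivial solution \<open>c\<close>, a relation
  between the functionals.
\<close>

lemma (in vector_space) dual_vectors:
  fixes \<phi> :: "'i \<Rightarrow> 'b \<Rightarrow> 'a"
  assumes A: "finite A" and P: "subspace P"
    and add: "\<And>i p q. p \<in> P \<Longrightarrow> q \<in> P \<Longrightarrow> \<phi> i (p + q) = \<phi> i p + \<phi> i q"
    and scale: "\<And>i c p. p \<in> P \<Longrightarrow> \<phi> i (c *s p) = c * \<phi> i p"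
    and ind: "\<And>c i. (\<And>p. p \<in> P \<Longrightarrow> (\<Sum>i\<in>A. c i * \<phi> i p) = 0) \<Longrightarrow> i \<in> A \<Longrightarrow> c i = 0"
  shows "\<exists>y. \<forall>i\<in>A. y i \<in> P \<and> (\<forall>j\<in>A. \<phi> j (y i) = (if j = i then 1 else 0))"
proof -
  interpret K: vector_space "(*) :: 'a \<Rightarrow> 'a \<Rightarrow> 'a"
    by unfold_locales (auto simp: algebra_simps)
  interpret KK: vector_space "pointwise (*) :: 'a \<Rightarrow> ('i \<Rightarrow> 'a) \<Rightarrow> 'i \<Rightarrow> 'a"
    by (rule vector_space_pointwise) unfold_locales
  define L where "L p = (\<lambda>i. if i \<in> A then \<phi> i p else 0)" for p
  let ?S = "supported A (UNIV :: 'a set)"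
  have L_add: "L (p + q) = L p + L q" if "p \<in> P" "q \<in> P" for p q
    using add[OF that] by (auto simp: L_def fun_eq_iff)
  have L_scale: "L (c *s p) = pointwise (*) c (L p)" if "p \<in> P" for c p
    using scale[OF that] by (auto simp: L_def fun_eq_iff)
  have L_S: "L ` P \<subseteq> ?S" by (auto simp: L_def supported_def)
  have LP: "KK.subspace (L ` P)"
  proof (rule KK.subspaceI)
    have "L 0 = 0" using scale[OF subspace_0[OF P], of _ 0] by (auto simp: L_def fun_eq_iff)
    then show "0 \<in> L ` P" using subspace_0[OF P] by (metis imageI)
    show "x + y \<in> L ` P" if "x \<in> L ` P" "y \<in> L ` P" for x y
      using that by (auto simp: L_add[symmetric] subspace_add[OF P])
    show "pointwise (*) c x \<in> L ` P" if "x \<in> L ` P" for c x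
      using that by (auto simp: L_scale[symmetric] subspace_scale[OF P])
  qed
  note q = qdim_coefficients[OF A, where 'k = 'a]
  have zero: "{0} \<subseteq> L ` P" using KK.subspace_0[OF LP] by simp
  obtain n where n: "qdim (pointwise (*)) (L ` P) {0} n"
    using KK.qdim_mono(1)[OF q LP zero L_S] by blast
  then obtain z where z: "qbasis (pointwise (*)) (L ` P) {0} {..<n} z" by (auto simp: qdim_def)
  have "card A \<le> n"
  proof (rule ccontr)
    assume "\<not> card A \<le> n"
    then obtain c where c: "\<exists>i\<in>A. c i \<noteq> 0" "\<forall>j<n. (\<Sum>i\<in>A. c i * z j i) = 0"
      using nontrivial_solution[OF A, of n "\<lambda>i j. z j i"] by auto
    have "(\<Sum>i\<in>A. c i * \<phi> i p) = 0" if "p \<in> P" for p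
    proof -
      obtain k where "L p - (\<Sum>j<n. pointwise (*) (k j) (z j)) \<in> {0}"
        using z \<open>p \<in> P\<close> unfolding qbasis_def by blast
      then have "L p = (\<Sum>j<n. pointwise (*) (k j) (z j))" by simp
      then have Lp: "L p i = (\<Sum>j<n. k j * z j i)" for i by (simp add: sum_fun_apply)
      have "(\<Sum>i\<in>A. c i * \<phi> i p) = (\<Sum>i\<in>A. c i * L p i)"
        by (intro sum.cong) (auto simp: L_def)
      also have "\<dots> = (\<Sum>i\<in>A. \<Sum>j<n. k j * (c i * z j i))"
        unfolding Lp sum_distrib_left by (intro sum.cong refl) (rule mult.left_commute)
      also have "\<dots> = (\<Sum>j<n. k j * (\<Sum>i\<in>A. c i * z j i))"
        by (subst sum.swap) (simp add: sum_distrib_left)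
      finally show ?thesis using c(2) by simp
    qed
    then show False using ind c(1) by blast
  qed
  moreover obtain m where m: "qdim (pointwise (*)) ?S (L ` P) m"
    using KK.qdim_mono(2)[OF q LP zero L_S] by blast
  moreover have "m + n = card A" using KK.qdim_unique[OF KK.qdim_trans[OF m n] q] .
  ultimately have "m = 0" by simp
  then have "?S = L ` P" using KK.qdim_0_eq[of ?S "L ` P"] m by simp
  moreover have "(\<lambda>j. if j = i then 1 else 0) \<in> ?S" if "i \<in> A" for i
    using that by (simp add: supported_def)
  ultimately have "\<exists>y\<in>P. L y = (\<lambda>j. if j = i then 1 else 0)" if "i \<in> A" for i
    using that by (metis (no_types, lifting) imageE)
  then obtain y where y: "\<And>i. i \<in> A \<Longrightarrow> y i \<in> P"
      "\<And>i. i \<in> A \<Longrightarrow> L (y i) = (\<lambda>j. if j = i then 1 else 0)" by metis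
  have "\<phi> j (y i) = (if j = i then 1 else 0)" if "i \<in> A" "j \<in> A" for i j
    using fun_cong[OF y(2)[OF that(1)], of j] that(2) by (simp add: L_def)
  then show ?thesis using y(1) by blast
qed

lemma lookup_var: "lk (var u :: 'k::field mpoly) m = (if m = unit_exp u then 1 else 0)"
  by (auto simp: var_def lookup_single when_def)

lemma single_1_eq_iff: "unit_exp u = (unit_exp v :: expo) \<longleftrightarrow> u = v"
  by (metis lookup_single_eq lookup_single_not_eq one_neq_zero)

lemma homog_neg: "p \<in> homog e \<Longrightarrow> e < 0 \<Longrightarrow> p = (0 :: 'k::field mpoly)"
  by (rule poly_mapping_eqI) (force simp: homog_iff)

lemma homog_0_eq: "p \<in> homog 0 \<Longrightarrow> p = smul (lk p 0) (1 :: 'k::field mpoly)"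
  by (rule poly_mapping_eqI) (auto simp: homog_iff mdeg_eq_0_iff lookup_one when_def)

lemma in_vars_1 [simp]: "1 \<in> in_vars V" and homog_0_1: "(1 :: 'k::field mpoly) \<in> homog 0"
  by (auto simp: in_vars_def homog_def)

lemma linear_form:
  fixes c :: "nat \<Rightarrow> 'k::field"
  assumes "finite V"
  defines "q \<equiv> \<Sum>u\<in>V. smul (c u) (var u)"
  shows "q \<in> in_vars V \<inter> homog 1" and "v \<in> V \<Longrightarrow> lk q (unit_exp v) = c v"
    and "contract q f = (\<Sum>u\<in>V. smul (c u) (contract (var u) f))"
proof -
  show "q \<in> in_vars V \<inter> homog 1" unfolding q_def
    by (auto intro!: in_vars_sum homog_sum in_vars_smul homog_smul in_vars_var homog_var)
  show "lk q (unit_exp v) = c v" if "v \<in> V"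
  proof -
    have "lk q (unit_exp v) = (\<Sum>u\<in>V. if u = v then c u else 0)"
      unfolding q_def lookup_sum
      by (intro sum.cong refl) (simp only: lookup_smul lookup_var single_1_eq_iff, auto)
    then show ?thesis using assms(1) that by simp
  qed
  show "contract q f = (\<Sum>u\<in>V. smul (c u) (contract (var u) f))"
    by (simp add: q_def contract_sum_left contract_smul_left)
qed

text \<open>
  The functionals sending an operator \<open>D\<close> of order \<open>d - 1\<close> to the coefficients of the linear form \<open>D f\<close> are
  independent: a relation would give a linear operator \<open>q\<close> with \<open>D (q f) = 0\<close> for all \<open>D\<close> of order \<open>d - 1\<close>, that is,
  \<open>q f = 0\<close>. Operators dual to them produce the variables.
\<close>

lemma linear_forms_are_derivatives:
  fixes f :: "'k::field dpoly"
  assumes V: "finite V" and f: "f \<in> in_vars V" "f \<in> homog (int d)" and ann: "ann V f \<inter> homog 1 = {0}"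
  shows "\<exists>D. \<forall>v\<in>V. D v \<in> in_vars V \<inter> homog (int d - 1) \<and> contract (D v) f = var v"
proof -
  let ?P = "in_vars V \<inter> homog (int d - 1) :: 'k mpoly set"
  have "\<exists>y. \<forall>i\<in>V. y i \<in> ?P \<and>
      (\<forall>j\<in>V. lk (contract (y i) f) (unit_exp j) = (if j = i then 1 else 0))"
  proof (rule mp.dual_vectors[OF V])
    show "mp.subspace ?P"
      by (rule mp.subspaceI) (auto intro: in_vars_add homog_add in_vars_smul homog_smul)
    fix c i
    assume c: "\<And>p. p \<in> ?P \<Longrightarrow> (\<Sum>u\<in>V. c u * lk (contract p f) (unit_exp u)) = 0" and i: "i \<in> V"
    define q where "q = (\<Sum>u\<in>V. smul (c u) (var u))"
    note q = linear_form[OF V, where c = c, folded q_def]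
    have "lk (contract q f) m = 0" for m
    proof (cases "ks m \<subseteq> V \<and> int (mdeg m) = int d - 1")
      case True
      then have "Poly_Mapping.single m 1 \<in> ?P" by (auto simp: in_vars_def homog_def)
      from c[OF this] show ?thesis
        unfolding q(3) by (simp add: lookup_sum lookup_contract_var lookup_contract_single)
    next
      case False
      have "contract q f \<in> in_vars V" "contract q f \<in> homog (int d - 1)"
        using in_vars_contract[OF f(1)] homog_contract[of q 1 f "int d"] q(1) f(2) by auto
      then show ?thesis using False unfolding in_vars_iff homog_iff by blast
    qed
    then have "contract q f = 0" by (intro poly_mapping_eqI) simp
    then have "q \<in> ann V f \<inter> homog 1" using q(1) by (simp add: ann_def)
    then have "q = 0" using ann by simp
    then show "c i = 0" using q(2)[OF i] by simp
  qed (auto simp: contract_add_left contract_smul_left lookup_add)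
  then obtain D where D: "\<And>i. i \<in> V \<Longrightarrow> D i \<in> ?P"
      "\<And>i j. i \<in> V \<Longrightarrow> j \<in> V \<Longrightarrow> lk (contract (D i) f) (unit_exp j) = (if j = i then 1 else 0)"
    by blast
  have "contract (D v) f = var v" if v: "v \<in> V" for v
  proof (rule homog_1_eqI[of _ V])
    have "contract (D v) f \<in> homog (int d - (int d - 1))"
      using D(1)[OF v] f(2) by (intro homog_contract) auto
    then show "contract (D v) f \<in> in_vars V \<inter> homog 1" using in_vars_contract[OF f(1)] by simp
    show "var v \<in> in_vars V \<inter> homog 1" using in_vars_var[OF v] homog_var by blast
    show "lk (contract (D v) f) (unit_exp u) = lk (var v) (unit_exp u)" if "u \<in> V" for u
      using D(2)[OF v that] by (simp only: lookup_var single_1_eq_iff)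
  qed
  then show ?thesis using D(1) by blast
qed

lemma contract_outside_var:
  assumes "p \<in> in_vars V" "w \<notin> V" shows "contract (var w) p = 0"
proof (rule poly_mapping_eqI)
  fix m :: expo
  have "\<not> ks (m + unit_exp w) \<subseteq> V" using assms(2) by (simp add: keys_expo_add)
  then show "lk (contract (var w) p) m = lk 0 m"
    using assms(1) unfolding lookup_contract_var in_vars_iff by (metis lookup_zero)
qed

lemma contract_var_var: "contract (var u) (var v :: 'k::field dpoly) = (if u = v then 1 else 0)"
proof (rule poly_mapping_eqI)
  fix m :: expo
  have "m + unit_exp u = unit_exp v \<longleftrightarrow> u = v \<and> m = 0"
  proof
    assume e: "m + unit_exp u = unit_exp v"
    then have "mdeg m = 0" using mdeg_add[of m "unit_exp u"] by simp
    then have "m = 0" by (simp add: mdeg_eq_0_iff)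
    then show "u = v \<and> m = 0" using e by (simp add: single_1_eq_iff[simplified])
  qed auto
  then show "lk (contract (var u) (var v :: 'k dpoly)) m = lk (if u = v then 1 else 0) m"
    unfolding lookup_contract_var lookup_var by (simp add: lookup_one when_def)
qed

lemma unit_ends_inv_sys:
  fixes f :: "'k::field dpoly"
  assumes U: "finite U" "V \<subseteq> U" and f: "f \<in> in_vars V" "f \<in> homog (int d)" "f \<noteq> 0"
    and ann: "ann V f \<inter> homog 1 = {0}"
  shows "conk.unit_ends V U (inv_sys V f) d"
proof -
  have V: "finite V" using U finite_subset by blast
  have gr: "conk.graded_submodule U (inv_sys V f)"
    using free_cover.graded_submodule_M[OF free_cover_inv_sys[OF U(1)], of f] inv_sys_mono[OF f(1) U(2)] by simp
  have sub: "mulk.subspace (inv_sys V f j)" for j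
    by (rule free_cover.subspace_M[OF free_cover_inv_sys[OF V]])
  have fd: "fin_dim (pointwise smul) (inv_sys V f j)" for j
  proof (rule mulk.fin_dim_mono[OF mp.vdim_supported(1)[OF fin_dim_homog[OF V], of "{0}" "int d - j"] sub])
    show "inv_sys V f j \<subseteq> supported {0} (in_vars V \<inter> homog (int d - j))"
      using in_vars_contract[OF f(1)] homog_contract[OF _ f(2)]
      by (auto simp: mem_inv_sys supported_def emb_def)
  qed simp
  have zero: "inv_sys V f j = {0}" if "j < 0 \<or> int d < j" for j
  proof -
    have "x = 0" if x: "x \<in> inv_sys V f j" for x
    proof -
      obtain D where D: "D \<in> homog j" "x = emb (contract D f)" using x by (auto simp: mem_inv_sys)
      have "contract D f = 0"
        using \<open>j < 0 \<or> int d < j\<close> homog_neg[OF D(1)] homog_neg[OF homog_contract[OF D(1) f(2)]] by auto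
      then show ?thesis using D(2) by (simp add: emb_simps)
    qed
    then show ?thesis using mulk.subspace_0[OF sub] by blast
  qed
  have out: "conX w q = 0" if "w \<in> U - V" "q \<in> inv_sys V f j" for w q j
    using that contract_outside_var[OF in_vars_contract[OF f(1)]] by (auto simp: mem_inv_sys emb_simps)
  have bot: "emb f \<noteq> 0 \<and> inv_sys V f 0 = range (\<lambda>c. pointwise smul c (emb f)) \<and>
      (\<forall>c. (\<Sum>v\<in>V. pointwise smul (c v) (conX v (emb f))) = 0 \<longrightarrow> (\<forall>v\<in>V. c v = 0))"
  proof (intro conjI allI impI ballI)
    show "emb f \<noteq> 0" using f(3) by (simp add: emb_simps)
    show "inv_sys V f 0 = range (\<lambda>c. pointwise smul c (emb f))"
    proof (intro equalityI subsetI)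
      fix x assume "x \<in> inv_sys V f 0"
      then obtain D where D: "D \<in> homog 0" "x = emb (contract D f)" by (auto simp: mem_inv_sys)
      have "contract D f = smul (lk D 0) f"
        using homog_0_eq[OF D(1)] by (metis contract_smul_left contract_one)
      then have "x = pointwise smul (lk D 0) (emb f)" unfolding emb_simps D(2) by simp
      then show "x \<in> range (\<lambda>c. pointwise smul c (emb f))" by blast
    next
      fix x assume "x \<in> range (\<lambda>c. pointwise smul c (emb f))"
      then obtain c where "x = emb (contract (smul c 1) f)"
        by (auto simp: emb_simps contract_smul_left contract_one)
      then show "x \<in> inv_sys V f 0" unfolding mem_inv_sys
        using in_vars_smul[OF in_vars_1] homog_smul[OF homog_0_1] by blast
    qed
    fix c v assume c: "(\<Sum>v\<in>V. pointwise smul (c v) (conX v (emb f))) = 0" and v: "v \<in> V"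
    define q where "q = (\<Sum>u\<in>V. smul (c u) (var u))"
    note q = linear_form[OF V, where c = c, folded q_def]
    have "emb (contract q f) = 0" using c unfolding q(3) emb_simps emb_sum .
    then have "contract q f = 0" by (simp only: emb_simps)
    then have "q \<in> ann V f \<inter> homog 1" using q(1) by (simp add: ann_def)
    then have "q = 0" using ann by simp
    then show "c v = 0" using q(2)[OF v] by simp
  qed
  obtain D where D: "\<And>v. v \<in> V \<Longrightarrow> D v \<in> in_vars V \<inter> homog (int d - 1)"
      "\<And>v. v \<in> V \<Longrightarrow> contract (D v) f = var v"
    using linear_forms_are_derivatives[OF V f(1,2) ann] by blast
  have top: "emb 1 \<noteq> (0 :: nat \<Rightarrow> 'k mpoly) \<and> inv_sys V f (int d) = range (\<lambda>c. pointwise smul c (emb 1)) \<and>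
      (\<forall>v\<in>V. emb (var v) \<in> inv_sys V f (int d - 1) \<and>
        (\<forall>u\<in>U. conX u (emb (var v)) = (if u = v then emb 1 else 0 :: nat \<Rightarrow> 'k mpoly)))"
  proof (intro conjI ballI)
    show "emb 1 \<noteq> (0 :: nat \<Rightarrow> 'k mpoly)" by (simp add: emb_simps)
    show "inv_sys V f (int d) = range (\<lambda>c. pointwise smul c (emb 1))"
    proof (intro equalityI subsetI)
      fix x assume "x \<in> inv_sys V f (int d)"
      then obtain E where E: "E \<in> homog (int d)" "x = emb (contract E f)" by (auto simp: mem_inv_sys)
      have "contract E f \<in> homog 0" using homog_contract[OF E(1) f(2)] by simp
      then show "x \<in> range (\<lambda>c. pointwise smul c (emb 1))"
        using E(2) homog_0_eq[of "contract E f"] by (metis emb_simps(4) rangeI)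
    next
      fix x :: "nat \<Rightarrow> 'k mpoly" assume "x \<in> range (\<lambda>c. pointwise smul c (emb 1))"
      then obtain c where x: "x = emb (smul c 1)" by (auto simp: emb_simps)
      obtain m where m: "lk f m \<noteq> 0" using f(3) by (metis lookup_zero poly_mapping_eqI)
      define E where "E = Poly_Mapping.single m (c / lk f m)"
      have dm: "int (mdeg m) = int d" "ks m \<subseteq> V" using f m by (auto simp: in_vars_iff homog_iff)
      have E: "E \<in> in_vars V" "E \<in> homog (int d)" using dm by (auto simp: E_def in_vars_def homog_def)
      have h: "contract E f \<in> homog 0" using homog_contract[OF E(2) f(2)] by simp
      have "contract E f = smul (lk (contract E f) 0) 1" by (rule homog_0_eq[OF h])
      also have "lk (contract E f) 0 = c" using m by (simp add: E_def lookup_contract_single)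
      finally show "x \<in> inv_sys V f (int d)" unfolding mem_inv_sys x using E by metis
    qed
    fix v assume v: "v \<in> V"
    show "emb (var v) \<in> inv_sys V f (int d - 1)" unfolding mem_inv_sys using D[OF v] by force
    show "conX u (emb (var v)) = (if u = v then emb 1 else 0 :: nat \<Rightarrow> 'k mpoly)" for u
      by (simp add: emb_simps contract_var_var)
  qed
  show ?thesis unfolding conk.unit_ends_def
  proof (intro conjI)
    show "\<forall>j. fin_dim (pointwise smul) (inv_sys V f j)" by (intro allI fd)
    show "\<forall>j. j < 0 \<or> int d < j \<longrightarrow> inv_sys V f j = {0}" by (intro allI impI zero)
    show "\<forall>w\<in>U-V. \<forall>j. \<forall>q\<in>inv_sys V f j. conX w q = 0" by (intro ballI allI) (rule out)
  qed (rule gr, rule exI, rule bot, rule exI, rule exI[of _ "\<lambda>v. emb (var v)"], rule top)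
qed

text \<open>
  Cycles of top Koszul degree are elements of the inverse system that every variable contracts to \<open>0\<close>. Those of
  polynomial degree \<open>d - j > 0\<close> are zero.
\<close>

lemma betti_socle:
  fixes f :: "'k::field dpoly"
  assumes V: "finite V" and f: "f \<in> in_vars V" "f \<in> homog (int d)" "f \<noteq> 0" and ann: "ann V f \<inter> homog 1 = {0}"
    and j: "j < int d"
  shows "conk.betti V (inv_sys V f) (card V) j = 0"
proof -
  have M: "conk.unit_ends V V (inv_sys V f) d" by (rule unit_ends_inv_sys[OF V subset_refl f ann])
  obtain n where n: "has_betti (pointwise smul) conX V (inv_sys V f) (card V) j n"
      "conk.betti V (inv_sys V f) (card V) j = int n"
    using conk.has_betti_number[OF V conk.unit_ends_submodule[OF M] conk.unit_ends_fin_dim[OF M]] by blast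
  have "c = 0" if c: "c \<in> kcycles conX V (card V) (inv_sys V f j)" for c
  proof -
    have ck: "c \<in> kchains V (card V) (inv_sys V f j)" and d0: "kdiff conX V c = 0" using c by (auto simp: kcycles_def)
    have c0: "c J = 0" if "J \<noteq> V" for J
      using that V by (intro kchainsD0[OF ck]) (auto dest: card_subset_eq)
    obtain D where D: "D \<in> homog j" "c V = emb (contract D f)"
      using kchainsD1[OF ck subset_refl refl] by (auto simp: mem_inv_sys)
    define p where "p = contract D f"
    have p: "p \<in> in_vars V" "p \<in> homog (int d - j)"
      using in_vars_contract[OF f(1)] homog_contract[OF D(1) f(2)] by (auto simp: p_def)
    have vp: "contract (var v) p = 0" if v: "v \<in> V" for v
    proof -
      have "V - (V - {v}) = {v}" "insert v (V - {v}) = V" using v by auto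
      then have "kdiff conX V c (V - {v}) = ksgn v (V - {v}) (conX v (c V))" by (simp add: kdiff_def)
      then have "conX v (c V) = 0" using d0 by simp
      then show ?thesis using D(2) by (simp add: emb_simps p_def)
    qed
    have "lk p m = 0" for m
    proof (rule ccontr)
      assume m: "lk p m \<noteq> 0"
      then have "int (mdeg m) = int d - j" "ks m \<subseteq> V" using p by (auto simp: homog_iff in_vars_iff)
      then have "m \<noteq> 0" using j by auto
      then obtain v where v: "v \<in> ks m" using keys_expo_empty by blast
      then have "lk (contract (var v) p) (m - unit_exp v) = lk p m"
        unfolding lookup_contract_var using expo_minus_plus[OF v] by (simp add: add.commute)
      then show False using vp[of v] v \<open>ks m \<subseteq> V\<close> m by auto
    qed
    then have "p = 0" by (intro poly_mapping_eqI) simp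
    then have "c V = 0" using D(2) by (simp add: p_def emb_simps)
    then have "c J = 0" for J using c0 by (cases "J = V") auto
    then show "c = 0" by (simp add: fun_eq_iff)
  qed
  then have "kcycles conX V (card V) (inv_sys V f j) \<subseteq> {0}" by blast
  moreover have q: "qdim (pointwise (pointwise smul)) (kcycles conX V (card V) (inv_sys V f j))
      (kdiff conX V ` kchains V (Suc (card V)) (inv_sys V f (j - 1))) n"
    using n(1) by (simp only: has_betti_def)
  ultimately have "kcycles conX V (card V) (inv_sys V f j) = kdiff conX V ` kchains V (Suc (card V)) (inv_sys V f (j - 1))"
    unfolding qdim_def using mulk.ch.subspace_0 by blast
  then have "n = 0" using q mulk.ch.qdim_refl mulk.ch.qdim_unique unfolding qdim_def by metis
  then show ?thesis using n(2) by simp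
qed

text \<open>
  A positive order operator splits into a part in \<open>V\<close>, a part in \<open>W\<close>, and mixed monomials, which annihilate both \<open>g\<close>
  and \<open>h\<close>; the part in one set of variables annihilates the form in the other.
\<close>

lemma inv_sys_sum:
  fixes g h :: "'k::field dpoly"
  assumes g: "g \<in> in_vars V" and h: "h \<in> in_vars W" and VW: "V \<inter> W = {}" and j: "1 \<le> j"
  shows "inv_sys (V \<union> W) (g + h) j = {a + b |a b. a \<in> inv_sys V g j \<and> b \<in> inv_sys W h j}"
proof (intro equalityI subsetI)
  fix x assume "x \<in> inv_sys (V \<union> W) (g + h) j"
  then obtain D where D: "D \<in> homog j" "x = emb (contract D (g + h))" by (auto simp: mem_inv_sys)
  have "x = emb (contract (pfilter (\<lambda>m. ks m \<subseteq> V) D) g) + emb (contract (pfilter (\<lambda>m. ks m \<subseteq> W) D) h)"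
    using D(2) contract_filter[OF g, of D] contract_filter[OF h, of D] by (simp add: contract_add_right emb_simps)
  moreover have "emb (contract (pfilter (\<lambda>m. ks m \<subseteq> V) D) g) \<in> inv_sys V g j"
    "emb (contract (pfilter (\<lambda>m. ks m \<subseteq> W) D) h) \<in> inv_sys W h j"
    unfolding mem_inv_sys using filter_in_vars homog_pfilter[OF D(1)] by blast+
  ultimately show "x \<in> {a + b |a b. a \<in> inv_sys V g j \<and> b \<in> inv_sys W h j}" by blast
next
  fix x assume "x \<in> {a + b |a b. a \<in> inv_sys V g j \<and> b \<in> inv_sys W h j}"
  then obtain D E where D: "D \<in> in_vars V" "D \<in> homog j" and E: "E \<in> in_vars W" "E \<in> homog j"
    and x: "x = emb (contract D g) + emb (contract E h)" by (auto simp: mem_inv_sys)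
  have "contract D h = 0" "contract E g = 0"
    using contract_disjoint_vars[OF D _ h VW] contract_disjoint_vars[OF E _ g] VW j by auto
  then have "x = emb (contract (D + E) (g + h))"
    by (simp add: x emb_simps contract_add_left contract_add_right)
  moreover have "D + E \<in> in_vars (V \<union> W)" "D + E \<in> homog j"
    using in_vars_mono[of V "V \<union> W" D] in_vars_mono[of W "V \<union> W" E] D E by (auto intro: in_vars_add homog_add)
  ultimately show "x \<in> inv_sys (V \<union> W) (g + h) j" unfolding mem_inv_sys by blast
qed

text \<open>
  If \<open>D g + D h = 0\<close> for a linear operator \<open>D\<close>, both terms vanish: they have positive degree \<open>d - 1\<close> in disjoint
  sets of variables.
\<close>

lemma ann_sum_linear:
  fixes g h :: "'k::field dpoly"
  assumes g: "g \<in> in_vars V" "g \<in> homog (int d)" "ann V g \<inter> homog 1 = {0}"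
    and h: "h \<in> in_vars W" "h \<in> homog (int d)" "ann W h \<inter> homog 1 = {0}"
    and VW: "V \<inter> W = {}" and d: "2 \<le> d"
  shows "ann (V \<union> W) (g + h) \<inter> homog 1 = {0}"
proof -
  have "D = 0" if D: "D \<in> ann (V \<union> W) (g + h) \<inter> homog 1" for D
  proof -
    define D1 where "D1 = pfilter (\<lambda>m. ks m \<subseteq> V) D"
    define D2 where "D2 = pfilter (\<lambda>m. ks m \<subseteq> W) D"
    have c1: "contract D1 g = contract D g" and c2: "contract D2 h = contract D h"
      unfolding D1_def D2_def by (rule contract_filter[OF g(1)], rule contract_filter[OF h(1)])
    have Dh: "D \<in> homog 1" and DU: "D \<in> in_vars (V \<union> W)" and s: "contract D g + contract D h = 0"
      using D by (auto simp: ann_def contract_add_right)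
    have e: "contract D g = - contract D h" using s by (simp add: eq_neg_iff_add_eq_0)
    have n: "- contract D h \<in> in_vars W"
      using in_vars_contract[OF h(1), of D] by (auto simp: in_vars_iff)
    have "contract D g = 0"
    proof (rule in_vars_disjoint_0[OF in_vars_contract[OF g(1)] _ _ _ VW])
      show "contract D g \<in> in_vars W" using n e by simp
      show "contract D g \<in> homog (int d - 1)" by (rule homog_contract[OF Dh g(2)])
    qed (use d in simp)
    then have z: "contract D1 g = 0" "contract D2 h = 0" using c1 c2 e by auto
    have "D1 \<in> ann V g \<inter> homog 1" "D2 \<in> ann W h \<inter> homog 1"
      using z filter_in_vars homog_pfilter[OF Dh] unfolding ann_def D1_def D2_def by blast+
    then have z: "D1 = 0" "D2 = 0" using g(3) h(3) by auto
    show "D = 0"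
    proof (rule poly_mapping_eqI)
      fix m show "lk D m = lk 0 m"
      proof (rule ccontr)
        assume "lk D m \<noteq> lk 0 m"
        then have m: "lk D m \<noteq> 0" by simp
        then have "mdeg m = 1" "ks m \<subseteq> V \<union> W" using Dh DU by (auto simp: homog_iff in_vars_iff)
        then obtain v where v: "m = unit_exp v" "v \<in> V \<union> W" using mdeg_1E by blast
        then have "ks m \<subseteq> V \<or> ks m \<subseteq> W" by auto
        then have "lk D1 m \<noteq> 0 \<or> lk D2 m \<noteq> 0" using m by (auto simp: D1_def D2_def)
        then show False using z by simp
      qed
    qed
  qed
  moreover have "0 \<in> ann (V \<union> W) (g + h) \<inter> homog 1" by (simp add: ann_def)
  ultimately show ?thesis by blast
qed

lemma inv_sys_disjoint:
  fixes g h :: "'k::field dpoly"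
  assumes g: "g \<in> in_vars V" "g \<in> homog (int d)" and h: "h \<in> in_vars W"
    and VW: "V \<inter> W = {}" and j: "j < int d"
  shows "inv_sys V g j \<inter> inv_sys W h j \<subseteq> {0}"
proof
  fix x assume "x \<in> inv_sys V g j \<inter> inv_sys W h j"
  then obtain D E where D: "D \<in> homog j" "x = emb (contract D g)" and E: "x = emb (contract E h)"
    by (auto simp: mem_inv_sys)
  have e: "contract D g = contract E h" using D(2) E by (simp add: emb_simps)
  have "contract D g = 0"
  proof (rule in_vars_disjoint_0[OF in_vars_contract[OF g(1)] _ homog_contract[OF D(1) g(2)] _ VW])
    show "contract D g \<in> in_vars W" unfolding e by (rule in_vars_contract[OF h])
  qed (use j in simp)
  then show "x \<in> {0}" using D(2) by (simp add: emb_simps)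
qed

section \<open>The resolution of the annihilator of a connected sum\<close>

lemma (in koszul) betti_eq_0: "finite V \<Longrightarrow> card V < k \<Longrightarrow> betti V M k j = 0"
  by (simp add: betti_def krank_eq_0 binomial_eq_0)

lemma ann_linear_nonzero:
  assumes "ann V f \<inter> homog 1 = {0}" "v \<in> V" shows "f \<noteq> (0 :: 'k::field dpoly)"
proof
  assume "f = 0"
  moreover have "(var v :: 'k mpoly) \<in> in_vars V" "(var v :: 'k mpoly) \<in> homog 1"
    by (rule in_vars_var[OF assms(2)], rule homog_var)
  ultimately have "(var v :: 'k mpoly) \<in> ann V f \<inter> homog 1" by (simp add: ann_def)
  then have "(var v :: 'k mpoly) = 0" using assms(1) by blast
  then show False using lookup_var[of v "unit_exp v"] by (metis lookup_zero zero_neq_one)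
qed

lemma betti_res_seq:
  assumes V: "finite V" and M: "conk.unit_ends V V (inv_sys V f) d" and r: "res_seq V f a \<phi>"
  shows "conk.betti V (inv_sys V f) i j = int (count (mset (a i)) (int i + j))"
proof -
  obtain n where n: "has_betti (pointwise smul) conX V (inv_sys V f) i j n"
      "conk.betti V (inv_sys V f) i j = int n"
    using conk.has_betti_number[OF V conk.unit_ends_submodule[OF M] conk.unit_ends_fin_dim[OF M]] by blast
  have "n = count (mset (a i)) (int i + j)"
    by (rule mulk.ch.qdim_unique[OF n(1)[unfolded has_betti_def] res_seq_has_betti[OF V r, unfolded has_betti_def]])
  then show ?thesis using n(2) by simp
qed

text \<open>
  Over its own variables, \<open>M\<^sub>g\<close> has the Betti numbers of the given resolution. Those with \<open>i = 0\<close> vanish because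
  \<open>M\<^sub>g\<close> is generated in degree \<open>0\<close>, and those with \<open>i = card V\<close> because \<open>j < d\<close>; this leaves the range of the sum.
\<close>

lemma betti_summand:
  fixes g :: "'k::field dpoly"
  assumes V: "finite V" "finite W" "V \<inter> W = {}" and v: "v \<in> V"
    and g: "g \<in> in_vars V" "g \<in> homog (int d)" and ann: "ann V g \<inter> homog 1 = {0}"
    and res: "graded_min_free_res V n (ann V g) F \<delta> \<epsilon>"
    and j: "1 \<le> j" "j < d"
  shows "conk.betti (V \<union> W) (inv_sys V g) k (int j) =
    (\<Sum>i=1..card V - 1. int (bin (card W) (int k - int i)) * int (shifted_betti F i j))"
proof -
  have g0: "g \<noteq> 0" by (rule ann_linear_nonzero[OF ann v])
  have M: "conk.unit_ends V V (inv_sys V g) d" by (rule unit_ends_inv_sys[OF V(1) subset_refl g g0 ann])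
  obtain \<phi> where "res_seq V g (\<lambda>i. if i = 0 then [0] else F i) \<phi>"
    using res_seq_of_resolution[OF V(1) g0 g(2) res] by blast
  note b = betti_res_seq[OF V(1) M this]
  have b0: "conk.betti V (inv_sys V g) 0 (int j) = 0" using b[of 0 "int j"] j by simp
  have bi: "conk.betti V (inv_sys V g) i (int j) = int (shifted_betti F i j)" if "1 \<le> i" for i
    using b[of i "int j"] that by (simp add: shifted_betti_def)
  have bs: "conk.betti V (inv_sys V g) i (int j) = 0" if "card V \<le> i" for i
  proof (cases "i = card V")
    case True
    then show ?thesis using betti_socle[OF V(1) g g0 ann, of "int j"] j by simp
  next
    case False
    then have "card V < i" using that by simp
    then show ?thesis by (rule conk.betti_eq_0[OF V(1)])
  qed
  have W0: "conX w q = 0" if "w \<in> W" "q \<in> inv_sys V g (int j) \<union> inv_sys V g (int j - 1)" for w q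
  proof -
    have "w \<notin> V" using that(1) V(3) by auto
    then show ?thesis using that(2) contract_outside_var[OF in_vars_contract[OF g(1)]]
      by (auto simp: mem_inv_sys emb_simps)
  qed
  have "conk.betti (V \<union> W) (inv_sys V g) k (int j) =
      (\<Sum>i\<le>k. int (card W choose (k - i)) * conk.betti V (inv_sys V g) i (int j))"
    by (rule conk.betti_zero_variables[OF V conk.unit_ends_fin_dim[OF M] W0])
  also have "\<dots> = (\<Sum>i=1..card V - 1. int (bin (card W) (int k - int i)) * int (shifted_betti F i j))"
  proof (rule sum.mono_neutral_cong)
    fix i assume "i \<in> {1..card V - 1} - {..k}"
    then show "int (bin (card W) (int k - int i)) * int (shifted_betti F i j) = 0" by (simp add: bin_def)
  next
    fix i assume "i \<in> {..k} - {1..card V - 1}"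
    then have "i = 0 \<or> card V \<le> i" by auto
    then show "int (card W choose (k - i)) * conk.betti V (inv_sys V g) i (int j) = 0" using b0 bs by auto
  next
    fix i assume "i \<in> {..k} \<inter> {1..card V - 1}"
    then show "int (card W choose (k - i)) * conk.betti V (inv_sys V g) i (int j) =
        int (bin (card W) (int k - int i)) * int (shifted_betti F i j)"
      using bi[of i] by (auto simp: bin_def nat_diff_distrib)
  qed auto
  finally show ?thesis .
qed

theorem theorem3p33:
  fixes s t r d :: nat
    and g h f :: "'k::field dpoly"
    and F G :: "nat \<Rightarrow> int list"
    and \<delta>F \<delta>G :: "nat \<Rightarrow> (nat \<Rightarrow> 'k mpoly) \<Rightarrow> (nat \<Rightarrow> 'k mpoly)"
    and \<epsilon>F \<epsilon>G :: "(nat \<Rightarrow> 'k mpoly) \<Rightarrow> 'k mpoly"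
  assumes "s \<ge> 1" and "t \<ge> 1" and "r = s + t" and "d \<ge> 2"
    and "g \<in> in_vars {1..s} \<inter> homog (int d)"
    and "h \<in> in_vars {s+1..r} \<inter> homog (int d)"
    and "f = g + h"
    and "ann {1..s} g \<inter> homog 1 = {0}"
    and "ann {s+1..r} h \<inter> homog 1 = {0}"
    and "graded_min_free_res {1..s} s (ann {1..s} g) F \<delta>F \<epsilon>F"
    and "graded_min_free_res {s+1..r} t (ann {s+1..r} h) G \<delta>G \<epsilon>G"
  shows "\<exists>(H :: nat \<Rightarrow> int list) (\<delta>H :: nat \<Rightarrow> (nat \<Rightarrow> 'k mpoly) \<Rightarrow> (nat \<Rightarrow> 'k mpoly))
            (\<epsilon>H :: (nat \<Rightarrow> 'k mpoly) \<Rightarrow> 'k mpoly).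
    graded_min_free_res {1..r} r (ann {1..r} f) H \<delta>H \<epsilon>H \<and>
    H r = [int r + int d] \<and>
    (\<forall>k. 0 < k \<and> k < r \<longrightarrow>
      mset (H k) =
        replicate_mset (nu s t k) (int k + 1) +
        replicate_mset (nu s t (r - k)) (int d + int k - 1) +
        (\<Sum>j=1..d-1. replicate_mset
          ((\<Sum>i=1..s-1. bin (r - s) (int k - int i) * shifted_betti F i j) +
           (\<Sum>i=1..t-1. bin (r - t) (int k - int i) * shifted_betti G i j))
          (int k + int j)))"
proof -
  define V where "V = {1..s}"
  define W where "W = {s+1..r}"
  define U where "U = {1..r}"
  have fin: "finite V" "finite W" "finite U" by (auto simp: V_def W_def U_def)
  have U: "U = V \<union> W" "U = W \<union> V" and VW: "V \<inter> W = {}" "W \<inter> V = {}"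
    using assms(3) by (auto simp: V_def W_def U_def)
  have card: "card V = s" "card W = t" "card U = r" using assms(3) by (auto simp: V_def W_def U_def)
  have vw: "1 \<in> V" "r \<in> W" "1 \<in> U" using assms(1,2,3) by (auto simp: V_def W_def U_def)
  have g: "g \<in> in_vars V" "g \<in> homog (int d)" "ann V g \<inter> homog 1 = {0}"
    and h: "h \<in> in_vars W" "h \<in> homog (int d)" "ann W h \<inter> homog 1 = {0}"
    using assms by (auto simp: V_def W_def)
  have f: "f \<in> in_vars U" "f \<in> homog (int d)" "ann U f \<inter> homog 1 = {0}"
    using in_vars_mono[of V U g] in_vars_mono[of W U h] g h U(1) assms(7)
      ann_sum_linear[OF g h VW(1) assms(4)] by (auto intro: in_vars_add homog_add)
  note f0 = ann_linear_nonzero[OF f(3) vw(3)]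
  have Mg: "conk.unit_ends V U (inv_sys V g) d"
    by (rule unit_ends_inv_sys[OF fin(3) _ g(1,2) ann_linear_nonzero[OF g(3) vw(1)] g(3)]) (use U in auto)
  have Mh: "conk.unit_ends W U (inv_sys W h) d"
    by (rule unit_ends_inv_sys[OF fin(3) _ h(1,2) ann_linear_nonzero[OF h(3) vw(2)] h(3)]) (use U in auto)
  have Mf: "conk.unit_ends U U (inv_sys U f) d"
    by (rule unit_ends_inv_sys[OF fin(3) subset_refl f(1,2) f0 f(3)])
  let ?b = "conk.betti U (inv_sys U f)"
  have "\<forall>k j. \<exists>n. has_betti (pointwise smul) conX U (inv_sys U f) k j n \<and> ?b k j = int n"
    using conk.has_betti_number[OF fin(3) conk.unit_ends_submodule[OF Mf] conk.unit_ends_fin_dim[OF Mf]] by blast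
  then obtain \<beta> where \<beta>: "\<And>k j. has_betti (pointwise smul) conX U (inv_sys U f) k j (\<beta> k j)"
      "\<And>k j. ?b k j = int (\<beta> k j)" by metis
  have d: "0 < d" using assms(4) by simp
  have out: "?b k j = 0" if "j < 0 \<or> int d < j" for k j
    using conk.unit_ends_betti(3)[OF Mf fin(3) d that] .
  have "\<beta> k j = 0" if "j \<notin> {0..int d}" for k j using out[of j k] \<beta>(2)[of k j] that by auto
  then obtain H \<phi> where H: "res_seq U f H \<phi>" "\<And>i. graded_hom U (H (Suc i)) (H i) (\<phi> (Suc i))"
    using exists_res_seq[OF fin(3) f0 \<beta>(1), of "{0..int d}"] by auto
  have cnt: "int (count (mset (H k)) e) = ?b k (e - int k)" for k e
    using betti_res_seq[OF fin(3) Mf H(1), of k "e - int k"] by simp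
  have long: "H k = []" if "r < k" for k
  proof -
    have "?b k (e - int k) = 0" for e by (rule conk.betti_eq_0[OF fin(3)]) (use that card in simp)
    then have "count (mset (H k)) e = 0" for e using cnt[of k e] by (metis of_nat_eq_0_iff)
    then have "mset (H k) = {#}" by (intro multiset_eqI) simp
    then show ?thesis by simp
  qed
  have res: "graded_min_free_res U r (ann U f) H (\<lambda>i. \<phi> (Suc i)) (\<lambda>u. \<phi> 1 u 0)"
    by (rule resolution_of_res_seq[OF fin(3) f(2) H long])
  have b0: "?b k 0 = 0" if "0 < k" for k
    using conk.unit_ends_betti(1)[OF Mf fin(3) d] that gr0_implies_Suc by blast
  have bd: "?b k (int d) = (if k = r then 1 else 0)" for k
    using conk.unit_ends_betti(2)[OF Mf fin(3) d] card by simp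
  have r: "0 < r" using assms(1,3) by simp
  have "mset (H r) = {#int r + int d#}"
  proof (rule multiset_eqI)
    fix e
    consider "e - int r < 0 \<or> int d < e - int r" | "e - int r = 0" | "e - int r = int d"
      | "e - int r < int d" by linarith
    then have "?b r (e - int r) = (if e = int r + int d then 1 else 0)"
    proof cases
      case 4
      then show ?thesis using betti_socle[OF fin(3) f(1,2) f0 f(3) 4] card by auto
    qed (use out b0[OF r] bd d in auto)
    then show "count (mset (H r)) e = count {#int r + int d#} e" using cnt[of r e] by (auto split: if_splits)
  qed
  then have Hr: "H r = [int r + int d]" by simp
  define B where "B k j = (\<Sum>i=1..s-1. bin (r - s) (int k - int i) * shifted_betti F i j) +
      (\<Sum>i=1..t-1. bin (r - t) (int k - int i) * shifted_betti G i j)" for k j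
  have mid: "?b k (int j) = int (B k j + (if j = 1 then nu s t k else 0) + (if j = d - 1 then nu s t (r - k) else 0))"
    if k: "0 < k" "k < r" and j: "1 \<le> j" "j < d" for k j
  proof -
    \<comment> \<open>the contributions of \<open>M\<^sub>g\<close> and \<open>M\<^sub>h\<close>, regarded as modules over the whole ring\<close>
    have rs: "r - s = t" "r - t = s" using assms(3) by auto
    have kg: "conk.betti U (inv_sys V g) k (int j) = (\<Sum>i=1..s-1. int (bin (r - s) (int k - int i)) * int (shifted_betti F i j))"
      using betti_summand[OF fin(1,2) VW(1) vw(1) g assms(10)[folded V_def] j] card rs U(1) by simp
    have kh: "conk.betti U (inv_sys W h) k (int j) = (\<Sum>i=1..t-1. int (bin (r - t) (int k - int i)) * int (shifted_betti G i j))"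
      using betti_summand[OF fin(2,1) VW(2) vw(2) h assms(11)[folded W_def] j] card rs U(2) by simp
    have "?b k (int j) = conk.betti U (inv_sys V g) k (int j) + conk.betti U (inv_sys W h) k (int j)
        + (if int j = 1 then int (nu (card V) (card W) k) else 0)
        + (if int j = int d - 1 then int (nu (card V) (card W) (card U - k)) else 0)"
    proof (rule conk.betti_connected_sum[OF Mg Mh Mf fin(3) U(1) VW(1)])
      show "inv_sys U f i = {a + b |a b. a \<in> inv_sys V g i \<and> b \<in> inv_sys W h i}" if "1 \<le> i" for i
        unfolding U(1) assms(7) by (rule inv_sys_sum[OF g(1) h(1) VW(1) that])
      show "inv_sys V g i \<inter> inv_sys W h i \<subseteq> {0}" if "i < int d" for i
        by (rule inv_sys_disjoint[OF g(1,2) h(1) VW(1) that])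
    qed (use k j card in auto)
    then show ?thesis using j card by (auto simp: kg kh B_def)
  qed
  have "mset (H k) = replicate_mset (nu s t k) (int k + 1) + replicate_mset (nu s t (r - k)) (int d + int k - 1) +
      (\<Sum>j=1..d-1. replicate_mset (B k j) (int k + int j))" if k: "0 < k" "k < r" for k
  proof (rule multiset_eqI)
    fix e
    let ?R = "replicate_mset (nu s t k) (int k + 1) + replicate_mset (nu s t (r - k)) (int d + int k - 1) +
      (\<Sum>j=1..d-1. replicate_mset (B k j) (int k + int j))"
    have R: "count ?R e = (if e = int k + 1 then nu s t k else 0) + (if e = int d + int k - 1 then nu s t (r - k) else 0)
        + (\<Sum>j=1..d-1. if e = int k + int j then B k j else 0)"
      by (simp add: count_sum)
    show "count (mset (H k)) e = count ?R e"
    proof (cases "1 \<le> e - int k \<and> e - int k < int d")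
      case True
      define j where "j = nat (e - int k)"
      have j: "e = int k + int j" "1 \<le> j" "j < d" using True by (auto simp: j_def)
      have "(\<Sum>j'=1..d-1. if e = int k + int j' then B k j' else 0) = (\<Sum>j'=1..d-1. if j' = j then B k j' else 0)"
        by (intro sum.cong) (auto simp: j)
      also have "\<dots> = B k j"
      proof -
        have "j \<in> {1..d-1}" using j by auto
        then show ?thesis by (simp only: sum.delta finite_atLeastAtMost if_True)
      qed
      finally have "count ?R e = B k j + (if j = 1 then nu s t k else 0) + (if j = d - 1 then nu s t (r - k) else 0)"
        unfolding R using j by auto
      then show ?thesis using cnt[of k e] mid[OF k j(2,3)] j(1) by simp
    next
      case False
      have "(\<Sum>j'=1..d-1. if e = int k + int j' then B k j' else 0) = 0"
        using False by (intro sum.neutral) auto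
      then have "count ?R e = 0" unfolding R using False assms(4) by auto
      moreover have "?b k (e - int k) = 0"
      proof -
        consider "e - int k < 0 \<or> int d < e - int k" | "e - int k = 0" | "e - int k = int d"
          using False by linarith
        then show ?thesis using out b0[OF k(1)] bd k(2) by cases auto
      qed
      ultimately show ?thesis using cnt[of k e] by simp
    qed
  qed
  then show ?thesis using res Hr unfolding U_def B_def by blast
qed

end
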